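(* Let $E$ be a real-valued function on $k$-partite pure states that is fully additive, monotone on average under LOCC, and satisfies $E(\mathrm{GHZ})=1$. The following are equivalent: (1) $E$ is asymptotically continuous; (2) $E\in\mathcal{F}^{\mathrm{pure}}_k$, i.e. $\varphi\ge\psi$ implies $E(\varphi)\ge E(\psi)$ for all pure states; (3) for all $k$-partite state vectors $\varphi,\psi$ and $p\in[0,1]$, $E(\sqrt{p}\,\varphi\oplus\sqrt{1-p}\,\psi)=pE(\varphi)+(1-p)E(\psi)+h(p)$; (4) for all unit vectors $\varphi,\psi\in\mathcal{H}$ (same $k$-partite space $\mathcal{H}$), writing $\delta=D(|\varphi\rangle\langle\varphi|,|\psi\rangle\langle\psi|)$, \[ |E(\varphi)-E(\psi)|\le a(\delta)\log\dim\mathcal{H}+b(\delta), \] where \[ a(\delta)=\frac{\left(1+\delta^{\frac{2}{k+1}}\right)^{k+1}-1+\delta^2}{1-\delta^2},\qquad b(\delta)=\frac{\left(1+\delta^{\frac{2}{k+1}}\right)^{k+1}}{1-\delta^2}\,h\!\left(\left(1+\delta^{\frac{2}{k+1}}\right)^{-1}\right). \]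
   Context: Logs base 2; $h(p)=-p\log p-(1-p)\log(1-p)$. $k$-partite pure states are unit vectors in $\mathcal{H}=\mathcal{H}_1\otimes\cdots\otimes\mathcal{H}_k$ (finite-dimensional factors, arbitrary dimensions), $\dim\mathcal{H}=\prod_j\dim\mathcal{H}_j$; $E(\varphi)$ means $E(|\varphi\rangle\langle\varphi|)$; tensor products group factors per party. $\mathrm{GHZ}$ has vector $2^{-1/2}(|0\ldots0\rangle+|1\ldots1\rangle)\in(\mathbb{C}^2)^{\otimes k}$. For $\varphi\in\mathcal{H}$, $\psi\in\mathcal{K}$, $a\varphi\oplus b\psi$ is the vector $a\varphi+b\psi$ in $(\mathcal{H}_1\oplus\mathcal{K}_1)\otimes\cdots\otimes(\mathcal{H}_k\oplus\mathcal{K}_k)$. Purified distance $D(\rho,\sigma)=\sqrt{1-F(\rho,\sigma)^2}$, $F(\rho,\sigma)=\operatorname{Tr}\sqrt{\sigma^{1/2}\rho\sigma^{1/2}}$. $\rho\to_\epsilon\sigma$ means some LOCC channel $\Lambda$ has $D(\Lambda(\rho),\sigma)\le\epsilon$; for pure states, $\varphi\ge\psi$ iff $\limsup_{n\to\infty}\inf\{\epsilon\ge0:|\varphi\rangle\langle\varphi|^{\otimes n}\to_\epsilon|\psi\rangle\langle\psi|^{\otimes n}\}=0$ (the LOCC output may be mixed). $\mathcal{F}^{\mathrm{pure}}_k$ is the set of functions $E$ on pure $k$-partite states with $E(\mathrm{GHZ})=1$, $E(\varphi\otimes\psi)=E(\varphi)+E(\psi)$, and $\varphi\ge\psi\Rightarrow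 E(\varphi)\ge E(\psi)$. Fully additive: $E(\varphi\otimes\psi)=E(\varphi)+E(\psi)$. Monotone on average under LOCC: whenever an LOCC channel maps $|\varphi\rangle\langle\varphi|$ to $\sum_{x\in\mathcal{X}}P(x)|x\rangle\langle x|\otimes|\varphi_x\rangle\langle\varphi_x|$ (finite $\mathcal{X}$, classical flag known to all parties), $E(\varphi)\ge\sum_xP(x)E(\varphi_x)$. Asymptotic continuity: regard the disjoint union of pure state sets on all $\mathbb{C}^{d_1}\otimes\cdots\otimes\mathbb{C}^{d_k}$ as a metric space with purified distance between states on the same space and distance $1$ between states on different spaces; $E$ is asymptotically continuous if $E/(1+\log\dim\mathcal{H})$ is uniformly continuous on it. *)

theory Defs
  imports Complex_Main "HOL-Library.Extended_Real" "HOL-Library.Liminf_Limsup"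
begin

text \<open>A k-partite space C^{d_1} (x) ... (x) C^{d_k} is given by its list of local dimensions
  ds (length k). Basis vectors are indexed by multi-indices x (lists of length k with
  x!i < ds!i). Vectors are functions on multi-indices, operators are kernels
  (matrix entries indexed by output / input multi-indices).\<close>

type_synonym vec = "nat list \<Rightarrow> complex"
type_synonym op = "nat list \<Rightarrow> nat list \<Rightarrow> complex"

definition idxs :: "nat list \<Rightarrow> nat list set" where
  "idxs ds = {x. length x = length ds \<and> (\<forall>i<length ds. x ! i < ds ! i)}"

definition dimH :: "nat list \<Rightarrow> nat" where
  "dimH ds = prod_list ds"

definition is_state :: "nat \<Rightarrow> nat list \<Rightarrow> vec \<Rightarrow> bool" where
  "is_state k ds v \<longleftrightarrow> length ds = k \<and> (\<forall>x. x \<notin> idxs ds \<longrightarrow> v x = 0)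
     \<and> (\<Sum>x\<in>idxs ds. (cmod (v x))\<^sup>2) = 1"

definition proj :: "nat list \<Rightarrow> vec \<Rightarrow> op" where
  "proj ds v = (\<lambda>y x. if y \<in> idxs ds \<and> x \<in> idxs ds then v y * cnj (v x) else 0)"

text \<open>Functions on pure states: E takes (space, density operator); E(phi) = E(|phi><phi|).\<close>
type_synonym entfun = "nat list \<times> op \<Rightarrow> real"

definition Ev :: "entfun \<Rightarrow> nat list \<Rightarrow> vec \<Rightarrow> real" where
  "Ev E ds v = E (ds, proj ds v)"

definition mmul :: "nat list \<Rightarrow> op \<Rightarrow> op \<Rightarrow> op" where
  "mmul ds A B = (\<lambda>y x. \<Sum>z\<in>idxs ds. A y z * B z x)"

definition op_on :: "nat list \<Rightarrow> op \<Rightarrow> bool" where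
  "op_on ds A \<longleftrightarrow> (\<forall>y x. y \<notin> idxs ds \<or> x \<notin> idxs ds \<longrightarrow> A y x = 0)"

definition psd :: "nat list \<Rightarrow> op \<Rightarrow> bool" where
  "psd ds A \<longleftrightarrow> op_on ds A \<and>
     (\<forall>v. let q = (\<Sum>y\<in>idxs ds. \<Sum>x\<in>idxs ds. cnj (v y) * A y x * v x) in Im q = 0 \<and> 0 \<le> Re q)"

definition msqrt :: "nat list \<Rightarrow> op \<Rightarrow> op" where
  "msqrt ds A = (THE B. psd ds B \<and> mmul ds B B = A)"

definition trace :: "nat list \<Rightarrow> op \<Rightarrow> complex" where
  "trace ds A = (\<Sum>x\<in>idxs ds. A x x)"

definition fidelity :: "nat list \<Rightarrow> op \<Rightarrow> op \<Rightarrow> real" where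
  "fidelity ds \<rho> \<sigma> = Re (trace ds (msqrt ds (mmul ds (mmul ds (msqrt ds \<sigma>) \<rho>) (msqrt ds \<sigma>))))"

definition pdist :: "nat list \<Rightarrow> op \<Rightarrow> op \<Rightarrow> real" where
  "pdist ds \<rho> \<sigma> = sqrt (1 - (fidelity ds \<rho> \<sigma>)\<^sup>2)"

definition tensor_dims :: "nat list \<Rightarrow> nat list \<Rightarrow> nat list" where
  "tensor_dims ds es = map2 (*) ds es"

text \<open>Party i index x_i = a_i * e_i + b_i corresponds to |a_i> (x) |b_i>.\<close>
definition tensor_vec :: "nat list \<Rightarrow> vec \<Rightarrow> nat list \<Rightarrow> vec \<Rightarrow> vec" where
  "tensor_vec ds v es w = (\<lambda>x. if x \<in> idxs (tensor_dims ds es)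
      then v (map2 (div) x es) * w (map2 (mod) x es) else 0)"

primrec tpow :: "nat \<Rightarrow> nat list \<Rightarrow> vec \<Rightarrow> nat list \<times> vec" where
  "tpow 0 ds v = (replicate (length ds) 1, (\<lambda>x. if x = replicate (length ds) 0 then 1 else 0))"
| "tpow (Suc n) ds v = (tensor_dims (fst (tpow n ds v)) ds,
                        tensor_vec (fst (tpow n ds v)) (snd (tpow n ds v)) ds v)"

text \<open>a phi (+) b psi in (H_1 (+) K_1) (x) ... (x) (H_k (+) K_k): party i's index
  a < ds!i refers to H_i, ds!i + c refers to the c-th basis vector of K_i.\<close>
definition dsum_dims :: "nat list \<Rightarrow> nat list \<Rightarrow> nat list" where
  "dsum_dims ds es = map2 (+) ds es"

definition dsum_vec :: "complex \<Rightarrow> nat list \<Rightarrow> vec \<Rightarrow> complex \<Rightarrow> nat list \<Rightarrow> vec \<Rightarrow> vec" where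
  "dsum_vec a ds v b es w = (\<lambda>x. if x \<in> idxs (dsum_dims ds es) then
      (if (\<forall>i<length ds. x ! i < ds ! i) then a * v x
       else if (\<forall>i<length ds. ds ! i \<le> x ! i) then b * w (map2 (-) x ds)
       else 0) else 0)"

definition ghz_dims :: "nat \<Rightarrow> nat list" where
  "ghz_dims k = replicate k 2"

definition ghz_vec :: "nat \<Rightarrow> vec" where
  "ghz_vec k = (\<lambda>x. if x = replicate k 0 \<or> x = replicate k 1 then complex_of_real (1 / sqrt 2) else 0)"

definition local_op :: "nat list \<Rightarrow> nat \<Rightarrow> nat \<Rightarrow> (nat \<Rightarrow> nat \<Rightarrow> complex) \<Rightarrow> op" where
  "local_op ds i d' K = (\<lambda>y x. if x \<in> idxs ds \<and> y \<in> idxs (ds[i := d']) \<and>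
        (\<forall>j<length ds. j \<noteq> i \<longrightarrow> y ! j = x ! j) then K (y ! i) (x ! i) else 0)"

definition local_instr :: "nat \<Rightarrow> nat \<Rightarrow> (nat \<Rightarrow> nat \<Rightarrow> complex) list \<Rightarrow> bool" where
  "local_instr d d' Ks \<longleftrightarrow> (\<forall>a<d. \<forall>b<d.
      (\<Sum>K\<leftarrow>Ks. \<Sum>c<d'. cnj (K c a) * K c b) = (if a = b then 1 else 0))"

definition idop :: "nat list \<Rightarrow> op" where
  "idop ds = (\<lambda>y x. if x \<in> idxs ds \<and> y = x then 1 else 0)"

definition comp :: "nat list \<Rightarrow> op \<Rightarrow> op \<Rightarrow> op" where
  "comp ds A B = mmul ds A B"

text \<open>(Finite-round) LOCC instruments from space ds to space ds': a list of
  (classical outcome, Kraus operator). In each round one party applies a local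
  instrument and broadcasts the result; the remaining protocol may depend on it.
  Outcomes may be relabelled (any function of the transcript, incl. coarse-graining).\<close>
inductive LOCC :: "nat list \<Rightarrow> nat list \<Rightarrow> (nat \<times> op) list \<Rightarrow> bool" where
  idI: "LOCC ds ds [(0, idop ds)]"
| roundI: "i < length ds \<Longrightarrow> local_instr (ds ! i) d' Ks \<Longrightarrow>
     (\<forall>j<length Ks. LOCC (ds[i := d']) ds' (C j)) \<Longrightarrow>
     LOCC ds ds' (concat (map (\<lambda>j. map (\<lambda>(x, A). (prod_encode (j, x),
                 comp (ds[i := d']) A (local_op ds i d' (Ks ! j)))) (C j)) [0..<length Ks]))"
| relabelI: "LOCC ds ds' L \<Longrightarrow> LOCC ds ds' (map (\<lambda>(x, A). (f x, A)) L)"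

definition apply_op :: "nat list \<Rightarrow> op \<Rightarrow> op \<Rightarrow> op" where
  "apply_op ds A \<rho> = (\<lambda>y y'. \<Sum>z\<in>idxs ds. \<Sum>z'\<in>idxs ds. A y z * \<rho> z z' * cnj (A y' z'))"

definition outcome_out :: "nat list \<Rightarrow> (nat \<times> op) list \<Rightarrow> nat \<Rightarrow> op \<Rightarrow> op" where
  "outcome_out ds L x \<rho> = (\<lambda>y y'. sum_list (map (\<lambda>(x', A). if x' = x then apply_op ds A \<rho> y y' else 0) L))"

definition channel_out :: "nat list \<Rightarrow> (nat \<times> op) list \<Rightarrow> op \<Rightarrow> op" where
  "channel_out ds L \<rho> = (\<lambda>y y'. sum_list (map (\<lambda>(x', A). apply_op ds A \<rho> y y') L))"

definition eps_conv :: "nat list \<Rightarrow> op \<Rightarrow> nat list \<Rightarrow> op \<Rightarrow> real \<Rightarrow> bool" where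
  "eps_conv ds \<rho> ds' \<sigma> \<epsilon> \<longleftrightarrow> (\<exists>L. LOCC ds ds' L \<and> pdist ds' (channel_out ds L \<rho>) \<sigma> \<le> \<epsilon>)"

definition asym_ge :: "nat list \<Rightarrow> vec \<Rightarrow> nat list \<Rightarrow> vec \<Rightarrow> bool" where
  "asym_ge ds v es w \<longleftrightarrow>
     limsup (\<lambda>n. INF \<epsilon>\<in>{\<epsilon>. 0 \<le> \<epsilon> \<and>
        eps_conv (fst (tpow n ds v)) (proj (fst (tpow n ds v)) (snd (tpow n ds v)))
                 (fst (tpow n es w)) (proj (fst (tpow n es w)) (snd (tpow n es w))) \<epsilon>}.
        ereal \<epsilon>) = 0"

definition h :: "real \<Rightarrow> real" where
  "h p = - p * log 2 p - (1 - p) * log 2 (1 - p)"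

definition fully_additive :: "nat \<Rightarrow> entfun \<Rightarrow> bool" where
  "fully_additive k E \<longleftrightarrow> (\<forall>ds v es w. is_state k ds v \<longrightarrow> is_state k es w \<longrightarrow>
     Ev E (tensor_dims ds es) (tensor_vec ds v es w) = Ev E ds v + Ev E es w)"

definition mono_on_average :: "nat \<Rightarrow> entfun \<Rightarrow> bool" where
  "mono_on_average k E \<longleftrightarrow> (\<forall>ds v ds' L (P :: nat \<Rightarrow> real) \<phi>s.
     is_state k ds v \<longrightarrow> LOCC ds ds' L \<longrightarrow>
     (\<forall>x\<in>fst ` set L. is_state k ds' (\<phi>s x) \<and>
        outcome_out ds L x (proj ds v) = (\<lambda>y y'. complex_of_real (P x) * proj ds' (\<phi>s x) y y')) \<longrightarrow>
     (\<Sum>x\<in>fst ` set L. P x * Ev E ds' (\<phi>s x)) \<le> Ev E ds v)"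

definition F_pure :: "nat \<Rightarrow> entfun set" where
  "F_pure k = {E. Ev E (ghz_dims k) (ghz_vec k) = 1 \<and> fully_additive k E \<and>
     (\<forall>ds v es w. is_state k ds v \<longrightarrow> is_state k es w \<longrightarrow> asym_ge ds v es w \<longrightarrow>
        Ev E es w \<le> Ev E ds v)}"

text \<open>Purified distance on the disjoint union of pure-state sets (1 across spaces).\<close>
definition sdist :: "nat list \<Rightarrow> vec \<Rightarrow> nat list \<Rightarrow> vec \<Rightarrow> real" where
  "sdist ds v es w = (if ds = es then pdist ds (proj ds v) (proj es w) else 1)"

definition asym_continuous :: "nat \<Rightarrow> entfun \<Rightarrow> bool" where
  "asym_continuous k E \<longleftrightarrow> (\<forall>\<epsilon>>0. \<exists>\<delta>>0. \<forall>ds v es w. is_state k ds v \<longrightarrow> is_state k es w \<longrightarrow>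
     sdist ds v es w < \<delta> \<longrightarrow>
     \<bar>Ev E ds v / (1 + log 2 (dimH ds)) - Ev E es w / (1 + log 2 (dimH es))\<bar> < \<epsilon>)"

definition dsum_rule :: "nat \<Rightarrow> entfun \<Rightarrow> bool" where
  "dsum_rule k E \<longleftrightarrow> (\<forall>ds v es w p. is_state k ds v \<longrightarrow> is_state k es w \<longrightarrow> 0 \<le> p \<longrightarrow> p \<le> 1 \<longrightarrow>
     Ev E (dsum_dims ds es)
        (dsum_vec (complex_of_real (sqrt p)) ds v (complex_of_real (sqrt (1 - p))) es w)
     = p * Ev E ds v + (1 - p) * Ev E es w + h p)"

definition acoef :: "nat \<Rightarrow> real \<Rightarrow> real" where
  "acoef k \<delta> = ((1 + \<delta> powr (2 / (real k + 1))) ^ (k + 1) - 1 + \<delta>\<^sup>2) / (1 - \<delta>\<^sup>2)"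

definition bcoef :: "nat \<Rightarrow> real \<Rightarrow> real" where
  "bcoef k \<delta> = (1 + \<delta> powr (2 / (real k + 1))) ^ (k + 1) / (1 - \<delta>\<^sup>2)
               * h (inverse (1 + \<delta> powr (2 / (real k + 1))))"

text \<open>For delta = 1 the right-hand side is +infinity in the paper, so only delta < 1 is constrained.\<close>
definition cont_bound :: "nat \<Rightarrow> entfun \<Rightarrow> bool" where
  "cont_bound k E \<longleftrightarrow> (\<forall>ds v w. is_state k ds v \<longrightarrow> is_state k ds w \<longrightarrow>
     (let \<delta> = pdist ds (proj ds v) (proj ds w) in \<delta> < 1 \<longrightarrow>
       \<bar>Ev E ds v - Ev E ds w\<bar> \<le> acoef k \<delta> * log 2 (dimH ds) + bcoef k \<delta>))"

end

theory Submission
  imports "HOL-Analysis.Analysis" "HOL-Real_Asymp.Real_Asymp" Defs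
begin

text \<open>
  The implications are proved in the cycle (1), (2), (3), (4), (1). Throughout, \<open>E\<close> is extended to
  unnormalised vectors by \<open>Eb w = |w|\<^sup>2 E(w / |w|)\<close>, so that monotonicity on average reads: the
  sum of \<open>Eb\<close> over the outcomes of a local instrument is at most \<open>Eb\<close> of the input.

  (1) to (2): split the channel into its Kraus branches and apply Markov's inequality to the
  infidelities of the branches.

  (2) to (3), lower bound (only additivity and monotonicity on average): two copies of
  \<open>\<surd>p \<phi> \<oplus> \<surd>(1-p) \<psi>\<close> decompose by the parity of the block labels, the odd part is a GHZ state
  times \<open>\<phi> \<otimes> \<psi>\<close>, and the even part is again a direct sum. The defect from the claimed bound thus
  satisfies the recursion of Peres' randomness extractor, whose only bounded solution
  that vanishes at the end points is zero.

  (2) to (3), upper bound: up to vanishing error, a power of \<open>\<surd>p \<phi> \<oplus> \<surd>(1-p) \<psi>\<close> is a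
  superposition of typical strings of \<open>\<phi>\<close> and \<open>\<psi>\<close>; it is prepared from slightly too few copies of
  \<open>\<phi>\<close> and \<open>\<psi>\<close>, everything else (the string and the missing copies) being produced from GHZ
  states by a preparation protocol that needs one GHZ bit per bit of the size of the support. The
  same protocol gives \<open>E \<le> log dim\<close>.

  (3) to (4): with \<open>t = \<delta>\<^bsup>2/(k+1)\<^esup>\<close> and \<open>p = 1/(1+t)\<close>, let every party apply the row operator
  \<open>(\<surd>p, \<surd>(1-p))\<close> to \<open>\<surd>p \<psi> \<oplus> \<surd>(1-p) \<xi>\<close>, where \<open>\<xi>\<close> is minus the normalised component of \<open>\<psi>\<close>
  orthogonal to \<open>\<phi>\<close>. The orthogonal components cancel and \<open>\<phi>\<close> results with probability
  \<open>(1-\<delta>\<^sup>2)/(1+t)\<^bsup>k+1\<^esup>\<close>.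
\<close>

section \<open>Vectors and LOCC instruments\<close>


text \<open>The entropy \<open>h(p)\<close> is an asymptotic rate, whereas additivity and
  monotonicity on average constrain exact finite protocols only. This asymmetry shapes (2) to (3).
  Extracting \<open>h(p)\<close> has to work without any continuity, so the lower bound avoids
  typicality: every round of the pairwise extractor is exact, and the new defect is at most (1+s)/2
  times the largest one, where s = p^2 + (1-p)^2; this is a contraction away from the end points.
  Preparing the direct sum, in contrast, may fail slightly, because (2) tolerates a vanishing error.

  The obstacle in the preparation is that typical strings differ in their number of \<phi>. Using
  fewer copies than any typical string contains lets one fixed input serve all strings. The label of
  the string is then erased by local Fourier measurements; their random phase can be undone since it
  is additive over the parties.

  In (3) to (4) the exponent 2/(k+1) is forced. Relative to \<psi>, the compensating vector \<xi>
  acquires one factor sqrt t from each of the k row operators and one more from the superposition,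
  and the product of these k+1 factors must equal \<delta>.\<close>

definition vec_on :: "nat list \<Rightarrow> vec \<Rightarrow> bool" where
  "vec_on ds v \<longleftrightarrow> (\<forall>x. x \<notin> idxs ds \<longrightarrow> v x = 0)"

definition sqn :: "nat list \<Rightarrow> vec \<Rightarrow> real" where
  "sqn ds v = (\<Sum>x\<in>idxs ds. (cmod (v x))\<^sup>2)"

definition ip :: "nat list \<Rightarrow> vec \<Rightarrow> vec \<Rightarrow> complex" where
  "ip ds v w = (\<Sum>x\<in>idxs ds. cnj (v x) * w x)"

definition op_vec :: "nat list \<Rightarrow> op \<Rightarrow> vec \<Rightarrow> vec" where
  "op_vec ds A v = (\<lambda>y. \<Sum>z\<in>idxs ds. A y z * v z)"

text \<open>Coordinate form of \<open>local_op\<close>: an operator of party \<open>i\<close> mixes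
  only the entries along coordinate \<open>i\<close>, so one sum over \<open>a < ds ! i\<close>
  replaces the sum over all multi-indices.\<close>

definition local_app :: "nat list \<Rightarrow> nat \<Rightarrow> nat \<Rightarrow> (nat \<Rightarrow> nat \<Rightarrow> complex) \<Rightarrow> vec \<Rightarrow> vec" where
  "local_app ds i d' K v = (\<lambda>y. if y \<in> idxs (ds[i := d'])
     then \<Sum>a<ds ! i. K (y ! i) a * v (y[i := a]) else 0)"

lemma is_state_iff: "is_state k ds v \<longleftrightarrow> length ds = k \<and> vec_on ds v \<and> sqn ds v = 1"
  by (simp add: is_state_def vec_on_def sqn_def)

lemma idxs_Nil [simp]: "idxs [] = {[]}"
  by (auto simp: idxs_def)

lemma idxs_Cons: "idxs (d # ds) = (\<lambda>(a, x). a # x) ` ({..<d} \<times> idxs ds)"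
proof (rule set_eqI)
  fix x
  show "x \<in> idxs (d # ds) \<longleftrightarrow> x \<in> (\<lambda>(a, x). a # x) ` ({..<d} \<times> idxs ds)"
    by (cases x) (auto simp: idxs_def nth_Cons less_Suc_eq_0_disj image_iff split: nat.splits)
qed

lemma finite_idxs [simp]: "finite (idxs ds)"
  by (induction ds) (auto simp: idxs_Cons)

lemma card_idxs: "card (idxs ds) = dimH ds"
proof (induction ds)
  case (Cons d ds)
  have "inj_on (\<lambda>(a, x). a # x) ({..<d} \<times> idxs ds)" by (auto simp: inj_on_def)
  then show ?case using Cons by (simp add: idxs_Cons card_image dimH_def)
qed (simp add: dimH_def)

lemma idxsD: "x \<in> idxs ds \<Longrightarrow> i < length ds \<Longrightarrow> x ! i < ds ! i"
  by (simp add: idxs_def)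

lemma idxs_length: "x \<in> idxs ds \<Longrightarrow> length x = length ds"
  by (simp add: idxs_def)

lemma idxs_update: "x \<in> idxs ds \<Longrightarrow> a < d' \<Longrightarrow> x[i := a] \<in> idxs (ds[i := d'])"
  by (cases "i < length ds") (auto simp: idxs_def nth_list_update)

lemma idxs_update_same: "y \<in> idxs (ds[i := d']) \<Longrightarrow> a < ds ! i \<Longrightarrow> y[i := a] \<in> idxs ds"
  by (metis idxs_update list_update_id list_update_overwrite)

text \<open>The fibres along coordinate \<open>i\<close> are indexed by \<open>ds[i := 1]\<close>,
  whose multi-indices have 0 in that place. Statements about one party's operators thereby reduce to
  vectors of length \<open>ds ! i\<close>.\<close>

lemma sum_idxs_split:
  assumes "i < length ds"
  shows "sum f (idxs ds) = (\<Sum>x\<in>idxs (ds[i := 1]). \<Sum>a<ds ! i. f (x[i := a]))"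
proof -
  have "sum f (idxs ds) = (\<Sum>(x, a)\<in>idxs (ds[i := 1]) \<times> {..<ds ! i}. f (x[i := a]))"
  proof (rule sum.reindex_bij_witness[where i = "\<lambda>(x, a). x[i := a]" and j = "\<lambda>x. (x[i := 0], x ! i)"], goal_cases)
    case (2 x)
    then show ?case using assms idxsD[OF 2 assms] idxs_update[OF 2, of 0 1 i] by auto
  next
    case (3 b)
    then obtain x a where b: "b = (x, a)" "x \<in> idxs (ds[i := 1])" "a < ds ! i" by auto
    have "x ! i = 0" using idxsD[OF b(2), of i] assms by simp
    moreover have "length x = length ds" using idxs_length[OF b(2)] by simp
    ultimately show ?case using b(1) assms by (simp add: list_update_same_conv)
  next
    case (4 b)
    then show ?case using idxs_update_same by auto
  qed (use assms in auto)
  then show ?thesis by (simp add: sum.cartesian_product)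
qed

lemma sqn_nonneg: "0 \<le> sqn ds v"
  by (simp add: sqn_def sum_nonneg)

lemma sqn_eq_0: "vec_on ds v \<Longrightarrow> sqn ds v = 0 \<Longrightarrow> v = (\<lambda>_. 0)"
  by (rule ext) (auto simp: vec_on_def sqn_def sum_nonneg_eq_0_iff)

lemma sqn_scale: "sqn ds (\<lambda>x. c * v x) = (cmod c)\<^sup>2 * sqn ds v"
  by (simp add: sqn_def norm_mult power_mult_distrib sum_distrib_left)

lemma sqn_ip: "complex_of_real (sqn ds v) = ip ds v v"
  unfolding sqn_def ip_def by (simp add: complex_norm_square mult.commute del: of_real_power)

lemma local_op_vec:
  assumes "i < length ds"
  shows "op_vec ds (local_op ds i d' K) v = local_app ds i d' K v"
proof
  fix y
  show "op_vec ds (local_op ds i d' K) v y = local_app ds i d' K v y"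
  proof (cases "y \<in> idxs (ds[i := d'])")
    case True
    have len: "length y = length ds" using idxs_length[OF True] by simp
    let ?S = "(\<lambda>a. y[i := a]) ` {..<ds ! i}"
    have sub: "?S \<subseteq> idxs ds" using idxs_update_same[OF True] by auto
    have inj: "inj_on (\<lambda>a. y[i := a]) {..<ds ! i}"
      by (rule inj_onI) (metis assms len nth_list_update_eq)
    have zero: "local_op ds i d' K y z * v z = 0" if z: "z \<in> idxs ds - ?S" for z
    proof -
      have "\<not> (\<forall>j<length ds. j \<noteq> i \<longrightarrow> y ! j = z ! j)"
      proof
        assume *: "\<forall>j<length ds. j \<noteq> i \<longrightarrow> y ! j = z ! j"
        have "z = y[i := z ! i]"
          using * len idxs_length[of z ds] z assms by (intro nth_equalityI) (auto simp: nth_list_update)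
        then show False using z idxsD[of z ds i] assms by blast
      qed
      then show ?thesis by (auto simp: local_op_def)
    qed
    have "op_vec ds (local_op ds i d' K) v y = (\<Sum>z\<in>?S. local_op ds i d' K y z * v z)"
      unfolding op_vec_def by (rule sum.mono_neutral_right) (use sub zero in auto)
    also have "\<dots> = (\<Sum>a<ds ! i. local_op ds i d' K y (y[i := a]) * v (y[i := a]))"
      by (simp add: sum.reindex[OF inj])
    also have "\<dots> = local_app ds i d' K v y"
      using True idxs_update_same[OF True] assms len
      by (auto simp: local_app_def local_op_def intro!: sum.cong)
    finally show ?thesis .
  next
    case False
    then show ?thesis by (simp add: op_vec_def local_app_def local_op_def)
  qed
qed

text \<open>Completeness of the instrument: once the squares are expanded, summing over outcomes and
  output states first leaves the Kronecker delta of \<open>a\<close> and \<open>b\<close>.\<close>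

lemma instr_sqn:
  assumes "local_instr d d' Ks"
  shows "(\<Sum>j<length Ks. \<Sum>c<d'. (cmod (\<Sum>a<d. (Ks ! j) c a * z a))\<^sup>2) = (\<Sum>a<d. (cmod (z a))\<^sup>2)"
proof -
  have I: "(\<Sum>j<length Ks. \<Sum>c<d'. cnj ((Ks ! j) c a) * (Ks ! j) c b) = (if a = b then 1 else 0)"
    if "a < d" "b < d" for a b
    using assms that unfolding local_instr_def sum_list_sum_nth atLeast0LessThan
    by (auto simp: atLeast0LessThan)
  have "complex_of_real (\<Sum>j<length Ks. \<Sum>c<d'. (cmod (\<Sum>a<d. (Ks ! j) c a * z a))\<^sup>2)
     = (\<Sum>j<length Ks. \<Sum>c<d'. (\<Sum>a<d. (Ks ! j) c a * z a) * cnj (\<Sum>a<d. (Ks ! j) c a * z a))"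
    by (simp add: complex_norm_square del: of_real_power)
  also have "\<dots> = (\<Sum>j<length Ks. \<Sum>c<d'. \<Sum>b<d. \<Sum>a<d. cnj (z a) * z b * (cnj ((Ks ! j) c a) * (Ks ! j) c b))"
    by (simp add: sum_product algebra_simps)
  also have "\<dots> = (\<Sum>j<length Ks. \<Sum>b<d. \<Sum>c<d'. \<Sum>a<d. cnj (z a) * z b * (cnj ((Ks ! j) c a) * (Ks ! j) c b))"
    by (rule sum.cong[OF refl], rule sum.swap)
  also have "\<dots> = (\<Sum>b<d. \<Sum>j<length Ks. \<Sum>a<d. \<Sum>c<d'. cnj (z a) * z b * (cnj ((Ks ! j) c a) * (Ks ! j) c b))"
    by (subst sum.swap, rule sum.cong[OF refl], rule sum.cong[OF refl], rule sum.swap)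
  also have "\<dots> = (\<Sum>b<d. \<Sum>a<d. cnj (z a) * z b * (\<Sum>j<length Ks. \<Sum>c<d'. cnj ((Ks ! j) c a) * (Ks ! j) c b))"
    by (rule sum.cong[OF refl], subst sum.swap) (simp add: sum_distrib_left)
  also have "\<dots> = (\<Sum>b<d. \<Sum>a<d. if a = b then cnj (z a) * z b else 0)"
    by (intro sum.cong refl) (simp add: I)
  also have "\<dots> = complex_of_real (\<Sum>a<d. (cmod (z a))\<^sup>2)"
    by (simp add: complex_norm_square mult.commute del: of_real_power)
  finally show ?thesis using of_real_eq_iff by blast
qed

lemma local_app_sqn:
  assumes "i < length ds" "local_instr (ds ! i) d' Ks"
  shows "(\<Sum>j<length Ks. sqn (ds[i := d']) (local_app ds i d' (Ks ! j) v)) = sqn ds v"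
proof -
  have "sqn (ds[i := d']) (local_app ds i d' K v)
     = (\<Sum>x\<in>idxs (ds[i := 1]). \<Sum>c<d'. (cmod (\<Sum>a<ds ! i. K c a * v (x[i := a])))\<^sup>2)" for K
  proof -
    have "sqn (ds[i := d']) (local_app ds i d' K v)
      = (\<Sum>x\<in>idxs (ds[i := 1]). \<Sum>c<d'. (cmod (local_app ds i d' K v (x[i := c])))\<^sup>2)"
      unfolding sqn_def using assms by (subst sum_idxs_split[where i = i]) auto
    also have "\<dots> = (\<Sum>x\<in>idxs (ds[i := 1]). \<Sum>c<d'. (cmod (\<Sum>a<ds ! i. K c a * v (x[i := a])))\<^sup>2)"
    proof (intro sum.cong refl)
      fix x c assume x: "x \<in> idxs (ds[i := 1])" "c \<in> {..<d'}"
      have "x[i := c] \<in> idxs (ds[i := d'])" using idxs_update[OF x(1), of c d' i] x(2) by simp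
      moreover have "length x = length ds" using idxs_length[OF x(1)] by simp
      ultimately show "(cmod (local_app ds i d' K v (x[i := c])))\<^sup>2 = (cmod (\<Sum>a<ds ! i. K c a * v (x[i := a])))\<^sup>2"
        using assms by (simp add: local_app_def)
    qed
    finally show ?thesis .
  qed
  then have "(\<Sum>j<length Ks. sqn (ds[i := d']) (local_app ds i d' (Ks ! j) v))
     = (\<Sum>x\<in>idxs (ds[i := 1]). \<Sum>j<length Ks. \<Sum>c<d'. (cmod (\<Sum>a<ds ! i. (Ks ! j) c a * v (x[i := a])))\<^sup>2)"
    by (simp only:) (rule sum.swap)
  also have "\<dots> = (\<Sum>x\<in>idxs (ds[i := 1]). \<Sum>a<ds ! i. (cmod (v (x[i := a])))\<^sup>2)"
    by (simp add: instr_sqn[OF assms(2)])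
  also have "\<dots> = sqn ds v" unfolding sqn_def by (rule sum_idxs_split[OF assms(1), symmetric])
  finally show ?thesis .
qed

lemma op_vec_comp: "op_vec ds (comp es A B) v = op_vec es A (op_vec ds B v)"
proof
  fix y
  have "op_vec ds (comp es A B) v y = (\<Sum>z\<in>idxs ds. \<Sum>u\<in>idxs es. A y u * B u z * v z)"
    by (simp add: op_vec_def comp_def mmul_def sum_distrib_right)
  also have "\<dots> = op_vec es A (op_vec ds B v) y"
    by (subst sum.swap) (simp add: op_vec_def sum_distrib_left mult.assoc)
  finally show "op_vec ds (comp es A B) v y = op_vec es A (op_vec ds B v) y" .
qed

lemma op_vec_idop: "vec_on ds v \<Longrightarrow> op_vec ds (idop ds) v = v"
proof
  fix y assume v: "vec_on ds v"
  have "op_vec ds (idop ds) v y = (\<Sum>z\<in>idxs ds. if z = y then v z else 0)"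
    unfolding op_vec_def idop_def by (intro sum.cong) auto
  then show "op_vec ds (idop ds) v y = v y" using v by (simp add: vec_on_def)
qed

lemma sum_list_concat: "sum_list (concat xss) = sum_list (map sum_list (xss :: 'a :: monoid_add list list))"
  by (induction xss) auto

text \<open>Nonemptiness excludes a degenerate case: a party with a zero-dimensional space admits
  the empty instrument, and the resulting empty list is an instrument into any space.\<close>

lemma LOCC_length: "LOCC ds es L \<Longrightarrow> L \<noteq> [] \<Longrightarrow> length es = length ds"
proof (induction rule: LOCC.induct)
  case (roundI i ds d' Ks ds' C)
  then obtain j where "j < length Ks" "C j \<noteq> []" by auto
  then show ?case using roundI by auto
qed auto

lemma LOCC_support:
  "LOCC ds es L \<Longrightarrow> (x, A) \<in> set L \<Longrightarrow> y \<notin> idxs es \<Longrightarrow> A y z = 0"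
proof (induction arbitrary: x A z rule: LOCC.induct)
  case (roundI i ds d' Ks ds' C)
  then obtain j x' A' where j: "j < length Ks" "(x', A') \<in> set (C j)"
    "A = comp (ds[i := d']) A' (local_op ds i d' (Ks ! j))" by auto
  have "A' y u = 0" for u using roundI.IH j(1,2) roundI.prems(2) by blast
  then show ?case using j(3) by (simp add: comp_def mmul_def)
next
  case (relabelI ds ds' L f)
  then show ?case by fastforce
qed (auto simp: idop_def)

lemma LOCC_sqn: "LOCC ds es L \<Longrightarrow> (\<Sum>(x, A)\<leftarrow>L. sqn es (op_vec ds A v)) = sqn ds v"
proof (induction arbitrary: v rule: LOCC.induct)
  case (idI ds)
  have "sqn ds (op_vec ds (idop ds) v) = sqn ds v"
    unfolding sqn_def
  proof (rule sum.cong[OF refl])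
    fix x assume "x \<in> idxs ds"
    then have "op_vec ds (idop ds) v x = (\<Sum>z\<in>idxs ds. if z = x then v z else 0)"
      unfolding op_vec_def idop_def by (intro sum.cong) auto
    with \<open>x \<in> idxs ds\<close> show "(cmod (op_vec ds (idop ds) v x))\<^sup>2 = (cmod (v x))\<^sup>2" by simp
  qed
  then show ?case by simp
next
  case (roundI i ds d' Ks ds' C)
  have "(\<Sum>(x, A)\<leftarrow>concat (map (\<lambda>j. map (\<lambda>(x, A). (prod_encode (j, x),
          comp (ds[i := d']) A (local_op ds i d' (Ks ! j)))) (C j)) [0..<length Ks]). sqn ds' (op_vec ds A v))
     = (\<Sum>j\<leftarrow>[0..<length Ks]. \<Sum>(x, A)\<leftarrow>C j. sqn ds' (op_vec (ds[i := d']) A (local_app ds i d' (Ks ! j) v)))"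
    by (simp add: map_concat sum_list_concat o_def case_prod_unfold op_vec_comp local_op_vec[OF roundI.hyps(1)])
  also have "\<dots> = (\<Sum>j\<leftarrow>[0..<length Ks]. sqn (ds[i := d']) (local_app ds i d' (Ks ! j) v))"
    by (rule arg_cong[where f = sum_list], rule map_cong) (use roundI.IH in auto)
  also have "\<dots> = (\<Sum>j<length Ks. sqn (ds[i := d']) (local_app ds i d' (Ks ! j) v))"
    by (simp add: interv_sum_list_conv_sum_set_nat atLeast0LessThan)
  also have "\<dots> = sqn ds v" by (rule local_app_sqn[OF roundI.hyps(1,2)])
  finally show ?case .
next
  case (relabelI ds ds' L f)
  then show ?case by (simp add: case_prod_unfold o_def)
qed

text \<open>Coarse-graining may merge several Kraus operators under one flag, and the conditional
  output is then mixed. Dropping all relabellings separates them again, because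
  \<open>prod_encode\<close> records the transcript injectively. Each flag then has a pure output,
  as \<open>mono_on_average\<close> demands.\<close>

lemma LOCC_distinct:
  "LOCC ds es L \<Longrightarrow> \<exists>L'. LOCC ds es L' \<and> distinct (map fst L') \<and> map snd L' = map snd L"
proof (induction rule: LOCC.induct)
  case (idI ds)
  show ?case by (rule exI[where x = "[(0, idop ds)]"]) (auto intro: LOCC.idI)
next
  case (roundI i ds d' Ks ds' C)
  then have "\<forall>j<length Ks. \<exists>L'. LOCC (ds[i := d']) ds' L' \<and> distinct (map fst L') \<and> map snd L' = map snd (C j)"
    by blast
  then obtain C' where C': "\<And>j. j < length Ks \<Longrightarrow> LOCC (ds[i := d']) ds' (C' j)"
    "\<And>j. j < length Ks \<Longrightarrow> distinct (map fst (C' j))"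
    "\<And>j. j < length Ks \<Longrightarrow> map snd (C' j) = map snd (C j)"
    by metis
  let ?L = "\<lambda>n C. concat (map (\<lambda>j. map (\<lambda>(x, A). (prod_encode (j, x),
          comp (ds[i := d']) A (local_op ds i d' (Ks ! j)))) (C j)) [0..<n])"
  have "n \<le> length Ks \<Longrightarrow> distinct (map fst (?L n C')) \<and> map snd (?L n C') = map snd (?L n C)" for n
  proof (induction n)
    case (Suc n)
    then have n: "n < length Ks" by simp
    have 1: "map fst (map (\<lambda>(x, A). (prod_encode (n, x),
          comp (ds[i := d']) A (local_op ds i d' (Ks ! n)))) (C' n)) = map (\<lambda>x. prod_encode (n, x)) (map fst (C' n))"
      by auto
    have 2: "distinct (map (\<lambda>x. prod_encode (n, x)) (map fst (C' n)))"
      using C'(2)[OF n] by (subst distinct_map) (auto simp: inj_on_def)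
    have 3: "map snd (map (\<lambda>(x, A). (prod_encode (n, x),
          comp (ds[i := d']) A (local_op ds i d' (Ks ! n)))) (D n))
        = map (\<lambda>A. comp (ds[i := d']) A (local_op ds i d' (Ks ! n))) (map snd (D n))" for D
      by auto
    have 4: "z < n" if "z' \<in> set (?L n C')" "fst z' = prod_encode (z, y)" for z z' y
      using that by auto
    show ?case using Suc 2 C'(3)[OF n]
      by (auto simp: 1 3 simp del: map_map dest!: 4)
  qed simp
  from this[of "length Ks"] show ?case
    using LOCC.roundI[OF roundI.hyps(1,2), of ds' C'] C'(1) by blast
next
  case (relabelI ds ds' L f)
  then show ?case by (auto simp: case_prod_unfold o_def)
qed

section \<open>Ensembles of unnormalised branch vectors\<close>

definition ens :: "nat list \<Rightarrow> vec \<Rightarrow> nat list \<Rightarrow> vec list \<Rightarrow> bool" where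
  "ens ds v es ws \<longleftrightarrow> (\<exists>L. LOCC ds es L \<and> ws = map (\<lambda>A. op_vec ds A v) (map snd L))"

lemma ens_id: "vec_on ds v \<Longrightarrow> ens ds v ds [v]"
  unfolding ens_def by (rule exI[where x = "[(0, idop ds)]"]) (auto intro: LOCC.idI simp: op_vec_idop)

lemma ens_round:
  assumes "i < length ds" "local_instr (ds ! i) d' Ks"
    and "\<And>j. j < length Ks \<Longrightarrow> ens (ds[i := d']) (local_app ds i d' (Ks ! j) v) es (C j)"
  shows "ens ds v es (concat (map C [0..<length Ks]))"
proof -
  obtain L where L: "\<And>j. j < length Ks \<Longrightarrow> LOCC (ds[i := d']) es (L j)"
    "\<And>j. j < length Ks \<Longrightarrow> C j = map (\<lambda>A. op_vec (ds[i := d']) A (local_app ds i d' (Ks ! j) v)) (map snd (L j))"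
    using assms(3) unfolding ens_def by metis
  have "LOCC ds es (concat (map (\<lambda>j. map (\<lambda>(x, A). (prod_encode (j, x),
                 comp (ds[i := d']) A (local_op ds i d' (Ks ! j)))) (L j)) [0..<length Ks]))"
    using L(1) by (intro LOCC.roundI assms) auto
  moreover have "concat (map C [0..<length Ks]) = map (\<lambda>A. op_vec ds A v) (map snd (concat (map (\<lambda>j. map (\<lambda>(x, A). (prod_encode (j, x),
                 comp (ds[i := d']) A (local_op ds i d' (Ks ! j)))) (L j)) [0..<length Ks])))"
    unfolding map_concat map_map o_def
    by (rule arg_cong[where f = concat], rule map_cong)
       (auto simp: L(2) case_prod_unfold op_vec_comp local_op_vec[OF assms(1)] o_def)
  ultimately show ?thesis unfolding ens_def by blast
qed

lemma ens_sqn: "ens ds v es ws \<Longrightarrow> (\<Sum>w\<leftarrow>ws. sqn es w) = sqn ds v"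
  using LOCC_sqn[of ds es _ v] by (auto simp: ens_def o_def case_prod_unfold)

lemma ens_vec_on: "ens ds v es ws \<Longrightarrow> w \<in> set ws \<Longrightarrow> vec_on es w"
  unfolding ens_def vec_on_def op_vec_def by (auto simp: LOCC_support intro!: sum.neutral)

text \<open>Mostly used for the predicate of being a multiple of a fixed vector; the conversion is
  then deterministic, and the squared moduli of the scalars are the branch probabilities.\<close>

definition reach :: "nat list \<Rightarrow> vec \<Rightarrow> nat list \<Rightarrow> (vec \<Rightarrow> bool) \<Rightarrow> bool" where
  "reach ds v es P \<longleftrightarrow> (\<exists>ws. ens ds v es ws \<and> (\<forall>w\<in>set ws. P w))"

lemma reach_id: "vec_on ds v \<Longrightarrow> P v \<Longrightarrow> reach ds v ds P"
  unfolding reach_def using ens_id by fastforce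

lemma reach_round:
  assumes "i < length ds" "local_instr (ds ! i) d' Ks"
    and "\<And>j. j < length Ks \<Longrightarrow> reach (ds[i := d']) (local_app ds i d' (Ks ! j) v) es P"
  shows "reach ds v es P"
proof -
  obtain C where "\<And>j. j < length Ks \<Longrightarrow> ens (ds[i := d']) (local_app ds i d' (Ks ! j) v) es (C j)"
    "\<And>j. j < length Ks \<Longrightarrow> \<forall>w\<in>set (C j). P w"
    using assms(3) unfolding reach_def by metis
  then show ?thesis unfolding reach_def using ens_round[OF assms(1,2), of v es C] by fastforce
qed

section \<open>Tensor products of local operators\<close>

definition prod_app :: "nat list \<Rightarrow> nat list \<Rightarrow> (nat \<Rightarrow> nat \<Rightarrow> nat \<Rightarrow> complex) \<Rightarrow> vec \<Rightarrow> vec" where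
  "prod_app ds es F v = (\<lambda>y. if y \<in> idxs es
     then \<Sum>x\<in>idxs ds. (\<Prod>i<length ds. F i (y ! i) (x ! i)) * v x else 0)"

definition id_mat :: "nat \<Rightarrow> nat \<Rightarrow> complex" where
  "id_mat b a = (if b = a then 1 else 0)"

lemma vec_on_prod_app: "vec_on es (prod_app ds es F v)"
  by (simp add: vec_on_def prod_app_def)

lemma prod_app_cong:
  "(\<And>i. i < length ds \<Longrightarrow> F i = G i) \<Longrightarrow> prod_app ds es F v = prod_app ds es G v"
  unfolding prod_app_def by (intro ext if_cong sum.cong refl arg_cong2[where f = "(*)"] prod.cong) auto

lemma prod_app_id:
  assumes "vec_on ds v" "\<And>i. i < length ds \<Longrightarrow> F i = id_mat"
  shows "prod_app ds ds F v = v"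
proof
  fix y
  show "prod_app ds ds F v y = v y"
  proof (cases "y \<in> idxs ds")
    case True
    have "(\<Prod>i<length ds. F i (y ! i) (x ! i)) = (if x = y then 1 else 0)" if x: "x \<in> idxs ds" for x
    proof (cases "x = y")
      case False
      then obtain i where "i < length ds" "x ! i \<noteq> y ! i"
        using True x by (metis idxs_length nth_equalityI)
      then show ?thesis using False assms(2) by (auto simp: id_mat_def intro!: prod_zero bexI[of _ i])
    qed (simp add: assms(2) id_mat_def)
    then have "(\<Sum>x\<in>idxs ds. (\<Prod>i<length ds. F i (y ! i) (x ! i)) * v x) = (\<Sum>x\<in>idxs ds. if x = y then v x else 0)"
      by (intro sum.cong) auto
    then have "prod_app ds ds F v y = (\<Sum>x\<in>idxs ds. if x = y then v x else 0)"
      using True by (simp add: prod_app_def)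
    then show ?thesis using True by simp
  qed (use assms in \<open>simp add: vec_on_def prod_app_def\<close>)
qed

text \<open>The space \<open>take m es @ drop m ds\<close> is the one after the first
  \<open>m\<close> parties have acted. Party \<open>m\<close> still carries the identity, which its
  operator \<open>K\<close> replaces.\<close>

lemma prod_app_step:
  assumes "m < length ds" "length es = length ds" "F m = id_mat"
  shows "local_app (take m es @ drop m ds) m (es ! m) K (prod_app ds (take m es @ drop m ds) F v)
    = prod_app ds (take (Suc m) es @ drop (Suc m) ds) (F(m := K)) v"
proof
  let ?p = "take m es @ drop m ds" and ?q = "take (Suc m) es @ drop (Suc m) ds"
  have pq: "?p[m := es ! m] = ?q"
    using assms by (intro nth_equalityI) (auto simp: nth_list_update nth_append)
  have pm: "?p ! m = ds ! m" using assms by (simp add: nth_append)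
  fix y
  show "local_app ?p m (es ! m) K (prod_app ds ?p F v) y = prod_app ds ?q (F(m := K)) v y"
  proof (cases "y \<in> idxs ?q")
    case True
    have len: "length y = length ds" using idxs_length[OF True] assms by simp
    let ?G = "\<lambda>x. \<Prod>i\<in>{..<length ds} - {m}. F i (y ! i) (x ! i)"
    have ya: "y[m := a] \<in> idxs ?p" if "a < ds ! m" for a
      using idxs_update_same[of y ?p m "es ! m" a] True pq pm that by simp
    have prodF: "(\<Prod>i<length ds. F i (y[m := a] ! i) (x ! i)) = id_mat a (x ! m) * ?G x" for a x
    proof -
      have "(\<Prod>i<length ds. F i (y[m := a] ! i) (x ! i))
         = F m (y[m := a] ! m) (x ! m) * (\<Prod>i\<in>{..<length ds} - {m}. F i (y[m := a] ! i) (x ! i))"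
        using assms by (subst prod.remove[where x = m]) auto
      also have "(\<Prod>i\<in>{..<length ds} - {m}. F i (y[m := a] ! i) (x ! i)) = ?G x"
        by (rule prod.cong) auto
      finally show ?thesis using assms len by simp
    qed
    have "local_app ?p m (es ! m) K (prod_app ds ?p F v) y
       = (\<Sum>a<ds ! m. K (y ! m) a * (\<Sum>x\<in>idxs ds. id_mat a (x ! m) * ?G x * v x))"
      using True ya unfolding local_app_def pq pm by (auto simp: prod_app_def prodF intro!: sum.cong)
    also have "\<dots> = (\<Sum>x\<in>idxs ds. \<Sum>a<ds ! m. K (y ! m) a * (id_mat a (x ! m) * ?G x * v x))"
      unfolding sum_distrib_left by (rule sum.swap)
    also have "\<dots> = (\<Sum>x\<in>idxs ds. K (y ! m) (x ! m) * ?G x * v x)"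
    proof (rule sum.cong[OF refl])
      fix x assume "x \<in> idxs ds"
      then have "x ! m < ds ! m" using assms by (simp add: idxsD)
      moreover have "(\<Sum>a<ds ! m. K (y ! m) a * (id_mat a (x ! m) * ?G x * v x))
         = (\<Sum>a<ds ! m. if a = x ! m then K (y ! m) a * ?G x * v x else 0)"
        by (intro sum.cong) (auto simp: id_mat_def)
      ultimately show "(\<Sum>a<ds ! m. K (y ! m) a * (id_mat a (x ! m) * ?G x * v x)) = K (y ! m) (x ! m) * ?G x * v x"
        by simp
    qed
    also have "\<dots> = prod_app ds ?q (F(m := K)) v y"
    proof -
      have "(\<Prod>i<length ds. (F(m := K)) i (y ! i) (x ! i)) = K (y ! m) (x ! m) * ?G x" for x
        using assms by (subst prod.remove[where x = m]) (auto intro!: prod.cong)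
      then show ?thesis using True by (simp add: prod_app_def)
    qed
    finally show ?thesis .
  qed (simp add: local_app_def prod_app_def pq)
qed

text \<open>All parties act independently of each other's results, and \<open>\<tau>\<close>
  collects their outcomes. The induction runs downwards in the number of parties that have acted,
  because \<open>reach_round\<close> puts a round in front of an existing protocol.\<close>

lemma reach_par:
  assumes "length es = length ds" "vec_on ds v"
    and instr: "\<And>i. i < length ds \<Longrightarrow> local_instr (ds ! i) (es ! i) (Ks i)"
    and reach: "\<And>\<tau>. (\<And>i. i < length ds \<Longrightarrow> \<tau> i < length (Ks i)) \<Longrightarrow>
        reach es (prod_app ds es (\<lambda>i. Ks i ! \<tau> i) v) fs P"
  shows "reach ds v fs P"
proof (cases "\<forall>i<length ds. Ks i \<noteq> []")
  case True
  let ?p = "\<lambda>m. take m es @ drop m ds"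
  let ?F = "\<lambda>m \<tau> i. if i < m then Ks i ! \<tau> i else id_mat"
  have "m \<le> length ds \<Longrightarrow> \<forall>\<tau>. (\<forall>i<length ds. \<tau> i < length (Ks i)) \<longrightarrow>
      reach (?p m) (prod_app ds (?p m) (?F m \<tau>) v) fs P" for m
  proof (induction rule: inc_induct)
    case base
    then show ?case
      using reach assms(1) prod_app_cong[of ds "?F (length ds) _" "\<lambda>i. Ks i ! _ i"] by simp
  next
    case (step m)
    show ?case
    proof (intro allI impI)
      fix \<tau> assume \<tau>: "\<forall>i<length ds. \<tau> i < length (Ks i)"
      have pm: "?p m ! m = ds ! m" using step assms by (simp add: nth_append)
      have pq: "(?p m)[m := es ! m] = ?p (Suc m)"
        using step assms by (intro nth_equalityI) (auto simp: nth_list_update nth_append)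
      show "reach (?p m) (prod_app ds (?p m) (?F m \<tau>) v) fs P"
      proof (rule reach_round[where i = m and d' = "es ! m" and Ks = "Ks m"])
        show "m < length (?p m)" using step assms by simp
        show "local_instr (?p m ! m) (es ! m) (Ks m)" using instr step by (simp add: pm)
        fix j assume j: "j < length (Ks m)"
        have "local_app (?p m) m (es ! m) (Ks m ! j) (prod_app ds (?p m) (?F m \<tau>) v)
           = prod_app ds (?p (Suc m)) ((?F m \<tau>)(m := Ks m ! j)) v"
          using step assms by (intro prod_app_step) auto
        also have "(?F m \<tau>)(m := Ks m ! j) = ?F (Suc m) (\<tau>(m := j))" by auto
        finally show "reach ((?p m)[m := es ! m]) (local_app (?p m) m (es ! m) (Ks m ! j)
            (prod_app ds (?p m) (?F m \<tau>) v)) fs P"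
          using step.IH \<tau> j unfolding pq by simp
      qed
    qed
  qed
  from this[of 0] have "reach ds (prod_app ds ds (\<lambda>_. id_mat) v) fs P"
    using True by (auto dest!: spec[where x = "\<lambda>_. 0"])
  then show ?thesis using prod_app_id[OF assms(2)] by simp
next
  case False
  \<comment> \<open>An empty instrument has no outcomes, so no branch has to satisfy the
    predicate.\<close>
  then obtain i where i: "i < length ds" "Ks i = []" by blast
  show ?thesis
    using reach_round[OF i(1) instr[OF i(1)], of v fs P] i(2) by simp
qed

lemma apply_op_proj:
  "apply_op ds A (proj ds v) y y' = op_vec ds A v y * cnj (op_vec ds A v y')"
  unfolding apply_op_def op_vec_def cnj_sum sum_product
  by (intro sum.cong refl) (simp add: proj_def)

lemma channel_out_proj:
  "channel_out ds L (proj ds v) y y' = (\<Sum>w\<leftarrow>map (\<lambda>A. op_vec ds A v) (map snd L). w y * cnj (w y'))"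
  unfolding channel_out_def apply_op_proj by (simp add: o_def case_prod_unfold)

lemma ip_Cauchy_Schwarz: "(cmod (ip ds v w))\<^sup>2 \<le> sqn ds v * sqn ds w"
proof -
  have "cmod (ip ds v w) \<le> (\<Sum>x\<in>idxs ds. cmod (v x) * cmod (w x))"
    unfolding ip_def by (rule order_trans[OF norm_sum]) (simp add: norm_mult)
  then have "(cmod (ip ds v w))\<^sup>2 \<le> (\<Sum>x\<in>idxs ds. cmod (v x) * cmod (w x))\<^sup>2"
    by (rule power_mono) simp
  also have "\<dots> \<le> sqn ds v * sqn ds w"
    unfolding sqn_def by (rule Cauchy_Schwarz_ineq_sum)
  finally show ?thesis .
qed

lemma ip_commute: "ip ds w v = cnj (ip ds v w)"
  by (simp add: ip_def mult.commute)

section \<open>Purified distance to a pure state\<close>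

definition qform :: "nat list \<Rightarrow> op \<Rightarrow> vec \<Rightarrow> vec \<Rightarrow> complex" where
  "qform ds A v u = (\<Sum>y\<in>idxs ds. \<Sum>x\<in>idxs ds. cnj (v y) * A y x * u x)"

text \<open>Polarisation: the quadratic form is real on the basis vectors e_y and e_z, on e_y + e_z
  and on e_y + i e_z, which determines the imaginary and the real part of the difference between an
  entry and its conjugate transpose.\<close>

lemma psd_hermitian:
  assumes "psd ds A"
  shows "A z y = cnj (A y z)"
proof (cases "y \<in> idxs ds \<and> z \<in> idxs ds")
  case True
  define e where "e = (\<lambda>y x. if x = (y :: nat list) then 1 else 0 :: complex)"
  have ee: "qform ds A (e y) (e z) = A y z" if "y \<in> idxs ds" "z \<in> idxs ds" for y z
  proof -
    have "qform ds A (e y) (e z) = (\<Sum>y'\<in>idxs ds. \<Sum>x\<in>idxs ds. if x = z then (if y' = y then A y' x else 0) else 0)"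
      unfolding qform_def e_def by (intro sum.cong) auto
    then show ?thesis using that by simp
  qed
  have lin: "qform ds A (\<lambda>x. e y x + c * e z x) (\<lambda>x. e y x + c * e z x)
     = A y y + c * A y z + cnj c * A z y + cnj c * c * A z z" for c
  proof -
    have "qform ds A (\<lambda>x. e y x + c * e z x) (\<lambda>x. e y x + c * e z x)
      = qform ds A (e y) (e y) + c * qform ds A (e y) (e z) + cnj c * qform ds A (e z) (e y)
        + cnj c * c * qform ds A (e z) (e z)"
      unfolding qform_def by (simp add: algebra_simps sum.distrib sum_distrib_left)
    then show ?thesis using True by (simp add: ee)
  qed
  have re: "Im (qform ds A v v) = 0" for v
    using assms unfolding psd_def qform_def Let_def by blast
  have "Im (A y y) = 0" "Im (A z z) = 0"
    using re[of "e y"] re[of "e z"] True by (simp_all add: ee)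
  then show ?thesis
    using re[of "\<lambda>x. e y x + 1 * e z x"] re[of "\<lambda>x. e y x + \<i> * e z x"]
    unfolding lin by (simp add: complex_eq_iff)
next
  case False
  then show ?thesis using assms by (auto simp: psd_def op_on_def)
qed

text \<open>\<open>msqrt\<close> is a definite description, so uniqueness of the positive root is
  part of the claim. If B is positive with square c |w><w|, then |Bu|^2 = c |<w,u>|^2, hence B
  vanishes on the complement of w. Being Hermitian it equals b |w><w|, and positivity leaves b =
  sqrt c.\<close>

lemma msqrt_scaled_proj:
  assumes "sqn ds w = 1" "0 \<le> c"
  shows "msqrt ds (\<lambda>y x. complex_of_real c * proj ds w y x)
    = (\<lambda>y x. complex_of_real (sqrt c) * proj ds w y x)"
  unfolding msqrt_def
proof (rule the_equality)
  let ?P = "\<lambda>y x. complex_of_real (sqrt c) * proj ds w y x"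
  have ww: "(\<Sum>z\<in>idxs ds. cnj (w z) * w z) = 1"
    using sqn_ip[of ds w] assms by (simp add: ip_def)
  have "qform ds ?P v v = complex_of_real (sqrt c * (cmod (ip ds w v))\<^sup>2)" for v
  proof -
    have "qform ds ?P v v = (\<Sum>y\<in>idxs ds. \<Sum>x\<in>idxs ds. complex_of_real (sqrt c) * ((cnj (v y) * w y) * (cnj (w x) * v x)))"
      unfolding qform_def by (intro sum.cong refl) (simp add: proj_def)
    also have "\<dots> = complex_of_real (sqrt c) * (ip ds v w * ip ds w v)"
      unfolding ip_def sum_product by (simp add: sum_distrib_left)
    also have "\<dots> = complex_of_real (sqrt c * (cmod (ip ds w v))\<^sup>2)"
      by (subst ip_commute) (simp add: complex_norm_square mult.commute del: of_real_power)
    finally show ?thesis .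
  qed
  then have "psd ds ?P"
    using assms unfolding psd_def qform_def[symmetric] Let_def by (auto simp: op_on_def proj_def)
  moreover have "mmul ds ?P ?P = (\<lambda>y x. complex_of_real c * proj ds w y x)"
  proof (intro ext)
    fix y x
    have "mmul ds ?P ?P y x = (\<Sum>z\<in>idxs ds. complex_of_real (sqrt c) * complex_of_real (sqrt c) * proj ds w y x * (cnj (w z) * w z))"
      unfolding mmul_def by (intro sum.cong refl) (auto simp: proj_def)
    also have "\<dots> = complex_of_real c * proj ds w y x"
      using assms ww by (simp add: sum_distrib_left[symmetric] of_real_mult[symmetric] del: of_real_mult)
    finally show "mmul ds ?P ?P y x = complex_of_real c * proj ds w y x" .
  qed
  ultimately show "psd ds ?P \<and> mmul ds ?P ?P = (\<lambda>y x. complex_of_real c * proj ds w y x)" by blast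
next
  fix B assume B: "psd ds B \<and> mmul ds B B = (\<lambda>y x. complex_of_real c * proj ds w y x)"
  have herm: "B z y = cnj (B y z)" for y z using psd_hermitian B by blast
  have ww: "(\<Sum>z\<in>idxs ds. cnj (w z) * w z) = 1"
    using sqn_ip[of ds w] assms by (simp add: ip_def)
  have kill: "op_vec ds B u y = 0" if u: "ip ds w u = 0" and y: "y \<in> idxs ds" for u y
  proof -
    have "complex_of_real (sqn ds (op_vec ds B u)) = (\<Sum>y\<in>idxs ds. cnj (op_vec ds B u y) * op_vec ds B u y)"
      by (simp add: sqn_ip ip_def)
    also have "\<dots> = (\<Sum>y\<in>idxs ds. \<Sum>z\<in>idxs ds. \<Sum>x\<in>idxs ds. cnj (u z) * (B z y * B y x) * u x)"
    proof (rule sum.cong[OF refl])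
      fix y
      have "cnj (op_vec ds B u y) = (\<Sum>z\<in>idxs ds. cnj (u z) * B z y)"
        unfolding op_vec_def cnj_sum by (intro sum.cong refl) (simp add: herm[of _ y] mult.commute)
      then show "cnj (op_vec ds B u y) * op_vec ds B u y = (\<Sum>z\<in>idxs ds. \<Sum>x\<in>idxs ds. cnj (u z) * (B z y * B y x) * u x)"
        by (simp add: op_vec_def sum_product mult.assoc)
    qed
    also have "\<dots> = (\<Sum>z\<in>idxs ds. \<Sum>x\<in>idxs ds. \<Sum>y\<in>idxs ds. cnj (u z) * (B z y * B y x) * u x)"
      by (subst sum.swap, rule sum.cong[OF refl], rule sum.swap)
    also have "\<dots> = (\<Sum>z\<in>idxs ds. \<Sum>x\<in>idxs ds. cnj (u z) * mmul ds B B z x * u x)"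
      by (simp add: mmul_def sum_distrib_left sum_distrib_right)
    also have "\<dots> = (\<Sum>z\<in>idxs ds. \<Sum>x\<in>idxs ds. (complex_of_real c * (cnj (u z) * w z)) * (cnj (w x) * u x))"
      using B by (intro sum.cong refl) (auto simp: proj_def)
    also have "\<dots> = (\<Sum>z\<in>idxs ds. complex_of_real c * (cnj (u z) * w z)) * ip ds w u"
      by (simp add: ip_def sum_product)
    finally have "sqn ds (op_vec ds B u) = 0" using u by simp
    then show ?thesis using y by (auto simp: sqn_def sum_nonneg_eq_0_iff)
  qed
  define g where "g = op_vec ds B w"
  have Bg: "B y z = cnj (w z) * g y" if y: "y \<in> idxs ds" and z: "z \<in> idxs ds" for y z
  proof -
    \<comment> \<open>The basis vector at \<open>z\<close> minus its projection onto
      \<open>w\<close>. It is orthogonal to \<open>w\<close> and hence killed, which expresses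
      column \<open>z\<close> of \<open>B\<close> through \<open>g\<close>.\<close>
    let ?u = "\<lambda>x. (if x = z then 1 else 0) - cnj (w z) * w x"
    have "ip ds w ?u = (\<Sum>x\<in>idxs ds. if x = z then cnj (w x) else 0) - cnj (w z) * (\<Sum>x\<in>idxs ds. cnj (w x) * w x)"
      unfolding ip_def sum_distrib_left sum_subtractf[symmetric] by (intro sum.cong refl) (auto simp: algebra_simps)
    also have "\<dots> = 0" using z ww by simp
    finally have "op_vec ds B ?u y = 0" using kill y by blast
    moreover have "op_vec ds B ?u y = (\<Sum>x\<in>idxs ds. if x = z then B y x else 0) - cnj (w z) * g y"
      unfolding op_vec_def g_def sum_distrib_left sum_subtractf[symmetric] by (intro sum.cong refl) (auto simp: algebra_simps)
    ultimately show ?thesis using z by simp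
  qed
  define b where "b = cnj (ip ds w g)"
  have gb: "g y = w y * b" if y: "y \<in> idxs ds" for y
  proof -
    have "g y = (\<Sum>z\<in>idxs ds. w y * cnj (cnj (w z) * g z))"
      unfolding g_def op_vec_def
    proof (rule sum.cong[OF refl])
      fix z assume z: "z \<in> idxs ds"
      have "B y z = w y * cnj (g z)" using herm[of y z] Bg[OF z y] by simp
      then show "B y z * w z = w y * cnj (cnj (w z) * (\<Sum>z'\<in>idxs ds. B z z' * w z'))"
        by (simp add: g_def op_vec_def mult.commute mult.left_commute)
    qed
    also have "\<dots> = w y * b"
      unfolding b_def ip_def cnj_sum sum_distrib_left ..
    finally show ?thesis .
  qed
  have Bb: "B y z = b * proj ds w y z" for y z
  proof (cases "y \<in> idxs ds \<and> z \<in> idxs ds")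
    case True
    then show ?thesis using Bg gb by (simp add: proj_def)
  next
    case False
    then show ?thesis using B by (auto simp: proj_def psd_def op_on_def)
  qed
  have "qform ds B w w = ip ds w g"
    unfolding qform_def ip_def g_def op_vec_def by (simp add: sum_distrib_left mult.assoc)
  moreover have "Im (qform ds B w w) = 0" "0 \<le> Re (qform ds B w w)"
    using B unfolding psd_def qform_def Let_def by blast+
  ultimately have b: "b = complex_of_real (Re b)" "0 \<le> Re b"
    by (simp_all add: b_def complex_eq_iff)
  obtain y where y: "y \<in> idxs ds" "w y \<noteq> 0"
  proof (rule ccontr)
    assume "\<not> thesis"
    then have "\<forall>y\<in>idxs ds. w y = 0" using that by blast
    then show False using assms(1) by (simp add: sqn_def)
  qed
  have "mmul ds B B y y = (\<Sum>z\<in>idxs ds. b * b * proj ds w y y * (cnj (w z) * w z))"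
    unfolding mmul_def Bb by (intro sum.cong refl) (auto simp: proj_def y)
  also have "\<dots> = b * b * proj ds w y y" using ww by (simp add: sum_distrib_left[symmetric])
  finally have "b * b * proj ds w y y = complex_of_real c * proj ds w y y" using B by auto
  then have "b * b = complex_of_real c" using y by (simp add: proj_def)
  then have "complex_of_real (Re b * Re b) = complex_of_real c" using b(1) by (metis of_real_mult)
  then have "Re b * Re b = c" using of_real_eq_iff by blast
  then have "Re b = sqrt c" using b(2) by (metis real_sqrt_unique power2_eq_square)
  then have "b = complex_of_real (sqrt c)" using b(1) by simp
  then show "B = (\<lambda>y x. complex_of_real (sqrt c) * proj ds w y x)" by (intro ext) (simp add: Bb)
qed

text \<open>The second argument is its own square root, so the operator under the outer root is f
  |w><w|, where f is the expectation of \<rho> in w; the fidelity is sqrt f.\<close>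

lemma pdist_proj:
  assumes "sqn ds w = 1" "0 \<le> f" "qform ds \<rho> w w = complex_of_real f"
  shows "pdist ds \<rho> (proj ds w) = sqrt (1 - f)"
proof -
  have m1: "msqrt ds (proj ds w) = proj ds w"
    using msqrt_scaled_proj[OF assms(1), of 1] by simp
  have "mmul ds (mmul ds (proj ds w) \<rho>) (proj ds w) = (\<lambda>y x. complex_of_real f * proj ds w y x)"
  proof (intro ext)
    fix y x
    have "mmul ds (mmul ds (proj ds w) \<rho>) (proj ds w) y x
      = (\<Sum>z\<in>idxs ds. \<Sum>z'\<in>idxs ds. proj ds w y z' * \<rho> z' z * proj ds w z x)"
      unfolding mmul_def by (simp add: sum_distrib_right)
    also have "\<dots> = (\<Sum>z\<in>idxs ds. \<Sum>z'\<in>idxs ds. proj ds w y x * (cnj (w z') * \<rho> z' z * w z))"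
      by (intro sum.cong refl) (auto simp: proj_def)
    also have "\<dots> = proj ds w y x * qform ds \<rho> w w"
      unfolding qform_def by (subst sum.swap) (simp add: sum_distrib_left)
    finally show "mmul ds (mmul ds (proj ds w) \<rho>) (proj ds w) y x = complex_of_real f * proj ds w y x"
      by (simp add: assms(3) mult.commute)
  qed
  then have "fidelity ds \<rho> (proj ds w) = Re (\<Sum>x\<in>idxs ds. complex_of_real (sqrt f) * proj ds w x x)"
    unfolding fidelity_def m1 by (simp add: msqrt_scaled_proj[OF assms(1,2)] trace_def)
  also have "(\<Sum>x\<in>idxs ds. complex_of_real (sqrt f) * proj ds w x x) = complex_of_real (sqrt f * sqn ds w)"
    unfolding of_real_mult sqn_ip ip_def sum_distrib_left by (intro sum.cong refl) (auto simp: proj_def)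
  finally show ?thesis using assms by (simp add: pdist_def)
qed

lemma qform_sum_rank_one:
  "qform ds (\<lambda>y y'. \<Sum>v\<leftarrow>vs. v y * cnj (v y')) w w = complex_of_real (\<Sum>v\<leftarrow>vs. (cmod (ip ds w v))\<^sup>2)"
proof (induction vs)
  case (Cons v vs)
  have "qform ds (\<lambda>y y'. \<Sum>v\<leftarrow>v # vs. v y * cnj (v y')) w w
     = (\<Sum>y\<in>idxs ds. \<Sum>x\<in>idxs ds. cnj (w y) * v y * (cnj (v x) * w x))
      + qform ds (\<lambda>y y'. \<Sum>v\<leftarrow>vs. v y * cnj (v y')) w w"
    unfolding qform_def by (simp add: algebra_simps sum.distrib)
  also have "(\<Sum>y\<in>idxs ds. \<Sum>x\<in>idxs ds. cnj (w y) * v y * (cnj (v x) * w x)) = ip ds w v * ip ds v w"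
    by (simp add: ip_def sum_product)
  also have "\<dots> = complex_of_real ((cmod (ip ds w v))\<^sup>2)"
    by (subst ip_commute[of ds v]) (simp add: complex_norm_square del: of_real_power)
  finally show ?case using Cons by simp
qed (simp add: qform_def)

lemma pdist_pure:
  assumes "is_state k ds v" "is_state k ds w"
  shows "pdist ds (proj ds v) (proj ds w) = sqrt (1 - (cmod (ip ds w v))\<^sup>2)"
proof (rule pdist_proj)
  have "qform ds (proj ds v) w w = qform ds (\<lambda>y y'. \<Sum>v\<leftarrow>[v]. v y * cnj (v y')) w w"
    unfolding qform_def by (intro sum.cong refl) (simp add: proj_def)
  then show "qform ds (proj ds v) w w = complex_of_real ((cmod (ip ds w v))\<^sup>2)"
    by (simp only: qform_sum_rank_one) simp
qed (use assms in \<open>auto simp: is_state_iff\<close>)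

lemma pdist_ens:
  assumes "sqn es w = 1"
  shows "pdist es (channel_out ds L (proj ds v)) (proj es w)
    = sqrt (1 - (\<Sum>u\<leftarrow>map (\<lambda>A. op_vec ds A v) (map snd L). (cmod (ip es w u))\<^sup>2))"
proof (rule pdist_proj[OF assms])
  have eq: "channel_out ds L (proj ds v) = (\<lambda>y y'. \<Sum>u\<leftarrow>map (\<lambda>A. op_vec ds A v) (map snd L). u y * cnj (u y'))"
    by (intro ext) (rule channel_out_proj)
  show "qform es (channel_out ds L (proj ds v)) w w
      = complex_of_real (\<Sum>u\<leftarrow>map (\<lambda>A. op_vec ds A v) (map snd L). (cmod (ip es w u))\<^sup>2)"
    unfolding eq by (rule qform_sum_rank_one)
qed (auto intro!: sum_list_nonneg)

section \<open>Tensor products and local relabellings\<close>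

text \<open>Inverse of the pair \<open>map2 (div)\<close>, \<open>map2 (mod)\<close>: the grouped
  index at which \<open>tensor_vec\<close> has the entry \<open>v a * w b\<close>.\<close>

definition tpair :: "nat list \<Rightarrow> nat list \<Rightarrow> nat list \<Rightarrow> nat list" where
  "tpair es a b = map (\<lambda>i. a ! i * es ! i + b ! i) [0..<length es]"

lemma length_tensor_dims [simp]: "length (tensor_dims ds es) = min (length ds) (length es)"
  by (simp add: tensor_dims_def)

lemma tensor_dims_nth:
  "length ds = length es \<Longrightarrow> i < length es \<Longrightarrow> tensor_dims ds es ! i = ds ! i * es ! i"
  by (simp add: tensor_dims_def)

lemma tpair_in: "length ds = length es \<Longrightarrow> a \<in> idxs ds \<Longrightarrow> b \<in> idxs es \<Longrightarrow> tpair es a b \<in> idxs (tensor_dims ds es)"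
proof -
  assume l: "length ds = length es" and a: "a \<in> idxs ds" and b: "b \<in> idxs es"
  have "a ! i * es ! i + b ! i < ds ! i * es ! i" if "i < length es" for i
  proof -
    have "a ! i < ds ! i" "b ! i < es ! i" using a b l that by (auto simp: idxs_def)
    then have "a ! i * es ! i + b ! i < Suc (a ! i) * es ! i" by simp
    also have "\<dots> \<le> ds ! i * es ! i" using \<open>a ! i < ds ! i\<close> by (intro mult_right_mono) auto
    finally show ?thesis .
  qed
  then show ?thesis using l by (auto simp: idxs_def tpair_def tensor_dims_nth)
qed

lemma map2_div_tpair: "length a = length es \<Longrightarrow> b \<in> idxs es \<Longrightarrow> map2 (div) (tpair es a b) es = a"
  by (rule nth_equalityI) (auto simp: tpair_def idxs_def)

lemma map2_mod_tpair: "b \<in> idxs es \<Longrightarrow> map2 (mod) (tpair es a b) es = b"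
  by (rule nth_equalityI) (auto simp: tpair_def idxs_def)

lemma map2_div_in:
  "length ds = length es \<Longrightarrow> z \<in> idxs (tensor_dims ds es) \<Longrightarrow> map2 (div) z es \<in> idxs ds"
  by (auto simp: idxs_def tensor_dims_nth less_mult_imp_div_less)

lemma map2_mod_in:
  assumes "length ds = length es" "z \<in> idxs (tensor_dims ds es)" shows "map2 (mod) z es \<in> idxs es"
proof -
  have "z ! i mod es ! i < es ! i" if "i < length es" for i
  proof -
    have "z ! i < ds ! i * es ! i" using assms that by (auto simp: idxs_def tensor_dims_nth)
    then have "0 < es ! i" by (cases "es ! i") auto
    then show ?thesis by simp
  qed
  then show ?thesis using assms by (auto simp: idxs_def)
qed

lemma tpair_div_mod:
  "length z = length es \<Longrightarrow> tpair es (map2 (div) z es) (map2 (mod) z es) = z"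
  by (rule nth_equalityI) (auto simp: tpair_def div_mult_mod_eq)

lemma sum_idxs_tensor:
  assumes "length ds = length es"
  shows "sum f (idxs (tensor_dims ds es)) = (\<Sum>a\<in>idxs ds. \<Sum>b\<in>idxs es. f (tpair es a b))"
proof -
  have "sum f (idxs (tensor_dims ds es)) = (\<Sum>(a, b)\<in>idxs ds \<times> idxs es. f (tpair es a b))"
    by (rule sum.reindex_bij_witness[where i = "\<lambda>(a, b). tpair es a b" and j = "\<lambda>z. (map2 (div) z es, map2 (mod) z es)"])
       (use assms in \<open>auto simp: map2_div_tpair map2_mod_tpair tpair_div_mod tpair_in map2_div_in map2_mod_in
          idxs_length simp del: map_eq_conv\<close>)
  then show ?thesis by (simp add: sum.cartesian_product)
qed

lemma tensor_vec_tpair: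
  "length ds = length es \<Longrightarrow> a \<in> idxs ds \<Longrightarrow> b \<in> idxs es \<Longrightarrow> tensor_vec ds v es w (tpair es a b) = v a * w b"
  by (simp add: tensor_vec_def tpair_in map2_div_tpair map2_mod_tpair idxs_length)

lemma vec_on_tensor: "vec_on (tensor_dims ds es) (tensor_vec ds v es w)"
  by (simp add: vec_on_def tensor_vec_def)

lemma sqn_tensor:
  assumes "length ds = length es"
  shows "sqn (tensor_dims ds es) (tensor_vec ds v es w) = sqn ds v * sqn es w"
  unfolding sqn_def sum_idxs_tensor[OF assms] sum_product
  by (intro sum.cong refl) (simp add: tensor_vec_tpair[OF assms] norm_mult power_mult_distrib)

lemma is_state_tensor:
  "is_state k ds v \<Longrightarrow> is_state k es w \<Longrightarrow> is_state k (tensor_dims ds es) (tensor_vec ds v es w)"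
  by (auto simp: is_state_iff vec_on_tensor sqn_tensor)

lemma idxs_replicate_1: "idxs (replicate n 1) = {replicate n 0}"
  by (auto simp: idxs_def list_eq_iff_nth_eq)

definition unit_vec :: "nat \<Rightarrow> vec" where
  "unit_vec n = (\<lambda>x. if x = replicate n 0 then 1 else 0)"

lemma is_state_unit: "is_state k (replicate k 1) (unit_vec k)"
  unfolding is_state_iff vec_on_def sqn_def idxs_replicate_1 by (simp add: unit_vec_def)

lemma is_state_tpow: "is_state k ds v \<Longrightarrow> is_state k (fst (tpow n ds v)) (snd (tpow n ds v))"
proof (induction n)
  case 0
  then have "length ds = k" by (simp add: is_state_def)
  then show ?case using is_state_unit[of k] by (simp add: unit_vec_def)
qed (simp add: is_state_tensor)

lemma dimH_tensor: "length ds = length es \<Longrightarrow> dimH (tensor_dims ds es) = dimH ds * dimH es"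
proof (induction ds es rule: list_induct2)
  case (Cons x xs y ys)
  then show ?case by (simp add: dimH_def tensor_dims_def)
qed (simp add: dimH_def tensor_dims_def)

lemma length_tpow [simp]: "length (fst (tpow n ds v)) = length ds"
  by (induction n) auto

lemma dimH_tpow: "dimH (fst (tpow n ds v)) = dimH ds ^ n"
proof (induction n)
  case 0
  show ?case by (simp add: dimH_def prod_list_replicate)
next
  case (Suc n)
  then show ?case by (simp add: dimH_tensor mult.commute)
qed

lemma is_state_dimH_pos:
  assumes "is_state k ds v" shows "0 < dimH ds"
proof -
  have "idxs ds \<noteq> {}" using assms by (auto simp: is_state_def)
  then show ?thesis by (simp add: card_idxs[symmetric] card_gt_0_iff)
qed

section \<open>Index maps acting party by party, and normalisation\<close>

definition lmap :: "(nat \<Rightarrow> nat \<Rightarrow> nat) \<Rightarrow> nat list \<Rightarrow> nat list" where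
  "lmap f x = map (\<lambda>i. f i (x ! i)) [0..<length x]"

lemma length_lmap [simp]: "length (lmap f x) = length x"
  by (simp add: lmap_def)

lemma nth_lmap [simp]: "i < length x \<Longrightarrow> lmap f x ! i = f i (x ! i)"
  by (simp add: lmap_def)

lemma prod_monomial:
  "(\<Prod>i<(n::nat). if P i then \<theta> i else 0) = (if \<forall>i<n. P i then \<Prod>i<n. \<theta> i else (0::'a::comm_semiring_1))"
  by (induction n) (auto simp: less_Suc_eq)

text \<open>Each local matrix has at most one nonzero entry per column, so the tensor product sends
  a basis vector to a multiple of a basis vector, and only the fibre of \<open>lmap f\<close> over
  \<open>y\<close> contributes.\<close>

lemma prod_app_monomial:
  assumes "length es = length ds" "y \<in> idxs es"
    and "\<And>i b a. i < length ds \<Longrightarrow> a < ds ! i \<Longrightarrow> F i b a = (if b = f i a then \<theta> i a else 0)"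
  shows "prod_app ds es F v y = (\<Sum>x\<in>{x\<in>idxs ds. lmap f x = y}. (\<Prod>i<length ds. \<theta> i (x ! i)) * v x)"
proof -
  have "prod_app ds es F v y = (\<Sum>x\<in>idxs ds. if lmap f x = y then (\<Prod>i<length ds. \<theta> i (x ! i)) * v x else 0)"
    unfolding prod_app_def using assms(2)
  proof (simp, intro sum.cong refl)
    fix x assume x: "x \<in> idxs ds"
    have "(\<Prod>i<length ds. F i (y ! i) (x ! i)) = (\<Prod>i<length ds. if y ! i = f i (x ! i) then \<theta> i (x ! i) else 0)"
      by (intro prod.cong refl) (use assms(3) x in \<open>auto simp: idxs_def\<close>)
    also have "\<dots> = (if lmap f x = y then \<Prod>i<length ds. \<theta> i (x ! i) else 0)"
      unfolding prod_monomial using assms(1,2) x by (auto simp: list_eq_iff_nth_eq idxs_length)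
    finally show "(\<Prod>i<length ds. F i (y ! i) (x ! i)) * v x = (if lmap f x = y then (\<Prod>i<length ds. \<theta> i (x ! i)) * v x else 0)"
      by simp
  qed
  then show ?thesis by (simp add: sum.inter_filter)
qed

lemma proj_phase: "cmod c = 1 \<Longrightarrow> proj ds (\<lambda>x. c * v x) = proj ds v"
proof -
  assume "cmod c = 1"
  then have "c * cnj c = 1" by (simp add: complex_norm_square[symmetric])
  then have "c * a * (cnj c * b) = a * b" for a b by (metis mult.assoc mult.commute mult.left_neutral)
  then show ?thesis by (intro ext) (simp add: proj_def)
qed

definition normalized :: "nat list \<Rightarrow> vec \<Rightarrow> vec" where
  "normalized ds w = (\<lambda>x. w x / complex_of_real (sqrt (sqn ds w)))"

lemma is_state_normalized:
  assumes "length ds = k" "vec_on ds w" "sqn ds w \<noteq> 0" shows "is_state k ds (normalized ds w)"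
proof -
  have "sqn ds (normalized ds w) = sqn ds (\<lambda>x. complex_of_real (1 / sqrt (sqn ds w)) * w x)"
    by (simp add: normalized_def)
  also have "\<dots> = 1"
    unfolding sqn_scale using assms sqn_nonneg[of ds w] by (simp add: power_divide norm_divide)
  finally show ?thesis using assms by (simp add: is_state_iff vec_on_def normalized_def)
qed

section \<open>Functionals that are additive and monotone on average\<close>

locale ent_measure =
  fixes k :: nat and E :: entfun
  assumes k2: "2 \<le> k" and additive: "fully_additive k E" and mono: "mono_on_average k E"
    and ghz: "Ev E (ghz_dims k) (ghz_vec k) = 1"
begin

definition Eb :: "nat list \<Rightarrow> vec \<Rightarrow> real" where
  "Eb ds w = sqn ds w * Ev E ds (normalized ds w)"

lemma Eb_state: "is_state k ds v \<Longrightarrow> Eb ds v = Ev E ds v"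
  by (simp add: Eb_def is_state_iff normalized_def)

lemma Eb_zero: "sqn ds w = 0 \<Longrightarrow> Eb ds w = 0"
  by (simp add: Eb_def)

lemma Eb_scale: "Eb ds (\<lambda>x. c * w x) = (cmod c)\<^sup>2 * Eb ds w"
proof (cases "c = 0 \<or> sqn ds w = 0")
  case True
  then show ?thesis by (auto simp: Eb_def sqn_scale)
next
  case False
  have "normalized ds (\<lambda>x. c * w x) = (\<lambda>x. (c / cmod c) * normalized ds w x)"
    using False by (intro ext) (simp add: normalized_def sqn_scale real_sqrt_mult)
  moreover have "cmod (c / cmod c) = 1" using False by (simp add: norm_divide)
  ultimately have "Ev E ds (normalized ds (\<lambda>x. c * w x)) = Ev E ds (normalized ds w)"
    by (simp only: Ev_def proj_phase)
  then show ?thesis by (simp add: Eb_def sqn_scale)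
qed

text \<open>Scaling the input to norm one and separating the flags turns the branches into data that
  \<open>mono_on_average\<close> accepts; homogeneity of \<open>Eb\<close> then removes the
  scale.\<close>

lemma ens_mono:
  assumes ens: "ens ds v es ws" and len: "length ds = k" and v: "vec_on ds v"
  shows "(\<Sum>w\<leftarrow>ws. Eb es w) \<le> Eb ds v"
proof (cases "sqn ds v = 0")
  case True
  have "(\<Sum>w\<leftarrow>ws. sqn es w) = 0" using ens_sqn[OF ens] True by simp
  then have "\<forall>w\<in>set ws. sqn es w = 0"
    by (subst (asm) sum_list_nonneg_eq_0_iff) (auto simp: sqn_nonneg)
  then have "(\<Sum>w\<leftarrow>ws. Eb es w) = (\<Sum>w\<leftarrow>ws. 0)"
    by (intro arg_cong[where f = sum_list] map_cong) (auto simp: Eb_zero)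
  then show ?thesis using True by (simp add: Eb_zero)
next
  case False
  obtain L where L: "LOCC ds es L" "distinct (map fst L)" "ws = map (\<lambda>A. op_vec ds A v) (map snd L)"
    using ens LOCC_distinct unfolding ens_def by metis
  define v' where "v' = normalized ds v"
  define r where "r = complex_of_real (1 / sqrt (sqn ds v))"
  have v'r: "v' = (\<lambda>x. r * v x)" by (simp add: v'_def r_def normalized_def)
  have r2: "(cmod r)\<^sup>2 = 1 / sqn ds v"
    using sqn_nonneg[of ds v] by (simp add: r_def norm_divide power_divide)
  have st: "is_state k ds v'" using is_state_normalized[OF len v False] by (simp add: v'_def)
  have opr: "op_vec ds A v' = (\<lambda>x. r * op_vec ds A v x)" for A
    by (simp add: v'r op_vec_def sum_distrib_left algebra_simps)
  define f where "f = (\<lambda>x. op_vec ds (the (map_of L x)) v')"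
  have f: "f x = op_vec ds A v'" if "(x, A) \<in> set L" for x A
    using that L(2) by (simp add: f_def)
  have fon: "vec_on es (f x)" if "x \<in> fst ` set L" for x
    using that LOCC_support[OF L(1)] by (force simp: f vec_on_def op_vec_def intro!: sum.neutral)
  have tot: "(\<Sum>(x, A)\<leftarrow>L. sqn es (op_vec ds A v')) = 1"
    using LOCC_sqn[OF L(1), of v'] st by (simp add: is_state_iff)
  obtain x0 A0 where x0: "(x0, A0) \<in> set L" "sqn es (op_vec ds A0 v') \<noteq> 0"
  proof (rule ccontr)
    assume "\<not> thesis"
    then have "\<forall>z\<in>set L. sqn es (op_vec ds (snd z) v') = 0" using that by force
    then have "(\<Sum>(x, A)\<leftarrow>L. sqn es (op_vec ds A v')) = (\<Sum>z\<leftarrow>L. 0)"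
      by (intro arg_cong[where f = sum_list] map_cong) (auto simp: case_prod_unfold)
    then show False using tot by simp
  qed
  have "L \<noteq> []" using x0(1) by auto
  then have lenes: "length es = k" using LOCC_length[OF L(1)] len by simp
  \<comment> \<open>A branch of probability zero still needs a state attached to its flag. The state
    of the nonzero branch \<open>x0\<close> serves as default and enters with coefficient 0.\<close>
  define \<phi> where "\<phi> = (\<lambda>x. normalized es (f (if sqn es (f x) = 0 then x0 else x)))"
  have \<phi>: "is_state k es (\<phi> x)" if "x \<in> fst ` set L" for x
    using that x0 fon[of x] fon[of x0] lenes f[OF x0(1)] unfolding \<phi>_def
    by (auto intro!: is_state_normalized simp: image_iff) force+
  have out: "outcome_out ds L x (proj ds v') = (\<lambda>y y'. complex_of_real (sqn es (f x)) * proj es (\<phi> x) y y')"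
    if x: "x \<in> fst ` set L" for x
  proof (intro ext)
    fix y y'
    obtain A where A: "(x, A) \<in> set L" using x by auto
    have "outcome_out ds L x (proj ds v') y y' = (\<Sum>z\<in>set L. if z = (x, A) then f x y * cnj (f x y') else 0)"
    proof -
      have "outcome_out ds L x (proj ds v') y y'
        = (\<Sum>z\<in>set L. case z of (x', A) \<Rightarrow> if x' = x then apply_op ds A (proj ds v') y y' else 0)"
        unfolding outcome_out_def using L(2) by (intro sum_list_distinct_conv_sum_set) (simp add: distinct_map)
      also have "\<dots> = (\<Sum>z\<in>set L. if z = (x, A) then f x y * cnj (f x y') else 0)"
        using A L(2) by (intro sum.cong) (auto simp: apply_op_proj f[OF A] dest: eq_key_imp_eq_value split: if_splits)
      finally show ?thesis .
    qed
    also have "\<dots> = f x y * cnj (f x y')" using A by simp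
    also have "\<dots> = complex_of_real (sqn es (f x)) * proj es (\<phi> x) y y'"
    proof (cases "sqn es (f x) = 0")
      case True
      then show ?thesis using sqn_eq_0[OF fon[OF x]] by simp
    next
      case False
      have "complex_of_real (sqrt (sqn es (f x))) * complex_of_real (sqrt (sqn es (f x))) = complex_of_real (sqn es (f x))"
        using sqn_nonneg[of es "f x"] by (simp add: of_real_mult[symmetric] del: of_real_mult)
      then show ?thesis using False fon[OF x]
        by (auto simp: proj_def \<phi>_def normalized_def vec_on_def field_simps)
    qed
    finally show "outcome_out ds L x (proj ds v') y y' = complex_of_real (sqn es (f x)) * proj es (\<phi> x) y y'" .
  qed
  have "(\<Sum>x\<in>fst ` set L. sqn es (f x) * Ev E es (\<phi> x)) \<le> Ev E ds v'"
    using mono[unfolded mono_on_average_def, rule_format, OF st L(1), of \<phi> "\<lambda>x. sqn es (f x)"] \<phi> out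
    by simp
  also have "(\<Sum>x\<in>fst ` set L. sqn es (f x) * Ev E es (\<phi> x)) = (\<Sum>x\<in>fst ` set L. Eb es (f x))"
    by (intro sum.cong refl) (auto simp: Eb_def \<phi>_def)
  also have "\<dots> = (\<Sum>x\<leftarrow>map fst L. Eb es (f x))"
    using sum_list_distinct_conv_sum_set[OF L(2), of "\<lambda>x. Eb es (f x)"] by simp
  also have "\<dots> = (\<Sum>w\<leftarrow>ws. (cmod r)\<^sup>2 * Eb es w)"
    unfolding L(3) map_map o_def
    by (intro arg_cong[where f = sum_list] map_cong refl) (auto simp: f opr Eb_scale)
  also have "\<dots> = (\<Sum>w\<leftarrow>ws. Eb es w) / sqn ds v"
    unfolding r2 by (subst sum_list_const_mult) simp
  finally show ?thesis
    using False sqn_nonneg[of ds v] by (simp add: Eb_def v'_def field_simps)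
qed

lemma vec_on_local_app: "vec_on (ds[i := d']) (local_app ds i d' K v)"
  by (simp add: vec_on_def local_app_def)

lemma Eb_local_instr:
  assumes "length ds = k" "vec_on ds v" "i < k" "local_instr (ds ! i) d' Ks"
  shows "(\<Sum>j<length Ks. Eb (ds[i := d']) (local_app ds i d' (Ks ! j) v)) \<le> Eb ds v"
proof -
  have "ens ds v (ds[i := d']) (concat (map (\<lambda>j. [local_app ds i d' (Ks ! j) v]) [0..<length Ks]))"
    using assms by (intro ens_round) (auto intro: ens_id vec_on_local_app)
  from ens_mono[OF this assms(1,2)] show ?thesis
    by (simp add: map_concat o_def interv_sum_list_conv_sum_set_nat atLeast0LessThan)
qed

text \<open>The trivial state is its own tensor square, so additivity forces its value to be twice
  itself.\<close>

lemma E_unit: "Ev E (replicate k 1) (unit_vec k) = 0"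
proof -
  have "tensor_dims (replicate k 1) (replicate k 1) = replicate k 1"
    by (simp add: tensor_dims_def zip_replicate)
  moreover have "tensor_vec (replicate k 1) (unit_vec k) (replicate k 1) (unit_vec k) = unit_vec k"
  proof
    fix x
    show "tensor_vec (replicate k 1) (unit_vec k) (replicate k 1) (unit_vec k) x = unit_vec k x"
      using calculation idxs_replicate_1[of k] unfolding tensor_vec_def
      by (auto simp: unit_vec_def zip_replicate)
  qed
  moreover have "Ev E (tensor_dims (replicate k 1) (replicate k 1))
      (tensor_vec (replicate k 1) (unit_vec k) (replicate k 1) (unit_vec k)) = Ev E (replicate k 1) (unit_vec k) + Ev E (replicate k 1) (unit_vec k)"
    using additive is_state_unit[of k] unfolding fully_additive_def by blast
  ultimately show ?thesis by simp
qed

text \<open>When every party measures in its basis, each branch ends in a multiple of the trivial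
  state, where \<open>E\<close> vanishes. The induction counts the leading parties whose dimension
  is still arbitrary.\<close>

lemma Eb_nonneg:
  assumes "length ds = k" "vec_on ds v" shows "0 \<le> Eb ds v"
proof -
  have "m \<le> k \<Longrightarrow> length ds = k \<Longrightarrow> vec_on ds v \<Longrightarrow> (\<And>i. m \<le> i \<Longrightarrow> i < k \<Longrightarrow> ds ! i = 1) \<Longrightarrow> 0 \<le> Eb ds v" for m ds v
  proof (induction m arbitrary: ds v)
    case 0
    then have ds: "ds = replicate k 1" by (intro nth_equalityI) auto
    have "v = (\<lambda>x. v (replicate k 0) * unit_vec k x)"
      using 0(3) idxs_replicate_1[of k] unfolding ds vec_on_def by (auto simp: unit_vec_def)
    then have "Eb ds v = (cmod (v (replicate k 0)))\<^sup>2 * Eb ds (unit_vec k)"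
      by (metis Eb_scale)
    then show ?case using E_unit Eb_state[OF is_state_unit] ds by simp
  next
    case (Suc m)
    \<comment> \<open>The bras of the local basis, with one-dimensional output.\<close>
    let ?Ks = "map (\<lambda>a (b::nat) c. if c = a then 1 else 0 :: complex) [0..<ds ! m]"
    have "local_instr (ds ! m) 1 ?Ks"
      unfolding local_instr_def
    proof (intro allI impI)
      fix a b assume "a < ds ! m" "b < ds ! m"
      have "(\<Sum>K\<leftarrow>?Ks. \<Sum>c<1. cnj (K c a) * K c b)
         = (\<Sum>j<ds ! m. cnj (if a = j then 1 else 0) * (if b = j then 1 else 0))"
        by (simp add: o_def interv_sum_list_conv_sum_set_nat atLeast0LessThan)
      also have "\<dots> = (\<Sum>j<ds ! m. if j = a then (if a = b then 1 else 0) else 0)"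
        by (intro sum.cong) auto
      finally show "(\<Sum>K\<leftarrow>?Ks. \<Sum>c<1. cnj (K c a) * K c b) = (if a = b then 1 else 0)"
        using \<open>a < ds ! m\<close> by simp
    qed
    then have "(\<Sum>j<length ?Ks. Eb (ds[m := 1]) (local_app ds m 1 (?Ks ! j) v)) \<le> Eb ds v"
      using Suc.prems by (intro Eb_local_instr) auto
    moreover have "0 \<le> Eb (ds[m := 1]) (local_app ds m 1 (?Ks ! j) v)" for j
    proof (rule Suc.IH)
      show "\<And>i. m \<le> i \<Longrightarrow> i < k \<Longrightarrow> ds[m := 1] ! i = 1"
        using Suc.prems by (auto simp: nth_list_update)
    qed (use Suc.prems in \<open>auto simp: vec_on_local_app\<close>)
    ultimately show ?case by (meson order_trans sum_nonneg)
  qed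
  from this[of k ds v] assms show ?thesis by auto
qed

lemma E_nonneg: "is_state k ds v \<Longrightarrow> 0 \<le> Ev E ds v"
  using Eb_nonneg[of ds v] Eb_state[of ds v] by (simp add: is_state_iff)

lemma Eb_prod_app_le:
  assumes "length ds = k" "length es = k" "vec_on ds v"
    and F: "\<And>i. i < k \<Longrightarrow> \<exists>Ks. local_instr (ds ! i) (es ! i) Ks \<and> F i \<in> set Ks"
  shows "Eb es (prod_app ds es F v) \<le> Eb ds v"
proof -
  let ?p = "\<lambda>m. take m es @ drop m ds"
  let ?F = "\<lambda>m i. if i < m then F i else id_mat"
  have "m \<le> k \<Longrightarrow> Eb (?p m) (prod_app ds (?p m) (?F m) v) \<le> Eb ds v" for m
  proof (induction m)
    case 0
    then show ?case using prod_app_id[of ds v "\<lambda>_. id_mat"] assms by simp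
  next
    case (Suc m)
    obtain Ks j where Ks: "local_instr (ds ! m) (es ! m) Ks" "j < length Ks" "F m = Ks ! j"
      using F[of m] Suc by (metis Suc_le_lessD in_set_conv_nth)
    have pm: "?p m ! m = ds ! m" using Suc assms by (simp add: nth_append)
    have pq: "(?p m)[m := es ! m] = ?p (Suc m)"
      using Suc assms by (intro nth_equalityI) (auto simp: nth_list_update nth_append)
    have "local_app (?p m) m (es ! m) (F m) (prod_app ds (?p m) (?F m) v)
       = prod_app ds (?p (Suc m)) ((?F m)(m := F m)) v"
      using Suc assms by (intro prod_app_step) auto
    also have "(?F m)(m := F m) = ?F (Suc m)" by auto
    finally have eq: "local_app (?p m) m (es ! m) (Ks ! j) (prod_app ds (?p m) (?F m) v)
       = prod_app ds (?p (Suc m)) (?F (Suc m)) v" using Ks(3) by simp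
    have "(\<Sum>j<length Ks. Eb ((?p m)[m := es ! m]) (local_app (?p m) m (es ! m) (Ks ! j) (prod_app ds (?p m) (?F m) v)))
        \<le> Eb (?p m) (prod_app ds (?p m) (?F m) v)"
      using Suc assms Ks by (intro Eb_local_instr) (auto simp: vec_on_prod_app nth_append)
    moreover have "Eb ((?p m)[m := es ! m]) (local_app (?p m) m (es ! m) (Ks ! j) (prod_app ds (?p m) (?F m) v))
        \<le> (\<Sum>j<length Ks. Eb ((?p m)[m := es ! m]) (local_app (?p m) m (es ! m) (Ks ! j) (prod_app ds (?p m) (?F m) v)))"
      using Ks assms Suc by (intro member_le_sum) (auto intro!: Eb_nonneg vec_on_local_app)
    ultimately show ?case using Suc by (simp add: eq pq)
  qed
  from this[of k] show ?thesis
    using assms prod_app_cong[of ds "?F k" F es v] by simp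
qed

text \<open>An injective relabelling of local basis states is a local isometry that can be undone
  locally, so monotonicity in both directions gives equality. This identifies vectors that differ
  only in local encoding, such as the blocks of a direct sum.\<close>

lemma Eb_embed:
  assumes len: "length ds = k" "length es = k" and v: "vec_on ds v" and w: "vec_on es w"
    and f: "\<And>i. i < k \<Longrightarrow> inj_on (f i) {..<ds ! i}" "\<And>i a. i < k \<Longrightarrow> a < ds ! i \<Longrightarrow> f i a < es ! i"
    and wv: "\<And>x. x \<in> idxs ds \<Longrightarrow> w (lmap f x) = v x"
    and w0: "\<And>y. y \<in> idxs es \<Longrightarrow> y \<notin> lmap f ` idxs ds \<Longrightarrow> w y = 0"
  shows "Eb es w = Eb ds v"
proof (cases "\<forall>i<k. 0 < ds ! i")
  case True
  have inj: "x = x'" if "x \<in> idxs ds" "x' \<in> idxs ds" "lmap f x = lmap f x'" for x x'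
  proof (rule nth_equalityI)
    show "length x = length x'" using that by (simp add: idxs_length)
    fix i assume "i < length x"
    then have "i < k" "f i (x ! i) = f i (x' ! i)"
      using that len by (auto simp: idxs_length lmap_def)
    then show "x ! i = x' ! i" using f(1) that len by (auto simp: idxs_def dest!: inj_onD)
  qed
  have fin: "lmap f x \<in> idxs es" if "x \<in> idxs ds" for x
    using that f(2) len by (auto simp: idxs_def)
  show ?thesis
  proof (rule antisym)
    let ?F = "\<lambda>i b a. if b = f i a then 1 else 0 :: complex"
    have "prod_app ds es ?F v = w"
    proof
      fix y
      show "prod_app ds es ?F v y = w y"
      proof (cases "y \<in> idxs es")
        case y: True
        have "prod_app ds es ?F v y = (\<Sum>x\<in>{x\<in>idxs ds. lmap f x = y}. v x)"
          using len y by (subst prod_app_monomial[where f = f and \<theta> = "\<lambda>_ _. 1"]) auto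
        also have "\<dots> = w y"
        proof (cases "y \<in> lmap f ` idxs ds")
          case True
          then obtain x where x: "x \<in> idxs ds" "y = lmap f x" by blast
          then have "{x\<in>idxs ds. lmap f x = y} = {x}" using inj by auto
          then show ?thesis using wv x by simp
        next
          case False
          then have "{x\<in>idxs ds. lmap f x = y} = {}" by auto
          then show ?thesis using w0[OF y False] by (metis sum.empty)
        qed
        finally show ?thesis .
      qed (use w in \<open>auto simp: vec_on_def prod_app_def\<close>)
    qed
    moreover have "Eb es (prod_app ds es ?F v) \<le> Eb ds v"
    proof (rule Eb_prod_app_le[OF len v])
      fix i assume i: "i < k"
      have "local_instr (ds ! i) (es ! i) [?F i]"
        unfolding local_instr_def
      proof (intro allI impI)
        fix a b assume ab: "a < ds ! i" "b < ds ! i"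
        have "(\<Sum>K\<leftarrow>[?F i]. \<Sum>c<es ! i. cnj (K c a) * K c b) = (\<Sum>c<es ! i. cnj (?F i c a) * ?F i c b)"
          by simp
        also have "\<dots> = (\<Sum>c<es ! i. if c = f i a then (if f i a = f i b then 1 else 0) else 0)"
          by (intro sum.cong) auto
        also have "\<dots> = (if a = b then 1 else 0)"
          using f[OF i] ab by (auto dest: inj_onD)
        finally show "(\<Sum>K\<leftarrow>[?F i]. \<Sum>c<es ! i. cnj (K c a) * K c b) = (if a = b then 1 else 0)" .
      qed
      then show "\<exists>Ks. local_instr (ds ! i) (es ! i) Ks \<and> ?F i \<in> set Ks" by fastforce
    qed
    ultimately show "Eb es w \<le> Eb ds v" by simp
  next
    let ?G = "\<lambda>i b a. if b < ds ! i \<and> a = f i b then 1 else 0 :: complex"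
    have "prod_app es ds ?G w = v"
    proof
      fix x
      show "prod_app es ds ?G w x = v x"
      proof (cases "x \<in> idxs ds")
        case x: True
        have "(\<Prod>i<length es. ?G i (x ! i) (y ! i)) = (if y = lmap f x then 1 else 0)" if y: "y \<in> idxs es" for y
          unfolding prod_monomial using x y len by (auto simp: idxs_def list_eq_iff_nth_eq)
        then have "(\<Sum>y\<in>idxs es. (\<Prod>i<length es. ?G i (x ! i) (y ! i)) * w y) = (\<Sum>y\<in>idxs es. if y = lmap f x then w y else 0)"
          by (intro sum.cong) auto
        then show ?thesis using x fin[OF x] wv[OF x] by (simp add: prod_app_def)
      qed (use v in \<open>auto simp: vec_on_def prod_app_def\<close>)
    qed
    moreover have "Eb ds (prod_app es ds ?G w) \<le> Eb es w"
    proof (rule Eb_prod_app_le[OF len(2,1) w])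
      fix i assume i: "i < k"
      let ?im = "f i ` {..<ds ! i}"
      \<comment> \<open>The adjoint of the isometry is completed to an instrument: every basis state
        outside the image gets its own Kraus operator, which resets it to 0. This target exists
        since \<open>0 < ds ! i\<close>.\<close>
      let ?cs = "filter (\<lambda>c. c \<notin> ?im) [0..<es ! i]"
      let ?Ks = "?G i # map (\<lambda>c b a. if b = 0 \<and> a = c then 1 else 0 :: complex) ?cs"
      have "local_instr (es ! i) (ds ! i) ?Ks"
        unfolding local_instr_def
      proof (intro allI impI)
        fix a b assume ab: "a < es ! i" "b < es ! i"
        have d0: "0 < ds ! i" using True i by blast
        have 1: "(\<Sum>c<ds ! i. cnj (?G i c a) * ?G i c b) = (if a = b \<and> a \<in> ?im then 1 else 0)"
        proof (cases "a \<in> ?im")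
          case True
          then obtain a' where a': "a' < ds ! i" "a = f i a'" by auto
          have "(\<Sum>c<ds ! i. cnj (?G i c a) * ?G i c b) = (\<Sum>c<ds ! i. if c = a' then (if a = b then 1 else 0) else 0)"
            using a' f(1)[OF i] by (intro sum.cong) (auto dest: inj_onD)
          then show ?thesis using a' True by simp
        qed (auto intro!: sum.neutral)
        have 2: "(\<Sum>K\<leftarrow>map (\<lambda>c b a. if b = 0 \<and> a = c then 1 else 0 :: complex) ?cs. \<Sum>c<ds ! i. cnj (K c a) * K c b)
           = (if a = b \<and> a \<notin> ?im then 1 else 0)"
        proof -
          have "(\<Sum>c<ds ! i. cnj (if c = 0 \<and> a = c' then 1 else 0) * (if c = 0 \<and> b = c' then 1 else 0))
              = (if c' = a then (if a = b then 1 else 0 :: complex) else 0)" for c'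
          proof -
            have "(\<Sum>c<ds ! i. cnj (if c = 0 \<and> a = c' then 1 else 0) * (if c = 0 \<and> b = c' then 1 else 0))
              = (\<Sum>c<ds ! i. if c = 0 then (if c' = a then (if a = b then 1 else 0 :: complex) else 0) else 0)"
              by (intro sum.cong) auto
            then show ?thesis using d0 by simp
          qed
          then have "(\<Sum>K\<leftarrow>map (\<lambda>c b a. if b = 0 \<and> a = c then 1 else 0 :: complex) ?cs. \<Sum>c<ds ! i. cnj (K c a) * K c b)
            = (\<Sum>c'\<leftarrow>?cs. if c' = a then (if a = b then 1 else 0) else 0)"
            by (simp add: o_def)
          also have "\<dots> = (\<Sum>c'\<in>set ?cs. if c' = a then (if a = b then 1 else 0) else 0)"
            by (rule sum_list_distinct_conv_sum_set) simp
          also have "\<dots> = (if a = b \<and> a \<notin> ?im then 1 else 0)" using ab by simp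
          finally show ?thesis .
        qed
        show "(\<Sum>K\<leftarrow>?Ks. \<Sum>c<ds ! i. cnj (K c a) * K c b) = (if a = b then 1 else 0)"
          using 1 2 by simp
      qed
      then show "\<exists>Ks. local_instr (es ! i) (ds ! i) Ks \<and> ?G i \<in> set Ks" by fastforce
    qed
    ultimately show "Eb ds v \<le> Eb es w" by simp
  qed
next
  case False
  then have "idxs ds = {}" using len by (auto simp: idxs_def)
  then have "sqn ds v = 0" "sqn es w = 0" using w0 by (auto simp: sqn_def)
  then show ?thesis by (simp add: Eb_zero)
qed

lemma Eb_tensor:
  assumes "length ds = k" "length es = k" "vec_on ds v" "vec_on es w"
  shows "Eb (tensor_dims ds es) (tensor_vec ds v es w) = sqn es w * Eb ds v + sqn ds v * Eb es w"
proof (cases "sqn ds v = 0 \<or> sqn es w = 0")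
  case True
  then show ?thesis using assms by (auto simp: Eb_zero sqn_tensor)
next
  case False
  have st: "is_state k ds (normalized ds v)" "is_state k es (normalized es w)"
    using False assms by (auto intro!: is_state_normalized)
  have "sqn (tensor_dims ds es) (tensor_vec ds v es w) = sqn ds v * sqn es w"
    using assms by (simp add: sqn_tensor)
  then have "normalized (tensor_dims ds es) (tensor_vec ds v es w)
    = tensor_vec ds (normalized ds v) es (normalized es w)"
    unfolding normalized_def by (intro ext) (simp add: tensor_vec_def real_sqrt_mult)
  then have "Ev E (tensor_dims ds es) (normalized (tensor_dims ds es) (tensor_vec ds v es w))
     = Ev E ds (normalized ds v) + Ev E es (normalized es w)"
    using additive st unfolding fully_additive_def by metis
  then show ?thesis using assms by (simp add: Eb_def sqn_tensor algebra_simps)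
qed

lemma E_tensor:
  "is_state k ds v \<Longrightarrow> is_state k es w \<Longrightarrow> Ev E (tensor_dims ds es) (tensor_vec ds v es w) = Ev E ds v + Ev E es w"
  using additive unfolding fully_additive_def by blast

lemma E_tpow: "is_state k ds v \<Longrightarrow> Ev E (fst (tpow n ds v)) (snd (tpow n ds v)) = n * Ev E ds v"
proof (induction n)
  case 0
  then have "length ds = k" by (simp add: is_state_def)
  then show ?case using E_unit by (simp add: unit_vec_def)
next
  case (Suc n)
  then show ?case by (simp add: E_tensor is_state_tpow algebra_simps)
qed

text \<open>Every branch is a multiple of \<open>w\<close> and contributes its probability times
  \<open>E\<close> of \<open>w\<close>; the probabilities sum to one.\<close>

lemma reach_mono:
  assumes "reach ds v es (\<lambda>u. \<exists>c. u = (\<lambda>x. c * w x))" "is_state k ds v" "is_state k es w"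
  shows "Ev E es w \<le> Ev E ds v"
proof -
  obtain ws where ws: "ens ds v es ws" "\<forall>u\<in>set ws. \<exists>c. u = (\<lambda>x. c * w x)"
    using assms(1) unfolding reach_def by blast
  have "Eb es u = sqn es u * Ev E es w" if "u \<in> set ws" for u
    using ws(2) that assms(3) by (auto simp: Eb_scale sqn_scale Eb_state is_state_iff)
  then have "(\<Sum>u\<leftarrow>ws. Eb es u) = (\<Sum>u\<leftarrow>ws. sqn es u * Ev E es w)"
    by (intro arg_cong[where f = sum_list] map_cong) auto
  also have "\<dots> = sqn ds v * Ev E es w"
    by (simp add: sum_list_mult_const ens_sqn[OF ws(1), symmetric])
  finally show ?thesis
    using ens_mono[OF ws(1)] assms Eb_state[OF assms(2)] by (simp add: is_state_iff)
qed

end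

section \<open>Binary entropy and the continuity coefficients\<close>

lemma h_0 [simp]: "h 0 = 0" and h_1 [simp]: "h 1 = 0"
  by (simp_all add: h_def)

lemma h_symmetric: "h (1 - p) = h p"
  by (simp add: h_def algebra_simps)

lemma tendsto_h_at_right_0: "(h \<longlongrightarrow> 0) (at_right 0)"
  unfolding h_def by real_asymp

lemma neg_mult_log_le: "0 \<le> x \<Longrightarrow> - x * log 2 x \<le> (1 - x) / ln 2"
proof (cases "x = 0")
  case False
  assume "0 \<le> x"
  with False have x: "x > 0" by simp
  have "ln (1 / x) \<le> 1 / x - 1" using x by (intro ln_le_minus_one) simp
  then have "- ln x \<le> 1 / x - 1" using x by (simp add: ln_div)
  then have "x * - ln x \<le> x * (1 / x - 1)" using x by (intro mult_left_mono) auto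
  then have "- x * ln x \<le> 1 - x" using x by (simp add: right_diff_distrib)
  then have "- x * ln x / ln 2 \<le> (1 - x) / ln 2" by (intro divide_right_mono) auto
  then show ?thesis by (simp add: log_def)
qed simp

text \<open>Only finiteness matters: the bound makes the set of extraction defects bounded
  above.\<close>

lemma h_le: "0 \<le> p \<Longrightarrow> p \<le> 1 \<Longrightarrow> h p \<le> 1 / ln 2"
  using neg_mult_log_le[of p] neg_mult_log_le[of "1 - p"]
  by (simp add: h_def diff_divide_distrib algebra_simps)

text \<open>Chain rule for two independent bits of bias p. Their parity is odd with probability
  2p(1-p), and then one unbiased bit remains; given even parity, with probability s, a bit of bias
  p^2/s remains.\<close>

lemma h_two_copies:
  assumes "0 < p" "p < 1"
  defines "s \<equiv> p\<^sup>2 + (1 - p)\<^sup>2"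
  shows "2 * h p = h (2 * p * (1 - p)) + 2 * p * (1 - p) + s * h (p\<^sup>2 / s)"
proof -
  define q where "q = 1 - p"
  have q: "0 < q" "p + q = 1" using assms by (auto simp: q_def)
  have s: "0 < s" using assms by (simp add: s_def sum_power2_gt_zero_iff)
  have s': "s = p\<^sup>2 + q\<^sup>2" by (simp add: s_def q_def)
  have pq1: "1 - 2 * p * q = s"
  proof -
    have "(p + q)\<^sup>2 = 1" using q by simp
    then show ?thesis by (simp add: s' power2_eq_square algebra_simps)
  qed
  have ps: "1 - p\<^sup>2 / s = q\<^sup>2 / s"
  proof -
    have "q\<^sup>2 = s - p\<^sup>2" by (simp add: s')
    then show ?thesis using s by (simp add: diff_divide_distrib)
  qed
  have 1: "h (2 * p * q) = - 2 * p * q * (1 + log 2 p + log 2 q) - s * log 2 s"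
    using assms q unfolding h_def pq1 by (simp add: log_mult algebra_simps)
  have l: "log 2 (p\<^sup>2 / s) = 2 * log 2 p - log 2 s" "log 2 (q\<^sup>2 / s) = 2 * log 2 q - log 2 s"
    using assms q s by (auto simp: log_divide log_nat_power)
  have "s * h (p\<^sup>2 / s) = - p\<^sup>2 * (2 * log 2 p - log 2 s) - q\<^sup>2 * (2 * log 2 q - log 2 s)"
    unfolding h_def ps l using s by (simp add: algebra_simps)
  then have 2: "s * h (p\<^sup>2 / s) = - 2 * p * p * log 2 p - 2 * q * q * log 2 q + s * log 2 s"
    unfolding s' by (simp add: power2_eq_square algebra_simps)
  have "h (2 * p * q) + 2 * p * q + s * h (p\<^sup>2 / s) = - 2 * p * log 2 p * (p + q) - 2 * q * log 2 q * (p + q)"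
    unfolding 1 2 by (simp add: algebra_simps)
  also have "\<dots> = 2 * h p" using q by (simp add: h_def q_def)
  finally show ?thesis by (simp add: q_def)
qed

lemma coef_0: "acoef k 0 = 0" "bcoef k 0 = 0"
  by (simp_all add: acoef_def bcoef_def)

lemma tendsto_powr_at_right_0:
  assumes "0 < c" shows "((\<lambda>x. x powr c) \<longlongrightarrow> (0::real)) (at_right 0)"
  using assms by real_asymp

lemma tendsto_acoef: "(acoef k \<longlongrightarrow> 0) (at_right 0)"
proof -
  have "((\<lambda>x. ((1 + x powr (2 / (real k + 1))) ^ (k + 1) - 1 + x\<^sup>2) / (1 - x\<^sup>2)) \<longlongrightarrow> ((1 + 0) ^ (k + 1) - 1 + 0\<^sup>2) / (1 - 0\<^sup>2)) (at_right (0::real))"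
    by (intro tendsto_intros tendsto_powr_at_right_0) (auto simp: tendsto_ident_at)
  then show ?thesis by (simp add: acoef_def[abs_def])
qed

lemma tendsto_bcoef: "(bcoef k \<longlongrightarrow> 0) (at_right 0)"
proof -
  define c where "c = 2 / (real k + 1)"
  have c: "0 < c" by (simp add: c_def)
  have t: "filterlim (\<lambda>x. x powr c) (at_right 0) (at_right (0::real))"
    using c by real_asymp
  have "((\<lambda>t. h (inverse (1 + t))) \<longlongrightarrow> 0) (at_right 0)"
    unfolding h_def by real_asymp
  from filterlim_compose[OF this t]
  have "((\<lambda>x. (1 + x powr c) ^ (k + 1) / (1 - x\<^sup>2) * h (inverse (1 + x powr c))) \<longlongrightarrow> (1 + 0) ^ (k + 1) / (1 - 0\<^sup>2) * 0) (at_right (0::real))"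
    by (intro tendsto_intros tendsto_powr_at_right_0 c) (auto simp: tendsto_ident_at)
  then show ?thesis by (simp add: bcoef_def[abs_def] c_def)
qed

lemma sqn_residual:
  assumes "sqn ds v = 1" "sqn ds w = 1"
  shows "sqn ds (\<lambda>x. w x - ip ds v w * v x) = 1 - (cmod (ip ds v w))\<^sup>2"
proof -
  define c where "c = ip ds v w"
  have "complex_of_real (sqn ds (\<lambda>x. w x - c * v x)) = ip ds w w - cnj c * ip ds v w - c * ip ds w v + cnj c * c * ip ds v v"
    unfolding sqn_ip unfolding ip_def
    by (simp add: algebra_simps sum.distrib sum_subtractf sum_distrib_left)
  also have "\<dots> = 1 - c * cnj c"
    by (simp add: ip_commute[of ds w v] c_def[symmetric] sqn_ip[symmetric] assms)
  also have "\<dots> = complex_of_real (1 - (cmod c)\<^sup>2)"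
    by (simp add: complex_norm_square del: of_real_power)
  finally show ?thesis unfolding c_def using of_real_eq_iff by blast
qed

lemma log_dimH_nonneg: "is_state k ds v \<Longrightarrow> 0 \<le> log 2 (dimH ds)"
  using is_state_dimH_pos[of k ds v] by (subst zero_le_log_cancel_iff) auto

lemma pdist_pure_nonneg:
  assumes "is_state k ds v" "is_state k ds w"
  shows "0 \<le> pdist ds (proj ds v) (proj ds w)"
proof -
  have "(cmod (ip ds w v))\<^sup>2 \<le> 1"
    using ip_Cauchy_Schwarz[of ds w v] assms by (simp add: is_state_iff)
  then show ?thesis unfolding pdist_pure[OF assms] by (rule_tac real_sqrt_ge_zero) linarith
qed

text \<open>Both coefficients vanish as \<delta> tends to 0. Once they are below \<epsilon>, the
  bound is below \<epsilon> (1 + log dim), which is exactly the scale of the normalisation.\<close>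

lemma cont_bound_imp_asym_continuous:
  assumes "cont_bound k E" shows "asym_continuous k E"
  unfolding asym_continuous_def
proof (intro allI impI)
  fix \<epsilon> :: real assume \<epsilon>: "\<epsilon> > 0"
  have "eventually (\<lambda>x. acoef k x < \<epsilon> \<and> bcoef k x < \<epsilon>) (at_right 0)"
    using \<epsilon> tendsto_acoef[of k] tendsto_bcoef[of k] by (intro eventually_conj) (auto intro: order_tendstoD)
  then obtain d where d: "d > 0" "\<And>x. 0 < x \<Longrightarrow> x < d \<Longrightarrow> acoef k x < \<epsilon> \<and> bcoef k x < \<epsilon>"
    unfolding eventually_at_right_field by blast
  show "\<exists>\<delta>>0. \<forall>ds v es w. is_state k ds v \<longrightarrow> is_state k es w \<longrightarrow> sdist ds v es w < \<delta> \<longrightarrow>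
      \<bar>Ev E ds v / (1 + log 2 (dimH ds)) - Ev E es w / (1 + log 2 (dimH es))\<bar> < \<epsilon>"
  \<comment> \<open>The cap 1 forces equal spaces, since states on different spaces have distance 1,
    and it makes \<open>cont_bound\<close> applicable.\<close>
  proof (intro exI[where x = "min d 1"] conjI allI impI)
    fix ds v es w assume st: "is_state k ds v" "is_state k es w" and sd: "sdist ds v es w < min d 1"
    then have es: "es = ds" by (auto simp: sdist_def split: if_splits)
    define \<delta> where "\<delta> = pdist ds (proj ds v) (proj ds w)"
    have \<delta>: "0 \<le> \<delta>" "\<delta> < d" "\<delta> < 1"
      using sd pdist_pure_nonneg[of k ds v w] st by (auto simp: sdist_def \<delta>_def es)
    \<comment> \<open>The limits concern positive arguments only, so \<delta> = 0 is treated
      separately.\<close>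
    have ab: "acoef k \<delta> < \<epsilon>" "bcoef k \<delta> < \<epsilon>"
      using d(2)[of \<delta>] \<delta> \<epsilon> by (cases "\<delta> = 0"; simp add: coef_0)+
    have "\<bar>Ev E ds v - Ev E ds w\<bar> \<le> acoef k \<delta> * log 2 (dimH ds) + bcoef k \<delta>"
      using assms st \<delta>(3) unfolding cont_bound_def es \<delta>_def Let_def by blast
    also have "\<dots> < \<epsilon> * log 2 (dimH ds) + \<epsilon>"
      using ab log_dimH_nonneg[OF st(1)] by (intro add_le_less_mono mult_right_mono) auto
    finally have "\<bar>Ev E ds v - Ev E ds w\<bar> < \<epsilon> * (1 + log 2 (dimH ds))" by (simp add: algebra_simps)
    then show "\<bar>Ev E ds v / (1 + log 2 (dimH ds)) - Ev E es w / (1 + log 2 (dimH es))\<bar> < \<epsilon>"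
      using log_dimH_nonneg[OF st(1)] unfolding es diff_divide_distrib[symmetric] by (simp add: divide_less_eq)
  qed (use d in auto)
qed

section \<open>Direct sums\<close>

definition shift :: "nat list \<Rightarrow> nat list \<Rightarrow> nat list" where
  "shift ds y = map2 (+) ds y"

lemma length_dsum_dims [simp]: "length (dsum_dims ds es) = min (length ds) (length es)"
  by (simp add: dsum_dims_def)

lemma dsum_dims_nth: "length ds = length es \<Longrightarrow> i < length es \<Longrightarrow> dsum_dims ds es ! i = ds ! i + es ! i"
  by (simp add: dsum_dims_def)

lemma shift_nth: "length ds = length y \<Longrightarrow> i < length y \<Longrightarrow> shift ds y ! i = ds ! i + y ! i"
  by (simp add: shift_def)

lemma length_shift [simp]: "length (shift ds y) = min (length ds) (length y)"
  by (simp add: shift_def)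

lemma inj_on_shift:
  assumes "length ds = length es"
  shows "inj_on (shift ds) (idxs es)"
proof (rule inj_onI)
  fix y y' assume y: "y \<in> idxs es" "y' \<in> idxs es" "shift ds y = shift ds y'"
  show "y = y'"
  proof (rule nth_equalityI)
    fix i assume i: "i < length y"
    have "shift ds y ! i = shift ds y' ! i" by (simp only: y(3))
    then show "y ! i = y' ! i" using y(1,2) i assms by (simp add: shift_nth idxs_def)
  qed (use y in \<open>simp add: idxs_def\<close>)
qed

lemma vec_on_dsum: "vec_on (dsum_dims ds es) (dsum_vec a ds v b es w)"
  by (simp add: vec_on_def dsum_vec_def)

context
  fixes ds es :: "nat list"
  assumes len: "length ds = length es" and ne: "0 < length es"
begin

lemma idxs_dsum_left: "x \<in> idxs ds \<Longrightarrow> x \<in> idxs (dsum_dims ds es)"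
  using len by (auto simp: idxs_def dsum_dims_nth trans_less_add1)

lemma idxs_dsum_right: "y \<in> idxs es \<Longrightarrow> shift ds y \<in> idxs (dsum_dims ds es)"
  using len by (auto simp: idxs_def dsum_dims_nth shift_nth)

lemma dsum_vec_left: "x \<in> idxs ds \<Longrightarrow> dsum_vec a ds v b es w x = a * v x"
  using idxs_dsum_left[of x] by (auto simp: dsum_vec_def idxs_def)

lemma dsum_vec_right: "y \<in> idxs es \<Longrightarrow> dsum_vec a ds v b es w (shift ds y) = b * w y"
proof -
  assume y: "y \<in> idxs es"
  have "map2 (-) (shift ds y) ds = y" using y len by (intro nth_equalityI) (auto simp: shift_def idxs_def)
  moreover have "\<not> (\<forall>i<length ds. shift ds y ! i < ds ! i)" "\<forall>i<length ds. ds ! i \<le> shift ds y ! i"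
    using y len ne by (auto simp: shift_nth idxs_def)
  ultimately show ?thesis using idxs_dsum_right[OF y] by (auto simp: dsum_vec_def)
qed

lemma dsum_vec_other:
  assumes "x \<in> idxs (dsum_dims ds es)" "x \<notin> idxs ds" "x \<notin> shift ds ` idxs es"
  shows "dsum_vec a ds v b es w x = 0"
proof -
  have lx: "length x = length ds" using assms(1) len by (simp add: idxs_def)
  have 1: "\<not> (\<forall>i<length ds. x ! i < ds ! i)" using assms(2) lx by (auto simp: idxs_def)
  have 2: "\<not> (\<forall>i<length ds. ds ! i \<le> x ! i)"
  proof
    assume *: "\<forall>i<length ds. ds ! i \<le> x ! i"
    have "x = shift ds (map2 (-) x ds)" using * lx by (intro nth_equalityI) (auto simp: shift_def)
    moreover have "map2 (-) x ds \<in> idxs es"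
      using * lx assms(1) len by (auto simp: idxs_def dsum_dims_nth less_diff_conv2)
    ultimately show False using assms(3) by blast
  qed
  from 1 2 show ?thesis by (auto simp: dsum_vec_def)
qed

text \<open>Indices that mix the two blocks carry amplitude 0, which \<open>G\<close> ignores. The
  two pure blocks are disjoint because there is at least one party.\<close>

lemma sum_dsum:
  fixes G :: "nat list \<Rightarrow> complex \<Rightarrow> 'b :: comm_monoid_add"
  assumes "\<And>x. G x 0 = 0"
  shows "(\<Sum>x\<in>idxs (dsum_dims ds es). G x (dsum_vec a ds v b es w x))
    = (\<Sum>x\<in>idxs ds. G x (a * v x)) + (\<Sum>y\<in>idxs es. G (shift ds y) (b * w y))"
proof -
  have disj: "idxs ds \<inter> shift ds ` idxs es = {}"
    using len ne by (auto simp: idxs_def shift_nth)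
  note inj = inj_on_shift[OF len]
  have "(\<Sum>x\<in>idxs (dsum_dims ds es). G x (dsum_vec a ds v b es w x))
     = (\<Sum>x\<in>idxs ds \<union> shift ds ` idxs es. G x (dsum_vec a ds v b es w x))"
    using idxs_dsum_left idxs_dsum_right dsum_vec_other assms
    by (intro sum.mono_neutral_right) auto
  also have "\<dots> = (\<Sum>x\<in>idxs ds. G x (dsum_vec a ds v b es w x)) + (\<Sum>y\<in>idxs es. G (shift ds y) (dsum_vec a ds v b es w (shift ds y)))"
    using disj by (subst sum.union_disjoint) (auto simp: sum.reindex[OF inj])
  finally show ?thesis by (simp add: dsum_vec_left dsum_vec_right)
qed

lemma sqn_dsum: "sqn (dsum_dims ds es) (dsum_vec a ds v b es w) = (cmod a)\<^sup>2 * sqn ds v + (cmod b)\<^sup>2 * sqn es w"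
  unfolding sqn_def by (subst sum_dsum) (auto simp: norm_mult power_mult_distrib sum_distrib_left)

end

lemma is_state_dsum:
  assumes "is_state k ds v" "is_state k es w" "0 < k" "0 \<le> p" "p \<le> 1"
  shows "is_state k (dsum_dims ds es) (dsum_vec (complex_of_real (sqrt p)) ds v (complex_of_real (sqrt (1 - p))) es w)"
  using assms by (auto simp: is_state_iff vec_on_dsum sqn_dsum)

section \<open>From the direct sum rule to the explicit continuity bound\<close>

context ent_measure
begin

lemma k_pos: "0 < k" using k2 by simp

text \<open>Equality in Cauchy-Schwarz leaves no residual, so the vectors differ by a phase, which
  the projector forgets.\<close>

lemma E_eq_of_ip:
  assumes v: "is_state k ds v" and w: "is_state k ds w" and ip: "cmod (ip ds v w) = 1"
  shows "Ev E ds w = Ev E ds v"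
proof -
  define c where "c = ip ds v w"
  define r where "r = (\<lambda>x. w x - c * v x)"
  have "sqn ds r = 0" using sqn_residual[of ds v w] v w ip by (simp add: r_def c_def is_state_iff)
  moreover have "vec_on ds r" using v w by (simp add: r_def vec_on_def is_state_iff)
  ultimately have "r = (\<lambda>_. 0)" by (metis sqn_eq_0)
  then have "w = (\<lambda>x. c * v x)" unfolding r_def by (metis (no_types) eq_iff_diff_eq_0)
  then have "Eb ds w = (cmod c)\<^sup>2 * Eb ds v" by (simp add: Eb_scale)
  then show ?thesis using ip Eb_state v w by (simp add: c_def)
qed

text \<open>Success with probability q gives q E(v) \<le> p E(w) + (1-p) E(\<xi>) + h(p). Replacing
  all of the right-hand side except q E(w) and h(p) by the dimension bound \<open>ub\<close> and
  dividing by q produces the two coefficients. The estimate is one-sided; the other side follows by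
  exchanging the vectors.\<close>

lemma dsum_rule_imp_bound:
  assumes rule: "dsum_rule k E" and ub: "\<And>ds v. is_state k ds v \<Longrightarrow> Ev E ds v \<le> log 2 (dimH ds)"
    and v: "is_state k ds v" and w: "is_state k ds w"
    and \<delta>: "\<delta> = sqrt (1 - (cmod (ip ds v w))\<^sup>2)" "\<delta> < 1"
  shows "Ev E ds v - Ev E ds w \<le> acoef k \<delta> * log 2 (dimH ds) + bcoef k \<delta>"
proof -
  define c where "c = ip ds v w"
  define r where "r = (\<lambda>x. w x - c * v x)"
  define L where "L = log 2 (dimH ds)"
  have len: "length ds = k" and on: "vec_on ds v" "vec_on ds w" and n1: "sqn ds v = 1" "sqn ds w = 1"
    using v w by (auto simp: is_state_iff)
  have c1: "(cmod c)\<^sup>2 \<le> 1" using ip_Cauchy_Schwarz[of ds v w] n1 by (simp add: c_def)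
  then have \<delta>2: "\<delta>\<^sup>2 = 1 - (cmod c)\<^sup>2" and \<delta>0: "0 \<le> \<delta>" using \<delta> by (auto simp: c_def)
  have rn: "sqn ds r = \<delta>\<^sup>2"
    using sqn_residual[OF n1] \<delta>2 by (simp add: r_def c_def)
  have ron: "vec_on ds r" using on by (simp add: r_def vec_on_def)
  show ?thesis
  proof (cases "\<delta> = 0")
    case True
    then have "(cmod c)\<^sup>2 = 1" using \<delta>2 by simp
    then have "cmod (ip ds v w) = 1" using norm_ge_zero[of c] unfolding c_def power2_eq_1_iff by linarith
    then have "Ev E ds w = Ev E ds v" by (rule E_eq_of_ip[OF v w])
    then show ?thesis using True by (simp add: coef_0)
  next
    case False
    with \<delta>0 have dpos: "0 < \<delta>" by simp
    \<comment> \<open>The sign makes \<delta>\<xi> cancel the residual \<open>r\<close> of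
      \<open>w\<close>.\<close>
    define \<xi> where "\<xi> = (\<lambda>x. complex_of_real (- 1 / \<delta>) * r x)"
    have "sqn ds \<xi> = 1" unfolding \<xi>_def sqn_scale using rn dpos by (simp add: norm_divide power_divide)
    then have \<xi>: "is_state k ds \<xi>"
      using len ron by (auto simp: is_state_iff \<xi>_def vec_on_def)
    \<comment> \<open>Chosen so that sqrt t to the power k+1 is \<delta>, as the cancellation below
      requires.\<close>
    define t where "t = \<delta> powr (2 / (real k + 1))"
    have t: "0 < t" using dpos by (simp add: t_def)
    have tk: "t ^ (k + 1) = \<delta>\<^sup>2"
    proof -
      have "t ^ (k + 1) = t powr real (k + 1)" using t by (simp only: powr_realpow)
      also have "\<dots> = \<delta> powr (2 / (real k + 1) * real (k + 1))" by (simp only: t_def powr_powr)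
      also have "2 / (real k + 1) * real (k + 1) = 2" by (simp add: divide_eq_eq)
      finally show ?thesis using dpos by (simp add: powr_numeral)
    qed
    define p where "p = inverse (1 + t)"
    have p: "0 < p" "p < 1" "1 - p = t * p" using t by (auto simp: p_def field_simps)
    define \<alpha> where "\<alpha> = sqrt p"
    define \<beta> where "\<beta> = sqrt (1 - p)"
    have \<alpha>\<beta>: "\<alpha> * \<alpha> + \<beta> * \<beta> = 1" using p by (simp add: \<alpha>_def \<beta>_def)
    have \<beta>t: "\<beta> = sqrt t * \<alpha>" using p by (simp add: \<alpha>_def \<beta>_def real_sqrt_mult)
    \<comment> \<open>The amplitude with which \<xi> survives, on the left, must be \<delta> times
      the amplitude with which \<open>w\<close> survives.\<close>
    have cancel: "\<beta> ^ k * sqrt (1 - p) = \<delta> * (\<alpha> ^ k * sqrt p)"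
    proof -
      have "\<beta> ^ k * sqrt (1 - p) = \<beta> ^ (k + 1)" by (simp add: \<beta>_def)
      also have "\<dots> = sqrt (t ^ (k + 1)) * \<alpha> ^ (k + 1)" by (simp add: \<beta>t power_mult_distrib real_sqrt_power real_sqrt_mult)
      also have "sqrt (t ^ (k + 1)) = \<delta>" unfolding tk using dpos by simp
      finally show ?thesis by (simp add: \<alpha>_def)
    qed
    define D where "D = dsum_dims ds ds"
    define \<Omega> where "\<Omega> = dsum_vec (complex_of_real (sqrt p)) ds w (complex_of_real (sqrt (1 - p))) ds \<xi>"
    have \<Omega>: "is_state k D \<Omega>" unfolding D_def \<Omega>_def using w \<xi> p k_pos by (intro is_state_dsum) auto
    have Di: "D ! i = ds ! i + ds ! i" if "i < k" for i using that len by (simp add: D_def dsum_dims_nth)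
    \<comment> \<open>\<open>res\<close> forgets the block. \<open>F\<close> is the row (\<alpha>,
      \<beta>) on the two copies of the local space and \<open>F'\<close> is the orthogonal row
      (-\<beta>, \<alpha>). Together they form a rotation, hence an instrument.\<close>
    define res where "res = (\<lambda>i a. if a < ds ! i then a else a - ds ! i)"
    define F where "F = (\<lambda>i b a. if b = res i a then complex_of_real (if a < ds ! i then \<alpha> else \<beta>) else 0)"
    define F' where "F' = (\<lambda>i b a. if b = res i a then complex_of_real (if a < ds ! i then - \<beta> else \<alpha>) else 0)"
    have instr: "local_instr (D ! i) (ds ! i) [F i, F' i]" if i: "i < k" for i
      unfolding local_instr_def
    proof (intro allI impI)
      fix a b assume ab: "a < D ! i" "b < D ! i"
      then have ra: "res i a < ds ! i" using Di[OF i] by (auto simp: res_def)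
      have "(\<Sum>c<ds ! i. cnj (F i c a) * F i c b) = (\<Sum>c<ds ! i. if c = res i a then (if res i a = res i b
          then complex_of_real ((if a < ds ! i then \<alpha> else \<beta>) * (if b < ds ! i then \<alpha> else \<beta>)) else 0) else 0)"
        by (intro sum.cong) (auto simp: F_def)
      moreover have "(\<Sum>c<ds ! i. cnj (F' i c a) * F' i c b) = (\<Sum>c<ds ! i. if c = res i a then (if res i a = res i b
          then complex_of_real ((if a < ds ! i then - \<beta> else \<alpha>) * (if b < ds ! i then - \<beta> else \<alpha>)) else 0) else 0)"
        by (intro sum.cong) (auto simp: F'_def)
      ultimately have "(\<Sum>K\<leftarrow>[F i, F' i]. \<Sum>c<ds ! i. cnj (K c a) * K c b) = (if res i a = res i b
          then complex_of_real ((if a < ds ! i then \<alpha> else \<beta>) * (if b < ds ! i then \<alpha> else \<beta>)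
             + (if a < ds ! i then - \<beta> else \<alpha>) * (if b < ds ! i then - \<beta> else \<alpha>)) else 0)"
        using ra by simp
      also have "\<dots> = (if a = b then 1 else 0)"
      proof (cases "res i a = res i b")
        case True
        then have "a = b \<longleftrightarrow> (a < ds ! i \<longleftrightarrow> b < ds ! i)" by (auto simp: res_def split: if_splits)
        moreover have "complex_of_real (\<alpha> * \<alpha> + \<beta> * \<beta>) = 1" "complex_of_real (\<beta> * \<beta> + \<alpha> * \<alpha>) = 1"
          using \<alpha>\<beta> by (simp_all add: add.commute)
        ultimately show ?thesis using True by (auto simp: algebra_simps simp del: of_real_add of_real_mult)
      qed auto
      finally show "(\<Sum>K\<leftarrow>[F i, F' i]. \<Sum>c<ds ! i. cnj (K c a) * K c b) = (if a = b then 1 else 0)" .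
    qed
    have "prod_app D ds F \<Omega> = (\<lambda>y. complex_of_real (\<alpha> ^ k * sqrt p) * c * v y)"
    proof
      fix y
      show "prod_app D ds F \<Omega> y = complex_of_real (\<alpha> ^ k * sqrt p) * c * v y"
      proof (cases "y \<in> idxs ds")
        case y: True
        have eqv: "(\<forall>i<k. y ! i = x ! i) \<longleftrightarrow> x = y" if "x \<in> idxs ds" for x
        proof
          assume "\<forall>i<k. y ! i = x ! i"
          then show "x = y" using that y len by (intro nth_equalityI) (auto simp: idxs_def)
        qed simp
        have pl: "(\<Prod>i<length D. F i (y ! i) (x ! i)) = (if x = y then complex_of_real (\<alpha> ^ k) else 0)" if x: "x \<in> idxs ds" for x
        proof -
          have "(\<Prod>i<length D. F i (y ! i) (x ! i)) = (\<Prod>i<k. if y ! i = x ! i then complex_of_real \<alpha> else 0)"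
            using x len by (intro prod.cong) (auto simp: D_def F_def res_def idxs_def)
          also have "\<dots> = (if x = y then complex_of_real (\<alpha> ^ k) else 0)"
            unfolding prod_monomial eqv[OF x] by simp
          finally show ?thesis .
        qed
        have pr: "(\<Prod>i<length D. F i (y ! i) (shift ds x ! i)) = (if x = y then complex_of_real (\<beta> ^ k) else 0)" if x: "x \<in> idxs ds" for x
        proof -
          have "(\<Prod>i<length D. F i (y ! i) (shift ds x ! i)) = (\<Prod>i<k. if y ! i = x ! i then complex_of_real \<beta> else 0)"
            using x len by (intro prod.cong) (auto simp: D_def F_def res_def idxs_def shift_nth)
          also have "\<dots> = (if x = y then complex_of_real (\<beta> ^ k) else 0)"
            unfolding prod_monomial eqv[OF x] by simp
          finally show ?thesis .
        qed
        have "prod_app D ds F \<Omega> y = (\<Sum>x\<in>idxs D. (\<Prod>i<length D. F i (y ! i) (x ! i)) * \<Omega> x)"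
          using y by (simp add: prod_app_def)
        also have "\<dots> = (\<Sum>x\<in>idxs ds. (\<Prod>i<length D. F i (y ! i) (x ! i)) * (complex_of_real (sqrt p) * w x))
           + (\<Sum>x\<in>idxs ds. (\<Prod>i<length D. F i (y ! i) (shift ds x ! i)) * (complex_of_real (sqrt (1 - p)) * \<xi> x))"
          unfolding D_def \<Omega>_def using len k_pos by (subst sum_dsum) auto
        also have "\<dots> = (\<Sum>x\<in>idxs ds. if x = y then complex_of_real (\<alpha> ^ k) * (complex_of_real (sqrt p) * w x) else 0)
           + (\<Sum>x\<in>idxs ds. if x = y then complex_of_real (\<beta> ^ k) * (complex_of_real (sqrt (1 - p)) * \<xi> x) else 0)"
          by (intro arg_cong2[where f = "(+)"] sum.cong) (auto simp: pl pr)
        also have "\<dots> = complex_of_real (\<alpha> ^ k * sqrt p) * w y + complex_of_real (\<beta> ^ k * sqrt (1 - p)) * \<xi> y"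
          using y by simp
        also have "\<dots> = complex_of_real (\<alpha> ^ k * sqrt p) * (w y + complex_of_real \<delta> * \<xi> y)"
          unfolding cancel by (simp add: algebra_simps)
        also have "complex_of_real \<delta> * \<xi> y = - r y" using dpos by (simp add: \<xi>_def)
        finally show ?thesis by (simp add: r_def)
      qed (use on in \<open>simp add: prod_app_def vec_on_def\<close>)
    qed
    then have "(\<alpha> ^ k * sqrt p)\<^sup>2 * (cmod c)\<^sup>2 * Ev E ds v = Eb ds (prod_app D ds F \<Omega>)"
      using p by (simp add: Eb_scale Eb_state[OF v] norm_mult power_mult_distrib norm_power \<alpha>_def)
    also have "\<dots> \<le> Eb D \<Omega>"
      using \<Omega> len instr by (intro Eb_prod_app_le) (auto simp: is_state_iff intro!: exI[where x = "[F _, F' _]"])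
    also have "Eb D \<Omega> = p * Ev E ds w + (1 - p) * Ev E ds \<xi> + h p"
      unfolding Eb_state[OF \<Omega>] unfolding D_def \<Omega>_def
      using rule[unfolded dsum_rule_def, rule_format, OF w \<xi>, of p] p(1,2) by simp
    finally have main: "(\<alpha> ^ k * sqrt p)\<^sup>2 * (cmod c)\<^sup>2 * Ev E ds v \<le> p * Ev E ds w + (1 - p) * Ev E ds \<xi> + h p" .
    \<comment> \<open>The probability of success and the origin of the coefficients:
      \<open>acoef\<close> is 1/q - 1 and \<open>bcoef\<close> is h(p)/q.\<close>
    define q where "q = (1 - \<delta>\<^sup>2) / (1 + t) ^ (k + 1)"
    have "\<alpha>\<^sup>2 = p" using p by (simp add: \<alpha>_def)
    then have "(\<alpha> ^ k * sqrt p)\<^sup>2 = p ^ (k + 1)"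
      using p by (simp add: power_mult_distrib power_mult[symmetric] mult.commute[of k] power_mult)
    then have q: "(\<alpha> ^ k * sqrt p)\<^sup>2 * (cmod c)\<^sup>2 = q"
      by (simp add: q_def \<delta>2 p_def power_inverse divide_inverse mult.commute)
    have \<delta>lt: "\<delta>\<^sup>2 < 1" using \<delta>(2) \<delta>0 by (simp add: power_less_one_iff)
    have q0: "0 < q" using \<delta>lt t by (simp add: q_def)
    \<comment> \<open>This fixes the sign of p - q, the coefficient with which E(w) is replaced by
      its upper bound.\<close>
    have qp: "q \<le> p"
    proof -
      have "q = (1 - \<delta>\<^sup>2) * p * inverse ((1 + t) ^ k)" using t by (simp add: q_def p_def field_simps)
      also have "\<dots> \<le> 1 * p * 1"
        using \<delta>lt p t by (intro mult_mono) (auto simp: inverse_le_1_iff)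
      finally show ?thesis by simp
    qed
    have a: "acoef k \<delta> = 1 / q - 1" and b: "bcoef k \<delta> = h p / q"
      unfolding acoef_def bcoef_def t_def[symmetric] p_def[symmetric] q_def
      using \<delta>lt t by (simp_all add: field_simps)
    have bounds: "Ev E ds w \<le> L" "Ev E ds \<xi> \<le> L" using ub w \<xi> by (auto simp: L_def)
    have "q * Ev E ds v \<le> p * Ev E ds w + (1 - p) * Ev E ds \<xi> + h p" using main unfolding q .
    also have "\<dots> = q * Ev E ds w + (p - q) * Ev E ds w + (1 - p) * Ev E ds \<xi> + h p" by (simp add: algebra_simps)
    also have "\<dots> \<le> q * Ev E ds w + (p - q) * L + (1 - p) * L + h p"
      using qp q0 p(1,2) bounds by (intro add_mono mult_left_mono) auto
    finally have "q * (Ev E ds v - Ev E ds w) \<le> (1 - q) * L + h p" by (simp add: algebra_simps)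
    then have "Ev E ds v - Ev E ds w \<le> ((1 - q) * L + h p) / q" using q0 by (simp add: field_simps)
    also have "\<dots> = acoef k \<delta> * L + bcoef k \<delta>" unfolding a b using q0 by (simp add: field_simps)
    finally show ?thesis by (simp add: L_def)
  qed
qed

lemma dsum_rule_imp_cont_bound:
  assumes "dsum_rule k E" "\<And>ds v. is_state k ds v \<Longrightarrow> Ev E ds v \<le> log 2 (dimH ds)"
  shows "cont_bound k E"
  unfolding cont_bound_def Let_def
proof (intro allI impI)
  fix ds v w assume st: "is_state k ds v" "is_state k ds w" and lt: "pdist ds (proj ds v) (proj ds w) < 1"
  have sym: "cmod (ip ds v w) = cmod (ip ds w v)" by (subst ip_commute) simp
  have d: "pdist ds (proj ds v) (proj ds w) = sqrt (1 - (cmod (ip ds v w))\<^sup>2)"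
    "pdist ds (proj ds v) (proj ds w) = sqrt (1 - (cmod (ip ds w v))\<^sup>2)"
    using pdist_pure[OF st] sym by simp_all
  show "\<bar>Ev E ds v - Ev E ds w\<bar> \<le> acoef k (pdist ds (proj ds v) (proj ds w)) * log 2 (dimH ds) + bcoef k (pdist ds (proj ds v) (proj ds w))"
    using dsum_rule_imp_bound[OF assms st d(1) lt] dsum_rule_imp_bound[OF assms st(2,1) d(2) lt] by linarith
qed

text \<open>One power \<open>n\<close> with small conversion error is enough for each \<epsilon>:
  additivity divides the resulting estimate by n, and the continuity error \<epsilon>(1 + n log dim)
  grows only linearly in n.\<close>

lemma asym_continuous_imp_F_pure:
  assumes ac: "asym_continuous k E" shows "E \<in> F_pure k"
proof -
  have "Ev E es w \<le> Ev E ds v" if v: "is_state k ds v" and w: "is_state k es w" and ge: "asym_ge ds v es w" for ds v es w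
  proof -
    define L where "L = log 2 (dimH es)"
    have key: "(1 - \<epsilon>) * (Ev E es w - \<epsilon> * (1 + L)) \<le> Ev E ds v" if \<epsilon>: "0 < \<epsilon>" "\<epsilon> < 1" for \<epsilon>
    proof (cases "0 \<le> Ev E es w - \<epsilon> * (1 + L)")
      case True
      obtain \<delta> where \<delta>: "\<delta> > 0" "\<And>ds v es w. is_state k ds v \<Longrightarrow> is_state k es w \<Longrightarrow> sdist ds v es w < \<delta> \<Longrightarrow>
        \<bar>Ev E ds v / (1 + log 2 (dimH ds)) - Ev E es w / (1 + log 2 (dimH es))\<bar> < \<epsilon>"
        using ac \<epsilon> unfolding asym_continuous_def by meson
      define \<eta> where "\<eta> = \<delta> * sqrt \<epsilon>"
      \<comment> \<open>A conversion error below \<eta> bounds the mean infidelity by \<delta>^2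
        \<epsilon>, so branches at distance \<delta> or more have total weight at most
        \<epsilon>.\<close>
      have \<eta>: "0 < \<eta>" "\<eta>\<^sup>2 = \<delta>\<^sup>2 * \<epsilon>" using \<delta> \<epsilon> by (auto simp: \<eta>_def power_mult_distrib)
      let ?f = "\<lambda>n. INF \<epsilon>\<in>{\<epsilon>. 0 \<le> \<epsilon> \<and>
        eps_conv (fst (tpow n ds v)) (proj (fst (tpow n ds v)) (snd (tpow n ds v)))
                 (fst (tpow n es w)) (proj (fst (tpow n es w)) (snd (tpow n es w))) \<epsilon>}. ereal \<epsilon>"
      have "limsup ?f < ereal \<eta>" using ge \<eta> unfolding asym_ge_def by simp
      then have "eventually (\<lambda>n. ?f n < ereal \<eta>) sequentially" by (rule Limsup_lessD)
      then obtain n where n: "n \<ge> 1" "?f n < ereal \<eta>"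
        by (metis (no_types, lifting) eventually_sequentially nle_le)
      define dn vn en wn where defs: "dn = fst (tpow n ds v)" "vn = snd (tpow n ds v)" "en = fst (tpow n es w)" "wn = snd (tpow n es w)"
      obtain e where e: "0 \<le> e" "e < \<eta>" "eps_conv dn (proj dn vn) en (proj en wn) e"
        using n(2) unfolding INF_less_iff defs by auto
      then obtain La where La: "LOCC dn en La" "pdist en (channel_out dn La (proj dn vn)) (proj en wn) \<le> e"
        unfolding eps_conv_def by blast
      have vn: "is_state k dn vn" and wn: "is_state k en wn" using is_state_tpow v w by (auto simp: defs)
      have Evn: "Ev E dn vn = n * Ev E ds v" "Ev E en wn = n * Ev E es w"
        using E_tpow v w by (auto simp: defs)
      define us where "us = map (\<lambda>A. op_vec dn A vn) (map snd La)"
      have ens: "ens dn vn en us" using La unfolding ens_def us_def by blast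
      have "sqrt (1 - (\<Sum>u\<leftarrow>us. (cmod (ip en wn u))\<^sup>2)) \<le> e"
        using La(2) pdist_ens[of en wn dn La vn] wn by (simp add: is_state_iff us_def)
      then have "1 - (\<Sum>u\<leftarrow>us. (cmod (ip en wn u))\<^sup>2) \<le> e\<^sup>2" by (rule sqrt_le_D)
      also have "e\<^sup>2 \<le> \<eta>\<^sup>2" using e by (intro power_mono) auto
      finally have fid: "1 - (\<Sum>u\<leftarrow>us. (cmod (ip en wn u))\<^sup>2) \<le> \<delta>\<^sup>2 * \<epsilon>" by (simp add: \<eta>)
      have tot: "(\<Sum>u\<leftarrow>us. sqn en u) = 1" using ens_sqn[OF ens] vn by (simp add: is_state_iff)
      \<comment> \<open>A lower bound for \<open>E\<close> on every normalised branch within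
        distance \<delta> of the target.\<close>
      define B where "B = n * Ev E es w - \<epsilon> * (1 + n * L)"
      have Ln: "log 2 (dimH en) = n * L"
        using is_state_dimH_pos[OF w] by (simp add: defs dimH_tpow L_def log_nat_power)
      have L0: "0 \<le> L" using log_dimH_nonneg[OF w] by (simp add: L_def)
      have Bn: "n * (Ev E es w - \<epsilon> * (1 + L)) \<le> B" 
      proof -
        have "\<epsilon> * 1 \<le> \<epsilon> * real n" using n \<epsilon> by (intro mult_left_mono) auto
        then show ?thesis by (simp add: B_def algebra_simps)
      qed
      then have B0: "0 \<le> B" using True by (meson mult_nonneg_nonneg of_nat_0_le_iff order_trans)
      \<comment> \<open>Markov's inequality in pointwise form. The coefficient of \<open>B\<close>
        is at most the weight of the branch, and it is nonpositive when the branch is at distance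
        \<delta> or more. Being linear in weight and overlap, it can be summed over the
        ensemble.\<close>
      have each: "(sqn en u - (sqn en u - (cmod (ip en wn u))\<^sup>2) / \<delta>\<^sup>2) * B \<le> Eb en u" if u: "u \<in> set us" for u
      proof (cases "sqn en u = 0")
        case True
        have "(cmod (ip en wn u))\<^sup>2 \<le> 0" using ip_Cauchy_Schwarz[of en wn u] True by simp
        then show ?thesis using True by (simp add: Eb_zero)
      next
        case False
        have on: "vec_on en u" using ens_vec_on[OF ens u] .
        have len: "length en = k" using wn by (simp add: is_state_iff)
        define s where "s = sqn en u"
        have s: "0 < s" using False sqn_nonneg[of en u] by (simp add: s_def)
        define u' where "u' = normalized en u"
        have u': "is_state k en u'" using is_state_normalized[OF len on False] by (simp add: u'_def)
        have ip': "(cmod (ip en wn u'))\<^sup>2 = (cmod (ip en wn u))\<^sup>2 / s"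
        proof -
          have "ip en wn u' = ip en wn u / complex_of_real (sqrt s)"
            by (simp add: u'_def normalized_def ip_def s_def sum_divide_distrib)
          then show ?thesis using s by (simp add: norm_divide power_divide)
        qed
        have pd: "pdist en (proj en wn) (proj en u') = sqrt (1 - (cmod (ip en wn u))\<^sup>2 / s)"
          using pdist_pure[OF wn u'] ip' by (subst (asm) ip_commute) simp
        have cs: "(cmod (ip en wn u))\<^sup>2 \<le> s"
          using ip_Cauchy_Schwarz[of en wn u] wn by (simp add: is_state_iff s_def)
        have Ebu: "Eb en u = s * Ev E en u'" by (simp add: Eb_def s_def u'_def)
        show ?thesis
        proof (cases "sqrt (1 - (cmod (ip en wn u))\<^sup>2 / s) < \<delta>")
          case True
          then have "\<bar>Ev E en wn / (1 + log 2 (dimH en)) - Ev E en u' / (1 + log 2 (dimH en))\<bar> < \<epsilon>"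
            using \<delta>(2)[OF wn u'] pd by (simp add: sdist_def)
          then have "Ev E en wn - Ev E en u' < \<epsilon> * (1 + n * L)"
            unfolding diff_divide_distrib[symmetric] Ln using L0
            by (simp add: abs_less_iff divide_less_eq add_pos_nonneg)
          then have "B \<le> Ev E en u'" by (simp add: B_def Evn)
          then have "s * B \<le> Eb en u" unfolding Ebu using s by (intro mult_left_mono) auto
          moreover have "(s - (s - (cmod (ip en wn u))\<^sup>2) / \<delta>\<^sup>2) * B \<le> s * B"
            using cs B0 by (intro mult_right_mono) auto
          ultimately show ?thesis by (simp add: s_def)
        next
          case False
          then have "\<delta>\<^sup>2 \<le> (sqrt (1 - (cmod (ip en wn u))\<^sup>2 / s))\<^sup>2"
            using \<delta> by (intro power_mono) auto
          also have "\<dots> = 1 - (cmod (ip en wn u))\<^sup>2 / s" using cs s by simp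
          finally have "s * \<delta>\<^sup>2 \<le> s - (cmod (ip en wn u))\<^sup>2" using s by (simp add: field_simps)
          then have "s - (s - (cmod (ip en wn u))\<^sup>2) / \<delta>\<^sup>2 \<le> 0" using \<delta>(1) by (simp add: field_simps)
          then have "(s - (s - (cmod (ip en wn u))\<^sup>2) / \<delta>\<^sup>2) * B \<le> 0" using B0 by (simp add: mult_nonpos_nonneg)
          also have "0 \<le> Eb en u" using Eb_nonneg[OF len on] .
          finally show ?thesis by (simp add: s_def)
        qed
      qed
      have "(1 - \<epsilon>) * B \<le> (1 - (1 - (\<Sum>u\<leftarrow>us. (cmod (ip en wn u))\<^sup>2)) / \<delta>\<^sup>2) * B"
        using fid \<delta>(1) B0 by (intro mult_right_mono) (auto simp: field_simps)
      also have "\<dots> = (\<Sum>u\<leftarrow>us. (sqn en u - (sqn en u - (cmod (ip en wn u))\<^sup>2) / \<delta>\<^sup>2) * B)"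
      proof -
        have "(\<Sum>u\<leftarrow>us. (sqn en u - (sqn en u - (cmod (ip en wn u))\<^sup>2) / \<delta>\<^sup>2) * B)
          = ((\<Sum>u\<leftarrow>us. sqn en u) - ((\<Sum>u\<leftarrow>us. sqn en u) - (\<Sum>u\<leftarrow>us. (cmod (ip en wn u))\<^sup>2)) / \<delta>\<^sup>2) * B" for us
          by (induction us) (auto simp: algebra_simps diff_divide_distrib add_divide_distrib)
        then show ?thesis by (simp add: tot)
      qed
      also have "\<dots> \<le> (\<Sum>u\<leftarrow>us. Eb en u)" using each by (intro sum_list_mono) auto
      also have "\<dots> \<le> n * Ev E ds v"
        using ens_mono[OF ens] vn Eb_state[OF vn] Evn by (simp add: is_state_iff)
      finally have "(1 - \<epsilon>) * B \<le> n * Ev E ds v" .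
      moreover have "(1 - \<epsilon>) * (n * (Ev E es w - \<epsilon> * (1 + L))) \<le> (1 - \<epsilon>) * B"
        using \<epsilon> by (intro mult_left_mono[OF Bn]) auto
      ultimately have "(1 - \<epsilon>) * (n * (Ev E es w - \<epsilon> * (1 + L))) \<le> n * Ev E ds v" by linarith
      then have "real n * ((1 - \<epsilon>) * (Ev E es w - \<epsilon> * (1 + L))) \<le> real n * Ev E ds v" by (simp add: algebra_simps)
      then show ?thesis using n by (subst (asm) mult_le_cancel_left_pos) auto
    next
      case False
      \<comment> \<open>A negative lower bound is trivial, since \<open>E\<close> is
        nonnegative.\<close>
      then have "(1 - \<epsilon>) * (Ev E es w - \<epsilon> * (1 + L)) \<le> 0" using \<epsilon> by (simp add: mult_nonneg_nonpos)
      then show ?thesis using E_nonneg[OF v] by simp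
    qed
    have "((\<lambda>\<epsilon>. (1 - \<epsilon>) * (Ev E es w - \<epsilon> * (1 + L))) \<longlongrightarrow> (1 - 0) * (Ev E es w - 0 * (1 + L))) (at_right 0)"
      by (intro tendsto_intros)
    moreover have "eventually (\<lambda>\<epsilon>. (1 - \<epsilon>) * (Ev E es w - \<epsilon> * (1 + L)) \<le> Ev E ds v) (at_right 0)"
      unfolding eventually_at_right_field using key by (intro exI[where x = 1]) auto
    ultimately have "(1 - 0) * (Ev E es w - 0 * (1 + L)) \<le> Ev E ds v"
      by (rule tendsto_upperbound) simp
    then show ?thesis by simp
  qed
  then show ?thesis unfolding F_pure_def using ghz additive by blast
qed

end

section \<open>Lower bound for block-supported vectors\<close>

definition restr :: "(nat \<Rightarrow> nat \<Rightarrow> bool) \<Rightarrow> vec \<Rightarrow> vec" where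
  "restr C v = (\<lambda>x. if \<forall>i<length x. C i (x ! i) then v x else 0)"

abbreviation (input) co :: "(nat \<Rightarrow> nat \<Rightarrow> bool) \<Rightarrow> nat \<Rightarrow> nat \<Rightarrow> bool" where
  "co C \<equiv> (\<lambda>i a. \<not> C i a)"

text \<open>In every basis state of the support all parties see the same colour, so the colour is a
  shared label in coherent superposition, as in a GHZ state.\<close>

definition blocks :: "(nat \<Rightarrow> nat \<Rightarrow> bool) \<Rightarrow> vec \<Rightarrow> bool" where
  "blocks C v \<longleftrightarrow> (\<forall>x. v x \<noteq> 0 \<longrightarrow> (\<forall>i<length x. C i (x ! i)) \<or> (\<forall>i<length x. \<not> C i (x ! i)))"

lemma vec_on_restr: "vec_on ds v \<Longrightarrow> vec_on ds (restr C v)"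
  by (simp add: vec_on_def restr_def)

lemma restr_scale: "restr C (\<lambda>x. c * v x) = (\<lambda>x. c * restr C v x)"
  by (intro ext) (auto simp: restr_def)

lemma sqn_parts:
  assumes "blocks C v" "0 < length ds"
  shows "sqn ds (restr C v) + sqn ds (restr (co C) v) = sqn ds v"
  unfolding sqn_def sum.distrib[symmetric]
proof (rule sum.cong[OF refl])
  fix x assume "x \<in> idxs ds"
  then have "0 < length x" using assms by (simp add: idxs_def)
  then show "(cmod (restr C v x))\<^sup>2 + (cmod (restr (co C) v x))\<^sup>2 = (cmod (v x))\<^sup>2"
    using assms(1) by (cases "v x = 0") (auto simp: restr_def blocks_def)
qed

context ent_measure
begin

text \<open>Party 0 measures its own colour. On the support all colours agree, so this alone
  projects onto the two blocks.\<close>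

lemma Eb_parts_le:
  assumes "length ds = k" "vec_on ds v" "blocks C v"
  shows "Eb ds (restr C v) + Eb ds (restr (co C) v) \<le> Eb ds v"
proof -
  define K where "K = (\<lambda>(P :: nat \<Rightarrow> bool) (b :: nat) a. if b = a \<and> P a then 1 else 0 :: complex)"
  have K: "local_app ds 0 (ds ! 0) (K (C' 0)) v = restr C' v"
    if C': "blocks C' v" for C'
  proof
    fix y
    show "local_app ds 0 (ds ! 0) (K (C' 0)) v y = restr C' v y"
    proof (cases "y \<in> idxs ds")
      case True
      have y0: "y ! 0 < ds ! 0" "0 < length y" using True k_pos assms(1) by (auto simp: idxs_def)
      have "local_app ds 0 (ds ! 0) (K (C' 0)) v y = (\<Sum>a<ds ! 0. K (C' 0) (y ! 0) a * v (y[0 := a]))"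
        using True by (simp add: local_app_def)
      also have "\<dots> = (\<Sum>a<ds ! 0. if a = y ! 0 then (if C' 0 a then v (y[0 := a]) else 0) else 0)"
        by (intro sum.cong) (auto simp: K_def)
      also have "\<dots> = (if C' 0 (y ! 0) then v y else 0)" using y0 by simp
      also have "\<dots> = restr C' v y"
        using C' y0 by (cases "v y = 0") (auto simp: restr_def blocks_def)
      finally show ?thesis .
    qed (use assms(2) in \<open>auto simp: local_app_def restr_def vec_on_def\<close>)
  qed
  have "local_instr (ds ! 0) (ds ! 0) [K (C 0), K (co C 0)]"
    unfolding local_instr_def
  proof (intro allI impI)
    fix a b assume a: "a < ds ! 0" "b < ds ! 0"
    have "(\<Sum>c<ds ! 0. cnj (K P c a) * K P c b) = (if a = b \<and> P a then 1 else 0)" for P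
    proof -
      have "(\<Sum>c<ds ! 0. cnj (K P c a) * K P c b) = (\<Sum>c<ds ! 0. if c = a then (if a = b \<and> P a then 1 else 0) else 0)"
        by (intro sum.cong) (auto simp: K_def)
      then show ?thesis using a by simp
    qed
    then show "(\<Sum>K\<leftarrow>[K (C 0), K (co C 0)]. \<Sum>c<ds ! 0. cnj (K c a) * K c b) = (if a = b then 1 else 0)" by simp
  qed
  from Eb_local_instr[OF assms(1,2) k_pos this] show ?thesis
    using K[OF assms(3)] K[of "co C"] assms(3) by (simp add: numeral_2_eq_2 blocks_def disj_commute)
qed

text \<open>The average loss of \<open>E\<close> when the colour is measured. It is 1 for a GHZ
  state; the aim is to bound it below by the binary entropy of the weights.\<close>

definition gap :: "nat list \<Rightarrow> vec \<Rightarrow> (nat \<Rightarrow> nat \<Rightarrow> bool) \<Rightarrow> real" where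
  "gap ds v C = Eb ds v - Eb ds (restr C v) - Eb ds (restr (co C) v)"

lemma gap_scale: "gap ds (\<lambda>x. c * v x) C = (cmod c)\<^sup>2 * gap ds v C"
  by (simp add: gap_def restr_scale Eb_scale algebra_simps)

lemma is_state_ghz: "is_state k (ghz_dims k) (ghz_vec k)"
proof -
  have ne: "replicate k (0::nat) \<noteq> replicate k 1" using k_pos by (cases k) auto
  have "sqn (ghz_dims k) (ghz_vec k) = (\<Sum>x\<in>{replicate k 0, replicate k 1}. (cmod (ghz_vec k x))\<^sup>2)"
    unfolding sqn_def by (rule sum.mono_neutral_right, rule finite_idxs) (auto simp: ghz_vec_def idxs_def ghz_dims_def)
  also have "\<dots> = 1" using ne by (simp add: ghz_vec_def power_divide norm_divide)
  finally show ?thesis by (auto simp: is_state_iff vec_on_def ghz_vec_def idxs_def ghz_dims_def)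
qed

text \<open>A controlled swap turns the superposition of the two orders into a GHZ state times a product.\<close>

lemma Eb_swapped_pair:
  fixes C :: "nat \<Rightarrow> nat \<Rightarrow> bool"
  assumes len: "length ds = k" and v: "vec_on ds v"
  defines "P \<equiv> restr C v" and "N \<equiv> restr (co C) v"
  shows "Eb (tensor_dims ds ds) (\<lambda>x. tensor_vec ds P ds N x + tensor_vec ds N ds P x)
    = 2 * (sqn ds P * sqn ds N + sqn ds N * Eb ds P + sqn ds P * Eb ds N)"
proof -
  let ?D = "tensor_dims ds ds"
  let ?G = "ghz_dims k"
  \<comment> \<open>The factor sqrt 2 gives both GHZ terms amplitude 1, matching the unnormalised
    superposition \<open>?X\<close>.\<close>
  let ?g = "\<lambda>x. complex_of_real (sqrt 2) * ghz_vec k x"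
  let ?w = "tensor_vec ?G ?g ?D (tensor_vec ds P ds N)"
  let ?X = "\<lambda>x. tensor_vec ds P ds N x + tensor_vec ds N ds P x"
  \<comment> \<open>The controlled swap as a local relabelling. If the first index of the pair has
    colour \<open>C\<close>, the pair is kept and receives GHZ digit 0. Otherwise the pair is
    swapped and receives digit 1, encoded by the offset \<open>ds ! i * ds ! i\<close>.\<close>
  define f where "f = (\<lambda>i \<gamma>. if C i (\<gamma> div ds ! i) then \<gamma> else ds ! i * ds ! i + ((\<gamma> mod ds ! i) * ds ! i + \<gamma> div ds ! i))"
  have onP: "vec_on ds P" and onN: "vec_on ds N" using v by (auto simp: P_def N_def vec_on_restr)
  have lenD: "length ?D = k" and lenG: "length ?G = k" using len by (auto simp: ghz_dims_def)
  have G2: "?G ! i = 2" if "i < k" for i using that by (simp add: ghz_dims_def)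
  have Di: "?D ! i = ds ! i * ds ! i" if "i < k" for i using that len by (simp add: tensor_dims_nth)
  have ghzon: "vec_on ?G (ghz_vec k)"
    by (auto simp: vec_on_def ghz_vec_def idxs_def ghz_dims_def)
  have form: "lmap f (tpair ds a b) = tpair ?D (map (\<lambda>i. if C i (a ! i) then 0 else 1) [0..<k])
     (tpair ds (map (\<lambda>i. if C i (a ! i) then a ! i else b ! i) [0..<k]) (map (\<lambda>i. if C i (a ! i) then b ! i else a ! i) [0..<k]))"
    if "a \<in> idxs ds" "b \<in> idxs ds" for a b
    using that len by (intro nth_equalityI) (auto simp: lmap_def tpair_def f_def Di idxs_def)
  have "Eb (tensor_dims ?G ?D) ?w = Eb ?D ?X"
  proof (rule Eb_embed[where f = f])
    show "length ?D = k" "length (tensor_dims ?G ?D) = k" using lenD lenG by auto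
    show "vec_on ?D ?X" using vec_on_tensor[of ds ds] by (simp add: vec_on_def)
    show "vec_on (tensor_dims ?G ?D) ?w" by (rule vec_on_tensor)
    show "inj_on (f i) {..<?D ! i}" if i: "i < k" for i
    proof (rule inj_onI)
      fix x y assume xy: "x \<in> {..<?D ! i}" "y \<in> {..<?D ! i}" "f i x = f i y"
      then have lt: "x < ds ! i * ds ! i" "y < ds ! i * ds ! i" using Di[OF i] by auto
      have d0: "0 < ds ! i" using lt by (cases "ds ! i") auto
      have lt2: "z mod ds ! i * ds ! i + z div ds ! i < ds ! i * ds ! i" and dm: "z div ds ! i < ds ! i"
        if "z < ds ! i * ds ! i" for z
      proof -
        show 1: "z div ds ! i < ds ! i" using that by (rule less_mult_imp_div_less)
        have "z mod ds ! i * ds ! i + z div ds ! i < Suc (z mod ds ! i) * ds ! i" using 1 by simp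
        also have "\<dots> \<le> ds ! i * ds ! i" using d0 by (intro mult_right_mono) (auto simp: Suc_leI)
        finally show "z mod ds ! i * ds ! i + z div ds ! i < ds ! i * ds ! i" .
      qed
      show "x = y"
      proof (cases "C i (x div ds ! i) \<longleftrightarrow> C i (y div ds ! i)")
        case True
        show ?thesis
        proof (cases "C i (x div ds ! i)")
          case False
          then have e: "x mod ds ! i * ds ! i + x div ds ! i = y mod ds ! i * ds ! i + y div ds ! i"
            using xy(3) True by (simp add: f_def)
          then have "(x mod ds ! i * ds ! i + x div ds ! i) div ds ! i = (y mod ds ! i * ds ! i + y div ds ! i) div ds ! i"
            "(x mod ds ! i * ds ! i + x div ds ! i) mod ds ! i = (y mod ds ! i * ds ! i + y div ds ! i) mod ds ! i" by auto
          then have "x mod ds ! i = y mod ds ! i" "x div ds ! i = y div ds ! i"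
            using dm lt d0 by auto
          then show ?thesis by (metis div_mult_mod_eq)
        qed (use True xy in \<open>simp add: f_def\<close>)
      next
        case False
        then show ?thesis using xy(3) lt by (auto simp: f_def split: if_splits)
      qed
    qed
    show "f i a < tensor_dims ?G ?D ! i" if i: "i < k" and a: "a < ?D ! i" for i a
    proof -
      have lt: "a < ds ! i * ds ! i" using a Di[OF i] by simp
      then have d0: "0 < ds ! i" by (cases "ds ! i") auto
      have 1: "a div ds ! i < ds ! i" using lt by (rule less_mult_imp_div_less)
      have "a mod ds ! i * ds ! i + a div ds ! i < Suc (a mod ds ! i) * ds ! i" using 1 by simp
      also have "\<dots> \<le> ds ! i * ds ! i" using d0 by (intro mult_right_mono) (auto simp: Suc_leI)
      finally show ?thesis using lt i lenD lenG by (simp add: f_def tensor_dims_nth G2 Di len)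
    qed
    show "?w (lmap f x) = ?X x" if x: "x \<in> idxs ?D" for x
    proof -
      define a b where "a = map2 (div) x ds" and "b = map2 (mod) x ds"
      have ab: "a \<in> idxs ds" "b \<in> idxs ds" "x = tpair ds a b"
        using map2_div_in[OF refl x] map2_mod_in[OF refl x] tpair_div_mod[of x ds] idxs_length[OF x]
        by (auto simp: a_def b_def)
      let ?s = "map (\<lambda>i. if C i (a ! i) then 0 else 1 :: nat) [0..<k]"
      let ?c = "map (\<lambda>i. if C i (a ! i) then a ! i else b ! i) [0..<k]"
      let ?c' = "map (\<lambda>i. if C i (a ! i) then b ! i else a ! i) [0..<k]"
      have cin: "?c \<in> idxs ds" "?c' \<in> idxs ds" "?s \<in> idxs ?G"
        using ab len by (auto simp: idxs_def ghz_dims_def)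
      have w: "?w (lmap f x) = ?g ?s * (P ?c * N ?c')"
        unfolding ab(3) form[OF ab(1,2)] using cin lenD lenG len
        by (simp add: tensor_vec_tpair tpair_in)
      have X: "?X x = P a * N b + N a * P b"
        unfolding ab(3) using ab by (simp add: tensor_vec_tpair)
      have la: "length a = k" "length b = k" using ab len by (auto simp: idxs_def)
      \<comment> \<open>In the mixed case the parties disagree on the GHZ digit, and both sides
        vanish.\<close>
      consider (all) "\<forall>i<k. C i (a ! i)" | (none) "\<forall>i<k. \<not> C i (a ! i)" | (mixed) "\<exists>i<k. C i (a ! i)" "\<exists>i<k. \<not> C i (a ! i)"
        by blast
      then show ?thesis
      proof cases
        case all
        have "?s = replicate k 0" "?c = a" "?c' = b" using all la by (auto intro!: nth_equalityI)
        moreover have "N a = 0" using all la k_pos by (auto simp: N_def restr_def)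
        ultimately show ?thesis unfolding w X by (simp add: ghz_vec_def)
      next
        case none
        have "?s = replicate k 1" "?c = b" "?c' = a" using none la by (auto intro!: nth_equalityI)
        moreover have "P a = 0" using none la k_pos by (auto simp: P_def restr_def)
        ultimately show ?thesis unfolding w X by (simp add: ghz_vec_def)
      next
        case mixed
        then obtain i j where ij: "i < k" "C i (a ! i)" "j < k" "\<not> C j (a ! j)" by blast
        have "?s \<noteq> replicate k 0" "?s \<noteq> replicate k 1"
          using ij by (auto simp: list_eq_iff_nth_eq)
        then have "?g ?s = 0" unfolding ghz_vec_def by simp
        moreover have "P a = 0" "N a = 0" using ij la by (auto simp: P_def N_def restr_def)
        ultimately show ?thesis unfolding w X by simp
      qed
    qed
    show "?w y = 0" if y: "y \<in> idxs (tensor_dims ?G ?D)" and nim: "y \<notin> lmap f ` idxs ?D" for y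
    proof (rule ccontr)
      assume wy: "?w y \<noteq> 0"
      define s z where "s = map2 (div) y ?D" and "z = map2 (mod) y ?D"
      have lGD: "length ?G = length ?D" using lenD lenG by simp
      have sz: "s \<in> idxs ?G" "z \<in> idxs ?D" "y = tpair ?D s z"
        using map2_div_in[OF lGD y] map2_mod_in[OF lGD y] tpair_div_mod[of y ?D] idxs_length[OF y] lenD lenG
        by (auto simp: s_def z_def)
      define c c' where "c = map2 (div) z ds" and "c' = map2 (mod) z ds"
      have cc: "c \<in> idxs ds" "c' \<in> idxs ds" "z = tpair ds c c'"
        using map2_div_in[OF refl sz(2)] map2_mod_in[OF refl sz(2)] tpair_div_mod[of z ds] idxs_length[OF sz(2)]
        by (auto simp: c_def c'_def)
      have "?w y = ?g s * (P c * N c')"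
        unfolding sz(3) using sz cc lGD by (simp add: tensor_vec_tpair tpair_in)
      then have nz: "ghz_vec k s \<noteq> 0" "P c \<noteq> 0" "N c' \<noteq> 0" using wy by auto
      have lc: "length c = k" "length c' = k" using cc len by (auto simp: idxs_def)
      have Cc: "\<forall>i<k. C i (c ! i)" "\<forall>i<k. \<not> C i (c' ! i)"
        using nz lc by (auto simp: P_def N_def restr_def split: if_splits)
      from nz(1) have "s = replicate k 0 \<or> s = replicate k 1" by (auto simp: ghz_vec_def split: if_splits)
      then show False
      proof
        assume s: "s = replicate k 0"
        have "lmap f (tpair ds c c') = tpair ?D s (tpair ds c c')"
          unfolding form[OF cc(1,2)] using Cc lc s
          by (intro arg_cong2[where f = "tpair ?D"] arg_cong2[where f = "tpair ds"]) (auto intro!: nth_equalityI)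
        then show False using nim tpair_in[OF refl cc(1,2)] sz(3) cc(3) by (metis imageI)
      next
        assume s: "s = replicate k 1"
        have "lmap f (tpair ds c' c) = tpair ?D s (tpair ds c c')"
          unfolding form[OF cc(2,1)] using Cc lc s
          by (intro arg_cong2[where f = "tpair ?D"] arg_cong2[where f = "tpair ds"]) (auto intro!: nth_equalityI)
        then show False using nim tpair_in[OF refl cc(2,1)] sz(3) cc(3) by (metis imageI)
      qed
    qed
  qed
  moreover have "Eb (tensor_dims ?G ?D) ?w = sqn ?D (tensor_vec ds P ds N) * Eb ?G ?g + sqn ?G ?g * Eb ?D (tensor_vec ds P ds N)"
  proof -
    have "vec_on ?G ?g" using ghzon by (simp add: vec_on_def)
    then show ?thesis using lenD lenG vec_on_tensor by (intro Eb_tensor)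
  qed
  moreover have "Eb ?G ?g = 2" "sqn ?G ?g = 2"
    unfolding Eb_scale sqn_scale using Eb_state[OF is_state_ghz] ghz is_state_ghz by (auto simp: is_state_iff)
  moreover have "Eb ?D (tensor_vec ds P ds N) = sqn ds N * Eb ds P + sqn ds P * Eb ds N"
    using len onP onN by (intro Eb_tensor)
  ultimately show ?thesis by (simp add: sqn_tensor algebra_simps)
qed

text \<open>The recursion of Peres' iterated extractor: two copies are split according to the parity of
  the block labels, and the even restr once more.\<close>

lemma gap_recursion:
  assumes v: "is_state k ds v" and bl: "blocks C v"
  defines "p \<equiv> sqn ds (restr C v)"
  assumes p: "0 < p" "p < 1"
  obtains ds1 v1 C1 ds2 v2 C2 where
    "is_state k ds1 v1" "blocks C1 v1" "is_state k ds2 v2" "blocks C2 v2"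
    "2 * (h p - gap ds v C) = h (sqn ds1 (restr C1 v1)) - gap ds1 v1 C1
       + (p\<^sup>2 + (1 - p)\<^sup>2) * (h (sqn ds2 (restr C2 v2)) - gap ds2 v2 C2)"
proof -
  define P where "P = restr C v"
  define N where "N = restr (co C) v"
  define D where "D = tensor_dims ds ds"
  define V where "V = tensor_vec ds v ds v"
  define Y where "Y = (\<lambda>x. tensor_vec ds P ds P x + tensor_vec ds N ds N x)"
  define X where "X = (\<lambda>x. tensor_vec ds P ds N x + tensor_vec ds N ds P x)"
  \<comment> \<open>\<open>C2\<close> marks pairs of different colours and so splits the two copies
    by parity. \<open>C1\<close> reads the first colour, which on the even part \<open>Y\<close> is
    also the second.\<close>
  define C2 where "C2 = (\<lambda>i \<gamma>. C i (\<gamma> div ds ! i) \<noteq> C i (\<gamma> mod ds ! i))"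
  define C1 where "C1 = (\<lambda>i \<gamma>. C i (\<gamma> div ds ! i))"
  define s where "s = p\<^sup>2 + (1 - p)\<^sup>2"
  have len: "length ds = k" and von: "vec_on ds v" and n1: "sqn ds v = 1" using v by (auto simp: is_state_iff)
  have lenD: "length D = k" using len by (simp add: D_def)
  have q: "sqn ds N = 1 - p" using sqn_parts[OF bl, of ds] n1 len k_pos by (simp add: p_def N_def)
  have Pp: "sqn ds P = p" by (simp add: P_def p_def)
  have onP: "vec_on ds P" and onN: "vec_on ds N" using von by (auto simp: P_def N_def vec_on_restr)
  have s0: "0 < s" using p by (simp add: s_def sum_power2_gt_zero_iff)
  have decomp: "\<exists>a b. a \<in> idxs ds \<and> b \<in> idxs ds \<and> x = tpair ds a b" if "x \<in> idxs D" for x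
    using map2_div_in[OF refl, of x ds] map2_mod_in[OF refl, of x ds] tpair_div_mod[of x ds] idxs_length[of x] that lenD len
    unfolding D_def by metis
  have dm: "tpair ds a b ! i div ds ! i = a ! i" "tpair ds a b ! i mod ds ! i = b ! i"
    if "a \<in> idxs ds" "b \<in> idxs ds" "i < k" for a b i
    using that len by (auto simp: tpair_def idxs_def)
  have PN: "(v a = 0 \<and> P a = 0 \<and> N a = 0) \<or> ((\<forall>i<k. C i (a ! i)) \<and> P a = v a \<and> N a = 0)
     \<or> ((\<forall>i<k. \<not> C i (a ! i)) \<and> P a = 0 \<and> N a = v a)" if a: "a \<in> idxs ds" for a
  proof -
    have "length a = k" using a len by (simp add: idxs_def)
    then show ?thesis using bl k_pos by (auto simp: blocks_def P_def N_def restr_def)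
  qed
  have outside: "x \<notin> idxs D \<Longrightarrow> tensor_vec ds u ds u' x = 0" for x u u' by (simp add: D_def tensor_vec_def)
  have lx: "length (tpair ds a b) = k" for a b using len by (simp add: tpair_def)
  have partV: "restr C2 V = X" "restr (co C2) V = Y" "blocks C2 V"
    "restr C1 Y = tensor_vec ds P ds P" "restr (co C1) Y = tensor_vec ds N ds N" "blocks C1 Y"
  proof -
    have A: "restr C2 V x = X x \<and> restr (co C2) V x = Y x \<and> (V x \<noteq> 0 \<longrightarrow> (\<forall>i<length x. C2 i (x ! i)) \<or> (\<forall>i<length x. \<not> C2 i (x ! i)))
       \<and> restr C1 Y x = tensor_vec ds P ds P x \<and> restr (co C1) Y x = tensor_vec ds N ds N x
       \<and> (Y x \<noteq> 0 \<longrightarrow> (\<forall>i<length x. C1 i (x ! i)) \<or> (\<forall>i<length x. \<not> C1 i (x ! i)))" for x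
    proof (cases "x \<in> idxs D")
      case True
      then obtain a b where ab: "a \<in> idxs ds" "b \<in> idxs ds" "x = tpair ds a b" using decomp by blast
      have t: "tensor_vec ds u ds u' x = u a * u' b" for u u' using ab by (simp add: tensor_vec_tpair)
      have c1: "C1 i (x ! i) = C i (a ! i)" and c2: "C2 i (x ! i) = (C i (a ! i) \<noteq> C i (b ! i))" if "i < k" for i
        using that ab dm[OF ab(1,2) that] by (auto simp: C1_def C2_def)
      have l: "length x = k" using ab lx by simp
      have yes: "restr C' u x = u x" if "\<forall>i<k. C' i (x ! i)" for C' u using that by (simp add: restr_def l)
      have no: "restr C' u x = 0" if "\<forall>i<k. \<not> C' i (x ! i)" for C' u using that k_pos by (auto simp: restr_def l)
      define Z where "Z = (\<lambda>a. v a = 0 \<and> P a = 0 \<and> N a = 0)"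
      define IP where "IP = (\<lambda>a. (\<forall>i<k. C i (a ! i)) \<and> P a = v a \<and> N a = 0)"
      define IN where "IN = (\<lambda>a. (\<forall>i<k. \<not> C i (a ! i)) \<and> P a = 0 \<and> N a = v a)"
      have "Z a \<or> IP a \<or> IN a" "Z b \<or> IP b \<or> IN b"
        using PN[OF ab(1)] PN[OF ab(2)] by (simp_all only: Z_def IP_def IN_def)
      then consider (zero) "Z a \<or> Z b" | (PP) "IP a" "IP b" | (PQ) "IP a" "IN b" | (QP) "IN a" "IP b" | (QQ) "IN a" "IN b"
        by blast
      then show ?thesis
      proof cases
        case zero
        then have "V x = 0" "X x = 0" "Y x = 0" "P a * P b = 0" "N a * N b = 0" by (auto simp: Z_def X_def Y_def V_def t)
        then show ?thesis by (simp add: restr_def t)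
      next
        case PP
        have "\<forall>i<k. C1 i (x ! i)" "\<forall>i<k. \<not> C2 i (x ! i)" using PP c1 c2 by (simp_all add: IP_def IN_def)
        then show ?thesis using yes[of C1 Y] no[of "co C1" Y] no[of C2 V] yes[of "co C2" V] PP l
          by (simp add: IP_def IN_def X_def Y_def V_def t)
      next
        case PQ
        have "\<forall>i<k. C1 i (x ! i)" "\<forall>i<k. C2 i (x ! i)" using PQ c1 c2 by (simp_all add: IP_def IN_def)
        then show ?thesis using yes[of C1 Y] no[of "co C1" Y] yes[of C2 V] no[of "co C2" V] PQ l
          by (simp add: IP_def IN_def X_def Y_def V_def t)
      next
        case QP
        have "\<forall>i<k. \<not> C1 i (x ! i)" "\<forall>i<k. C2 i (x ! i)" using QP c1 c2 by (simp_all add: IP_def IN_def)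
        then show ?thesis using no[of C1 Y] yes[of "co C1" Y] yes[of C2 V] no[of "co C2" V] QP l
          by (simp add: IP_def IN_def X_def Y_def V_def t)
      next
        case QQ
        have "\<forall>i<k. \<not> C1 i (x ! i)" "\<forall>i<k. \<not> C2 i (x ! i)" using QQ c1 c2 by (simp_all add: IP_def IN_def)
        then show ?thesis using no[of C1 Y] yes[of "co C1" Y] no[of C2 V] yes[of "co C2" V] QQ l
          by (simp add: IP_def IN_def X_def Y_def V_def t)
      qed
    qed (auto simp: restr_def X_def Y_def V_def outside)
    then show "restr C2 V = X" "restr (co C2) V = Y" "blocks C2 V"
      "restr C1 Y = tensor_vec ds P ds P" "restr (co C1) Y = tensor_vec ds N ds N" "blocks C1 Y"
      unfolding blocks_def by blast+
  qed
  have V: "is_state k D V" unfolding D_def V_def using v v by (rule is_state_tensor)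
  have sqPP: "sqn D (tensor_vec ds P ds P) = p\<^sup>2" "sqn D (tensor_vec ds N ds N) = (1 - p)\<^sup>2"
    unfolding D_def using len by (simp_all add: sqn_tensor Pp q power2_eq_square)
  have sqY: "sqn D Y = s"
    using sqn_parts[OF partV(6), of D] lenD k_pos sqPP by (simp add: partV s_def)
  have sqX: "sqn D X = 2 * p * (1 - p)"
  proof -
    have "sqn D X + s = 1" using sqn_parts[OF partV(3), of D] lenD k_pos V sqY by (simp add: partV is_state_iff)
    then show ?thesis by (simp add: s_def power2_eq_square algebra_simps)
  qed
  have Yon: "vec_on D Y" by (simp add: vec_on_def Y_def outside)
  define y where "y = normalized D Y"
  have yst: "is_state k D y" unfolding y_def using lenD Yon sqY s0 by (intro is_state_normalized) auto
  have yr: "y = (\<lambda>x. complex_of_real (1 / sqrt s) * Y x)" by (simp add: y_def normalized_def sqY)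
  have r2: "(cmod (complex_of_real (1 / sqrt s)))\<^sup>2 = 1 / s" using s0 by (simp add: norm_divide power_divide)
  have ybl: "blocks C1 y" using partV(6) s0 by (simp add: blocks_def yr)
  have p2: "sqn D (restr C1 y) = p\<^sup>2 / s" unfolding yr restr_scale sqn_scale partV(4) r2 sqPP by simp
  have g2: "s * gap D y C1 = gap D Y C1" unfolding yr gap_scale r2 using s0 by simp
  have EV: "Eb D V = 2 * Eb ds v" unfolding D_def V_def using len von n1 by (subst Eb_tensor) auto
  have EX: "Eb D X = 2 * (p * (1 - p) + (1 - p) * Eb ds P + p * Eb ds N)"
    unfolding D_def X_def P_def N_def
    using Eb_swapped_pair[OF len von, of C] Pp q by (simp add: P_def N_def)
  have EPP: "Eb D (tensor_vec ds P ds P) = 2 * p * Eb ds P" "Eb D (tensor_vec ds N ds N) = 2 * (1 - p) * Eb ds N"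
    unfolding D_def using len onP onN by (simp_all add: Eb_tensor Pp q)
  \<comment> \<open>The entropies combine by the chain rule for two copies. In the sum of the two
    gaps the term of \<open>Y\<close> cancels, and the GHZ content 2p(1-p) of \<open>X\<close>
    cancels against the same term of the chain rule.\<close>
  have "h (sqn D (restr C2 V)) - gap D V C2 + (p\<^sup>2 + (1 - p)\<^sup>2) * (h (sqn D (restr C1 y)) - gap D y C1)
     = h (2 * p * (1 - p)) + s * h (p\<^sup>2 / s) - gap D V C2 - s * gap D y C1"
    unfolding p2 by (simp add: partV sqX s_def algebra_simps)
  also have "\<dots> = 2 * h p - 2 * p * (1 - p) - gap D V C2 - gap D Y C1"
    unfolding g2 using h_two_copies[OF p] by (simp add: s_def)
  also have "\<dots> = 2 * (h p - gap ds v C)"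
    unfolding gap_def partV EV EX EPP P_def[symmetric] N_def[symmetric] by (simp add: algebra_simps)
  finally show ?thesis using that[OF V partV(3) yst ybl] by metis
qed

text \<open>Let M be the supremum of the defects \<open>h p - gap\<close>, assumed positive. The
  recursion bounds a defect at p by M (1+s)/2 = M (1 - p(1-p)), which is uniformly below M away from
  0 and 1. Near 0 and 1 the entropy itself is small and the gap is nonnegative. So M would be
  smaller than itself.\<close>

lemma gap_ge_h:
  assumes "is_state k ds v" "blocks C v"
  shows "h (sqn ds (restr C v)) \<le> gap ds v C"
proof (rule ccontr)
  assume neg: "\<not> ?thesis"
  \<comment> \<open>The supremum ranges over all spaces, states and colourings, because the
    recursion leaves the given ones.\<close>
  define S where "S = {h (sqn ds (restr C v)) - gap ds v C | ds v C. is_state k ds v \<and> blocks C v}"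
  have gap0: "0 \<le> gap ds v C" if "is_state k ds v" "blocks C v" for ds v C
    using Eb_parts_le[of ds v C] that by (simp add: gap_def is_state_iff)
  have p01: "0 \<le> sqn ds (restr C v)" "sqn ds (restr C v) \<le> 1" if "is_state k ds v" "blocks C v" for ds v C
    using sqn_parts[OF that(2), of ds] that(1) k_pos sqn_nonneg[of ds "restr C v"] sqn_nonneg[of ds "restr (co C) v"]
    by (auto simp: is_state_iff)
  have bdd: "bdd_above S"
  proof (rule bdd_aboveI)
    fix x assume "x \<in> S"
    then obtain ds v C where "x = h (sqn ds (restr C v)) - gap ds v C" "is_state k ds v" "blocks C v"
      unfolding S_def by blast
    then show "x \<le> 1 / ln 2" using gap0[of ds v C] h_le[OF p01, of ds v C] by simp
  qed
  define M where "M = Sup S"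
  have inS: "h (sqn ds (restr C v)) - gap ds v C \<in> S" if "is_state k ds v" "blocks C v" for ds v C
    unfolding S_def using that by blast
  have le_M: "h (sqn ds (restr C v)) - gap ds v C \<le> M" if "is_state k ds v" "blocks C v" for ds v C
    unfolding M_def by (rule cSup_upper[OF inS[OF that] bdd])
  have M0: "0 < M" using le_M[OF assms] neg by simp
  have "eventually (\<lambda>p. h p < M / 2) (at_right 0)"
    using order_tendstoD(2)[OF tendsto_h_at_right_0, of "M / 2"] M0 by simp
  then obtain e where e: "e > 0" "\<And>p. 0 < p \<Longrightarrow> p < e \<Longrightarrow> h p < M / 2"
    unfolding eventually_at_right_field by blast
  \<comment> \<open>Closer than \<open>p0\<close> to an end point the entropy is below M/2. On the
    remaining interval p(1-p) is smallest at the cut.\<close>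
  define p0 where "p0 = min e (1 / 2)"
  have p0: "0 < p0" "p0 \<le> 1 / 2" "p0 \<le> e" using e by (auto simp: p0_def)
  \<comment> \<open>The first entry bounds the defects near the end points, the second is the
    contraction at its weakest.\<close>
  define B where "B = max (M / 2) (M * (1 - p0 * (1 - p0)))"
  have "M \<le> B"
    unfolding M_def
  proof (rule cSup_least)
    show "S \<noteq> {}" using inS[OF assms] by blast
    fix x assume "x \<in> S"
    then obtain ds v C where x: "x = h (sqn ds (restr C v)) - gap ds v C" and st: "is_state k ds v" "blocks C v"
      unfolding S_def by blast
    define p where "p = sqn ds (restr C v)"
    have p: "0 \<le> p" "p \<le> 1" using p01[OF st] by (auto simp: p_def)
    show "x \<le> B"
    proof (cases "p < p0 \<or> 1 - p < p0")
      case True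
      have "h p \<le> M / 2"
      proof (cases "p = 0 \<or> p = 1")
        case True then show ?thesis using M0 by auto
      next
        case False
        then show ?thesis using True e(2)[of p] e(2)[of "1 - p"] h_symmetric[of p] p p0 by fastforce
      qed
      then show ?thesis using gap0[OF st] by (simp add: x p_def B_def)
    next
      case False
      then have pp: "0 < p" "p < 1" using p p0 by auto
      obtain ds1 v1 C1 ds2 v2 C2 where r: "is_state k ds1 v1" "blocks C1 v1" "is_state k ds2 v2" "blocks C2 v2"
        "2 * (h p - gap ds v C) = h (sqn ds1 (restr C1 v1)) - gap ds1 v1 C1
          + (p\<^sup>2 + (1 - p)\<^sup>2) * (h (sqn ds2 (restr C2 v2)) - gap ds2 v2 C2)"
        using gap_recursion[OF st] pp unfolding p_def by metis
      have "2 * x \<le> M + (p\<^sup>2 + (1 - p)\<^sup>2) * M"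
        unfolding x p_def[symmetric] r(5) using le_M[OF r(1,2)] le_M[OF r(3,4)]
        by (intro add_mono mult_left_mono) auto
      then have "x \<le> M * (1 - p * (1 - p))" by (simp add: power2_eq_square algebra_simps)
      also have "\<dots> \<le> M * (1 - p0 * (1 - p0))"
      proof -
        have "0 \<le> (p - p0) * (1 - p - p0)" using False p0 by (intro mult_nonneg_nonneg) auto
        then have "p0 * (1 - p0) \<le> p * (1 - p)" by (simp add: algebra_simps)
        then show ?thesis using M0 by (intro mult_left_mono) auto
      qed
      finally show ?thesis by (simp add: B_def)
    qed
  qed
  moreover have "B < M"
  proof -
    have "0 < p0 * (1 - p0)" using p0 by simp
    then have "M * (1 - p0 * (1 - p0)) < M * 1" using M0 by (intro mult_strict_left_mono) auto
    then show ?thesis using M0 by (simp add: B_def)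
  qed
  ultimately show False by simp
qed

definition dsum_colour :: "nat list \<Rightarrow> nat \<Rightarrow> nat \<Rightarrow> bool" where
  "dsum_colour ds = (\<lambda>i a. a < ds ! i)"

text \<open>Both summands embed locally into the direct sum, by inclusion and by shift, so the
  \<open>Eb\<close> of each block is that of the scaled summand. Mixed indices carry no amplitude,
  hence the colouring is one by \<open>blocks\<close>.\<close>

lemma dsum_parts:
  fixes p :: real
  assumes v: "is_state k ds v" and w: "is_state k es w" and p: "0 \<le> p" "p \<le> 1"
  defines "D \<equiv> dsum_dims ds es"
    and "\<Omega> \<equiv> dsum_vec (complex_of_real (sqrt p)) ds v (complex_of_real (sqrt (1 - p))) es w"
  shows "blocks (dsum_colour ds) \<Omega>"
    "Eb D (restr (dsum_colour ds) \<Omega>) = p * Ev E ds v"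
    "Eb D (restr (co (dsum_colour ds)) \<Omega>) = (1 - p) * Ev E es w"
    "sqn D (restr (dsum_colour ds) \<Omega>) = p"
proof -
  let ?C = "dsum_colour ds"
  have len: "length ds = k" "length es = k" and on: "vec_on ds v" "vec_on es w" and n1: "sqn ds v = 1" "sqn es w = 1"
    using v w by (auto simp: is_state_iff)
  have le: "length ds = length es" and ne: "0 < length es" using len k_pos by auto
  have lenD: "length D = k" by (simp add: D_def len)
  have \<Omega>on: "vec_on D \<Omega>" by (simp add: D_def \<Omega>_def vec_on_dsum)
  have L: "restr ?C \<Omega> x = complex_of_real (sqrt p) * v x" "restr (co ?C) \<Omega> x = 0" if "x \<in> idxs ds" for x
    using that len k_pos dsum_vec_left[OF le ne that] by (auto simp: restr_def dsum_colour_def idxs_def \<Omega>_def)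
  have R: "restr ?C \<Omega> (shift ds y) = 0" "restr (co ?C) \<Omega> (shift ds y) = complex_of_real (sqrt (1 - p)) * w y" if "y \<in> idxs es" for y
    using that len k_pos dsum_vec_right[OF le ne that] by (auto simp: restr_def dsum_colour_def idxs_def shift_nth \<Omega>_def)
  have O: "\<Omega> x = 0" if "x \<notin> idxs ds" "x \<notin> shift ds ` idxs es" for x
    using dsum_vec_other[OF le ne _ that] \<Omega>on unfolding \<Omega>_def D_def vec_on_def by blast
  show bl: "blocks ?C \<Omega>"
    unfolding blocks_def
  proof (intro allI impI)
    fix x assume "\<Omega> x \<noteq> 0"
    then consider "x \<in> idxs ds" | y where "y \<in> idxs es" "x = shift ds y" using O by blast
    then show "(\<forall>i<length x. ?C i (x ! i)) \<or> (\<forall>i<length x. \<not> ?C i (x ! i))"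
      by cases (use len in \<open>auto simp: dsum_colour_def idxs_def shift_nth\<close>)
  qed
  have lm: "lmap (\<lambda>i a. ds ! i + a) y = shift ds y" if "y \<in> idxs es" for y
    using that len by (intro nth_equalityI) (auto simp: idxs_def shift_nth)
  have lm0: "lmap (\<lambda>i a. a) x = x" for x by (simp add: lmap_def map_nth)
  have "Eb D (restr ?C \<Omega>) = Eb ds (\<lambda>x. complex_of_real (sqrt p) * v x)"
  proof (rule Eb_embed[where f = "\<lambda>i a. a"])
    show "restr ?C \<Omega> y = 0" if "y \<in> idxs D" "y \<notin> lmap (\<lambda>i a. a) ` idxs ds" for y
    proof (cases "y \<in> shift ds ` idxs es")
      case True then show ?thesis using R by auto
    next
      case False then show ?thesis using O[of y] that by (simp add: lm0 restr_def)
    qed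
    show "length ds = k" "length D = k" using len lenD by auto
    show "vec_on ds (\<lambda>x. complex_of_real (sqrt p) * v x)" using on by (simp add: vec_on_def)
    show "vec_on D (restr ?C \<Omega>)" by (rule vec_on_restr[OF \<Omega>on])
    show "a < D ! i" if "i < k" "a < ds ! i" for i a using that len by (simp add: D_def dsum_dims_nth)
    show "restr ?C \<Omega> (lmap (\<lambda>i a. a) x) = complex_of_real (sqrt p) * v x" if "x \<in> idxs ds" for x
      unfolding lm0 by (rule L(1)[OF that])
  qed simp
  then show "Eb D (restr ?C \<Omega>) = p * Ev E ds v" using p by (simp add: Eb_scale Eb_state[OF v])
  have "Eb D (restr (co ?C) \<Omega>) = Eb es (\<lambda>x. complex_of_real (sqrt (1 - p)) * w x)"
  proof (rule Eb_embed[where f = "\<lambda>i a. ds ! i + a"])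
    show "restr (co ?C) \<Omega> y = 0" if "y \<in> idxs D" "y \<notin> lmap (\<lambda>i a. ds ! i + a) ` idxs es" for y
    proof (cases "y \<in> idxs ds")
      case True then show ?thesis using L by auto
    next
      case False
      have "y \<notin> shift ds ` idxs es" using that lm by force
      then show ?thesis using O[of y] False by (simp add: restr_def)
    qed
    show "length es = k" "length D = k" using len lenD by auto
    show "vec_on es (\<lambda>x. complex_of_real (sqrt (1 - p)) * w x)" using on by (simp add: vec_on_def)
    show "vec_on D (restr (co ?C) \<Omega>)" by (rule vec_on_restr[OF \<Omega>on])
    show "ds ! i + a < D ! i" if "i < k" "a < es ! i" for i a using that len by (simp add: D_def dsum_dims_nth)
    show "restr (co ?C) \<Omega> (lmap (\<lambda>i a. ds ! i + a) x) = complex_of_real (sqrt (1 - p)) * w x" if "x \<in> idxs es" for x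
      unfolding lm[OF that] by (rule R(2)[OF that])
  qed simp
  then show "Eb D (restr (co ?C) \<Omega>) = (1 - p) * Ev E es w" using p by (simp add: Eb_scale Eb_state[OF w])
  have "sqn D (restr ?C \<Omega>) = (\<Sum>x\<in>idxs ds. (cmod (complex_of_real (sqrt p) * v x))\<^sup>2)"
  proof -
    have "sqn D (restr ?C \<Omega>) = (\<Sum>x\<in>idxs ds. (cmod (restr ?C \<Omega> x))\<^sup>2)"
      unfolding sqn_def
    proof (rule sum.mono_neutral_right)
      show "idxs ds \<subseteq> idxs D" using idxs_dsum_left[OF le ne] by (auto simp: D_def)
      show "\<forall>x\<in>idxs D - idxs ds. (cmod (restr ?C \<Omega> x))\<^sup>2 = 0"
      proof
        fix x assume x: "x \<in> idxs D - idxs ds"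
        show "(cmod (restr ?C \<Omega> x))\<^sup>2 = 0"
        proof (cases "x \<in> shift ds ` idxs es")
          case True
          then show ?thesis using R(1) by auto
        next
          case False
          then show ?thesis using O[of x] x by (simp add: restr_def)
        qed
      qed
    qed simp
    then show ?thesis by (simp add: L)
  qed
  also have "\<dots> = p" using sqn_scale[of ds "complex_of_real (sqrt p)" v] n1 p by (simp add: sqn_def)
  finally show "sqn D (restr ?C \<Omega>) = p" .
qed

lemma dsum_lower:
  assumes "is_state k ds v" "is_state k es w" "0 \<le> p" "p \<le> 1"
  shows "p * Ev E ds v + (1 - p) * Ev E es w + h p \<le> Ev E (dsum_dims ds es)
        (dsum_vec (complex_of_real (sqrt p)) ds v (complex_of_real (sqrt (1 - p))) es w)"
proof -
  have st: "is_state k (dsum_dims ds es) (dsum_vec (complex_of_real (sqrt p)) ds v (complex_of_real (sqrt (1 - p))) es w)"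
    using assms k_pos by (intro is_state_dsum) auto
  from gap_ge_h[OF st dsum_parts(1)[OF assms]] show ?thesis
    using dsum_parts[OF assms] Eb_state[OF st] by (simp add: gap_def)
qed

end

section \<open>Labelling local basis states\<close>

definition fam :: "nat \<Rightarrow> (nat \<Rightarrow> nat \<Rightarrow> 'a) \<Rightarrow> nat list \<Rightarrow> nat \<Rightarrow> 'a" where
  "fam k dec x = (\<lambda>i\<in>{..<k}. dec i (x ! i))"

text \<open>Iterated tensor products number their basis states by nested quotients and remainders.
  Here party \<open>i\<close> labels its basis by an arbitrary set \<open>A i\<close>, and the
  vector becomes an amplitude on families of labels. \<open>fam\<close> is restricted to the parties
  so that these families form a \<open>PiE\<close>.\<close>

definition rep_by :: "nat \<Rightarrow> nat list \<Rightarrow> vec \<Rightarrow> (nat \<Rightarrow> 'a set) \<Rightarrow> (nat \<Rightarrow> nat \<Rightarrow> 'a) \<Rightarrow> ((nat \<Rightarrow> 'a) \<Rightarrow> complex) \<Rightarrow> bool" where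
  "rep_by k ds v A dec amp \<longleftrightarrow> length ds = k \<and> (\<forall>i<k. bij_betw (dec i) {..<ds ! i} (A i))
     \<and> (\<forall>x\<in>idxs ds. v x = amp (fam k dec x))"

definition rep :: "nat \<Rightarrow> nat list \<Rightarrow> vec \<Rightarrow> (nat \<Rightarrow> 'a set) \<Rightarrow> ((nat \<Rightarrow> 'a) \<Rightarrow> complex) \<Rightarrow> bool" where
  "rep k ds v A amp \<longleftrightarrow> (\<exists>dec. rep_by k ds v A dec amp)"

lemma fam_in_PiE:
  "rep_by k ds v A dec amp \<Longrightarrow> x \<in> idxs ds \<Longrightarrow> fam k dec x \<in> PiE {..<k} A"
  by (auto simp: rep_by_def fam_def idxs_def bij_betw_def)

lemma rep_by_sum:
  assumes "rep_by k ds v A dec amp"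
  shows "(\<Sum>x\<in>idxs ds. F (fam k dec x)) = sum F (PiE {..<k} A)"
proof -
  have len: "length ds = k" and bij: "\<And>i. i < k \<Longrightarrow> bij_betw (dec i) {..<ds ! i} (A i)"
    using assms by (auto simp: rep_by_def)
  define enc where "enc = (\<lambda>f. map (\<lambda>i. inv_into {..<ds ! i} (dec i) (f i)) [0..<k])"
  have l: "inv_into {..<ds ! i} (dec i) (dec i a) = a" if "i < k" "a < ds ! i" for i a
    using that bij[of i] by (simp add: bij_betw_def)
  have r: "dec i (inv_into {..<ds ! i} (dec i) b) = b" "inv_into {..<ds ! i} (dec i) b < ds ! i"
    if "i < k" "b \<in> A i" for i b
    using that bij[of i] f_inv_into_f[of b "dec i" "{..<ds ! i}"] inv_into_into[of b "dec i" "{..<ds ! i}"]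
    by (auto simp: bij_betw_def)
  show ?thesis
  proof (rule sum.reindex_bij_witness[where i = enc and j = "fam k dec"])
    fix x assume x: "x \<in> idxs ds"
    show "enc (fam k dec x) = x"
      using x len l by (intro nth_equalityI) (auto simp: enc_def fam_def idxs_def)
    show "fam k dec x \<in> PiE {..<k} A" using fam_in_PiE[OF assms x] .
  next
    fix f assume f: "f \<in> PiE {..<k} A"
    show "fam k dec (enc f) = f"
      using f r by (intro ext) (auto simp: enc_def fam_def PiE_iff extensional_def)
    show "enc f \<in> idxs ds" using f r len by (auto simp: enc_def idxs_def PiE_iff)
  qed simp
qed

lemma rep_base:
  "length ds = k \<Longrightarrow> rep k ds v (\<lambda>i. {..<ds ! i}) (\<lambda>f. v (map f [0..<k]))"
  unfolding rep_def rep_by_def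
proof (intro exI[where x = "\<lambda>i a. a"] conjI ballI)
  fix x assume "length ds = k" "x \<in> idxs ds"
  then have "map (fam k (\<lambda>i a. a) x) [0..<k] = x" by (intro nth_equalityI) (auto simp: fam_def idxs_def)
  then show "v x = v (map (fam k (\<lambda>i a. a) x) [0..<k])" by simp
qed (auto simp: bij_betw_def)

lemma rep_map:
  assumes "rep k ds v A amp" "\<And>i. i < k \<Longrightarrow> bij_betw (\<beta> i) (A i) (B i)"
    and "\<And>f. f \<in> PiE {..<k} A \<Longrightarrow> amp f = amp' (\<lambda>i\<in>{..<k}. \<beta> i (f i))"
  shows "rep k ds v B amp'"
proof -
  obtain dec where d: "rep_by k ds v A dec amp" using assms(1) by (auto simp: rep_def)
  have "rep_by k ds v B (\<lambda>i a. \<beta> i (dec i a)) amp'"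
    unfolding rep_by_def
  proof (intro conjI allI impI ballI)
    show "length ds = k" using d by (simp add: rep_by_def)
    show "bij_betw (\<lambda>a. \<beta> i (dec i a)) {..<ds ! i} (B i)" if "i < k" for i
      using bij_betw_trans[of "dec i" "{..<ds ! i}" "A i" "\<beta> i" "B i"] d assms(2) that
      by (simp add: rep_by_def o_def)
    fix x assume x: "x \<in> idxs ds"
    have "(\<lambda>i\<in>{..<k}. \<beta> i (fam k dec x i)) = fam k (\<lambda>i a. \<beta> i (dec i a)) x"
      by (intro ext) (simp add: fam_def)
    then show "v x = amp' (fam k (\<lambda>i a. \<beta> i (dec i a)) x)"
      using d x assms(3)[OF fam_in_PiE[OF d x]] by (simp add: rep_by_def)
  qed
  then show ?thesis by (auto simp: rep_def)
qed

lemma bij_div_mod: "bij_betw (\<lambda>c. (c div e, c mod e)) {..<d * e} ({..<d} \<times> {..<(e::nat)})"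
proof (cases "e = 0")
  case False
  have lt: "a * e + b < d * e" if "a < d" "b < e" for a b
  proof -
    have "a * e + b < Suc a * e" using that by simp
    also have "\<dots> \<le> d * e" using that by (intro mult_right_mono) auto
    finally show ?thesis .
  qed
  show ?thesis
    by (rule bij_betw_byWitness[where f' = "\<lambda>(a, b). a * e + b"])
       (use False in \<open>auto simp: less_mult_imp_div_less lt\<close>)
qed (simp add: bij_betw_def)

lemma rep_tensor:
  assumes "rep k ds v A amp" "rep k es w B amp'"
  shows "rep k (tensor_dims ds es) (tensor_vec ds v es w) (\<lambda>i. A i \<times> B i)
    (\<lambda>f. amp (\<lambda>i\<in>{..<k}. fst (f i)) * amp' (\<lambda>i\<in>{..<k}. snd (f i)))"
proof -
  obtain dec dec' where d: "rep_by k ds v A dec amp" "rep_by k es w B dec' amp'"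
    using assms by (auto simp: rep_def)
  have len: "length ds = k" "length es = k" using d by (auto simp: rep_by_def)
  let ?dec = "\<lambda>i c. (dec i (c div es ! i), dec' i (c mod es ! i))"
  have "rep_by k (tensor_dims ds es) (tensor_vec ds v es w) (\<lambda>i. A i \<times> B i) ?dec
    (\<lambda>f. amp (\<lambda>i\<in>{..<k}. fst (f i)) * amp' (\<lambda>i\<in>{..<k}. snd (f i)))"
    unfolding rep_by_def
  proof (intro conjI allI impI ballI)
    show "length (tensor_dims ds es) = k" using len by simp
    show "bij_betw (?dec i) {..<tensor_dims ds es ! i} (A i \<times> B i)" if i: "i < k" for i
    proof -
      have "bij_betw (map_prod (dec i) (dec' i)) ({..<ds ! i} \<times> {..<es ! i}) (A i \<times> B i)"
        using d i by (intro bij_betw_map_prod) (auto simp: rep_by_def)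
      from bij_betw_trans[OF bij_div_mod this] show ?thesis
        using i len by (simp add: tensor_dims_nth o_def)
    qed
    fix x assume x: "x \<in> idxs (tensor_dims ds es)"
    have le: "length ds = length es" using len by simp
    have lx: "length x = k" using x len by (simp add: idxs_def)
    have "tensor_vec ds v es w x = v (map2 (div) x es) * w (map2 (mod) x es)"
      using x by (simp add: tensor_vec_def)
    also have "\<dots> = amp (fam k dec (map2 (div) x es)) * amp' (fam k dec' (map2 (mod) x es))"
      using d map2_div_in[OF le x] map2_mod_in[OF le x] by (simp add: rep_by_def)
    also have "fam k dec (map2 (div) x es) = (\<lambda>i\<in>{..<k}. fst (fam k ?dec x i))"
      using lx len by (intro ext) (simp add: fam_def)
    also have "fam k dec' (map2 (mod) x es) = (\<lambda>i\<in>{..<k}. snd (fam k ?dec x i))"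
      using lx len by (intro ext) (simp add: fam_def)
    finally show "tensor_vec ds v es w x = amp (\<lambda>i\<in>{..<k}. fst (fam k ?dec x i)) * amp' (\<lambda>i\<in>{..<k}. snd (fam k ?dec x i))" .
  qed
  then show ?thesis by (auto simp: rep_def)
qed

lemma bij_fun_upd_PiE:
  "bij_betw (\<lambda>(g, a). g(n := a)) (PiE {..<n} (\<lambda>_. A) \<times> A) (PiE {..<Suc n} (\<lambda>_. A))"
proof (rule bij_betw_byWitness[where f' = "\<lambda>g. (g(n := undefined), g n)"])
  show "\<forall>a\<in>PiE {..<n} (\<lambda>_. A) \<times> A. (\<lambda>g. (g(n := undefined), g n)) ((\<lambda>(g, a). g(n := a)) a) = a"
    by (auto simp: PiE_iff extensional_def fun_eq_iff)
  show "\<forall>g\<in>PiE {..<Suc n} (\<lambda>_. A). (case (g(n := undefined), g n) of (g, a) \<Rightarrow> g(n := a)) = g"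
    by simp
  show "(\<lambda>(g, a). g(n := a)) ` (PiE {..<n} (\<lambda>_. A) \<times> A) \<subseteq> PiE {..<Suc n} (\<lambda>_. A)"
  proof clarify
    fix g a assume "g \<in> PiE {..<n} (\<lambda>_. A)" "a \<in> A"
    then show "g(n := a) \<in> PiE {..<Suc n} (\<lambda>_. A)"
      unfolding lessThan_Suc by (intro PiE_fun_upd) auto
  qed
  show "(\<lambda>g. (g(n := undefined), g n)) ` PiE {..<Suc n} (\<lambda>_. A) \<subseteq> PiE {..<n} (\<lambda>_. A) \<times> A"
  proof clarify
    fix g assume g: "g \<in> PiE {..<Suc n} (\<lambda>_. A)"
    have "g(n := undefined) \<in> PiE {..<n} (\<lambda>_. A)"
    proof (rule PiE_I)
      fix x assume "x \<in> {..<n}"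
      then show "(g(n := undefined)) x \<in> A" using PiE_mem[OF g, of x] by simp
    next
      fix x assume "x \<notin> {..<n}"
      then show "(g(n := undefined)) x = undefined" using PiE_arb[OF g, of x] by auto
    qed
    then show "g(n := undefined) \<in> PiE {..<n} (\<lambda>_. A) \<and> g n \<in> A" using PiE_mem[OF g, of n] by simp
  qed
qed

text \<open>A local label of the power is a word over the labels of one copy. The empty power is
  one-dimensional, matching the single function on the empty domain.\<close>

lemma rep_tpow:
  assumes "rep k ds v A amp"
  shows "rep k (fst (tpow n ds v)) (snd (tpow n ds v)) (\<lambda>i. PiE {..<n} (\<lambda>_. A i))
    (\<lambda>f. \<Prod>t<n. amp (\<lambda>i\<in>{..<k}. f i t))"
proof (induction n)
  case 0
  have len: "length ds = k" using assms by (auto simp: rep_def rep_by_def)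
  show ?case
    unfolding rep_def rep_by_def
  proof (intro exI[where x = "\<lambda>_ _ _. undefined"] conjI allI impI ballI)
    show "length (fst (tpow 0 ds v)) = k" using len by simp
    fix i assume "i < k"
    then show "bij_betw (\<lambda>_ _. undefined) {..<fst (tpow 0 ds v) ! i} (PiE {..<(0::nat)} (\<lambda>_. A i))"
      using len by (simp add: bij_betw_def inj_on_def lessThan_Suc)
  next
    fix x assume "x \<in> idxs (fst (tpow 0 ds v))"
    then have "x = replicate k 0" using idxs_replicate_1[of k] len by simp
    then show "snd (tpow 0 ds v) x = (\<Prod>t<(0::nat). amp (\<lambda>i\<in>{..<k}. fam k (\<lambda>_ _ _. undefined) x i t))"
      using len by simp
  qed
next
  case (Suc n)
  have "rep k (fst (tpow (Suc n) ds v)) (snd (tpow (Suc n) ds v)) (\<lambda>i. PiE {..<n} (\<lambda>_. A i) \<times> A i)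
     (\<lambda>f. (\<Prod>t<n. amp (\<lambda>i\<in>{..<k}. (\<lambda>i\<in>{..<k}. fst (f i)) i t)) * amp (\<lambda>i\<in>{..<k}. snd (f i)))"
    unfolding tpow.simps fst_conv snd_conv by (rule rep_tensor[OF Suc assms])
  then show ?case
  proof (rule rep_map[where \<beta> = "\<lambda>i (g, a). g(n := a)"])
    show "\<And>i. bij_betw (\<lambda>(g, a). g(n := a)) (PiE {..<n} (\<lambda>_. A i) \<times> A i) (PiE {..<Suc n} (\<lambda>_. A i))"
      by (rule bij_fun_upd_PiE)
    fix f assume "f \<in> (\<Pi>\<^sub>E i\<in>{..<k}. PiE {..<n} (\<lambda>_. A i) \<times> A i)"
    have 1: "(\<lambda>i\<in>{..<k}. (\<lambda>i\<in>{..<k}. fst (f i)) i t) = (\<lambda>i\<in>{..<k}. (\<lambda>i\<in>{..<k}. case f i of (g, a) \<Rightarrow> g(n := a)) i t)" if "t < n" for t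
      using that by (intro ext) (simp add: case_prod_unfold)
    have 2: "(\<lambda>i\<in>{..<k}. snd (f i)) = (\<lambda>i\<in>{..<k}. (\<lambda>i\<in>{..<k}. case f i of (g, a) \<Rightarrow> g(n := a)) i n)"
      by (intro ext) (simp add: case_prod_unfold)
    show "(\<Prod>t<n. amp (\<lambda>i\<in>{..<k}. (\<lambda>i\<in>{..<k}. fst (f i)) i t)) * amp (\<lambda>i\<in>{..<k}. snd (f i))
      = (\<Prod>t<Suc n. amp (\<lambda>i\<in>{..<k}. (\<lambda>i\<in>{..<k}. case f i of (g, a) \<Rightarrow> g(n := a)) i t))"
      unfolding prod.lessThan_Suc
      by (intro arg_cong2[where f = "(*)"] prod.cong refl arg_cong[where f = amp]) (rule 1, simp, rule 2)
  qed
qed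

section \<open>Coherent preparation by LOCC\<close>

lemma add_mod_cancel:
  fixes s x y R :: nat
  assumes "x < R" "y < R" "(s + x) mod R = (s + y) mod R"
  shows "x = y"
proof -
  define r where "r = s mod R"
  have r: "r < R" using assms by (simp add: r_def)
  have m: "(s + z) mod R = (if r + z < R then r + z else r + z - R)" if "z < R" for z
  proof -
    have "(s + z) mod R = (r + z) mod R" by (simp add: r_def mod_add_left_eq)
    also have "\<dots> = (if r + z < R then r + z else r + z - R)" using r that by (simp add: mod_if)
    finally show ?thesis .
  qed
  show ?thesis using assms(3) unfolding m[OF assms(1)] m[OF assms(2)] using assms(1,2) r by (auto split: if_splits)
qed

lemma sum_lessThan_mod_shift:
  fixes F :: "nat \<Rightarrow> 'a :: comm_monoid_add"
  shows "(\<Sum>t<R. F ((s + t) mod R)) = (\<Sum>t<R. F t)"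
proof (cases "R = 0")
  case False
  have inj: "inj_on (\<lambda>t. (s + t) mod R) {..<R}"
    by (rule inj_onI) (auto intro: add_mod_cancel)
  have "(\<lambda>t. (s + t) mod R) ` {..<R} = {..<R}"
    using False inj by (intro endo_inj_surj) auto
  then show ?thesis using sum.reindex[OF inj, of F] by (simp add: o_def)
qed simp

section \<open>Characters of the cyclic group of order Q\<close>

definition ph :: "nat \<Rightarrow> nat \<Rightarrow> nat \<Rightarrow> complex" where
  "ph Q t m = cis (2 * pi * real t * real m / real Q)"

lemma ph_add_left: "ph Q (t + t') m = ph Q t m * ph Q t' m"
  by (simp add: ph_def cis_mult add_divide_distrib algebra_simps)

lemma ph_add_right: "ph Q t (m + m') = ph Q t m * ph Q t m'"
  by (simp add: ph_def cis_mult add_divide_distrib algebra_simps)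

lemma ph_0 [simp]: "ph Q 0 m = 1" "ph Q t 0 = 1"
  by (simp_all add: ph_def)

lemma ph_sum_left: "finite I \<Longrightarrow> ph Q (sum t I) m = (\<Prod>i\<in>I. ph Q (t i) m)"
  by (induction I rule: finite_induct) (auto simp: ph_add_left)

lemma ph_sum_right: "finite I \<Longrightarrow> ph Q t (sum m I) = (\<Prod>i\<in>I. ph Q t (m i))"
  by (induction I rule: finite_induct) (auto simp: ph_add_right)

lemma cnj_ph_mult: "cnj (ph Q t m) * ph Q t m = 1"
  by (simp add: ph_def cis_cnj cis_mult)

text \<open>Off the diagonal the summands are the powers of a Q-th root of unity. It is not 1, since
  two residues below Q do not differ by a nonzero multiple of Q, so the geometric sum
  vanishes.\<close>

lemma ph_orthogonal:
  assumes "m < Q" "m' < Q"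
  shows "(\<Sum>t<Q. cnj (ph Q t m) * ph Q t m') = (if m = m' then of_nat Q else 0)"
proof (cases "m = m'")
  case True
  then show ?thesis by (simp add: cnj_ph_mult)
next
  case False
  define z where "z = cis (2 * pi * (real m' - real m) / real Q)"
  have Q: "0 < Q" using assms by simp
  have "cnj (ph Q t m) * ph Q t m' = z ^ t" for t
  proof -
    have "cnj (ph Q t m) * ph Q t m' = cis (- (2 * pi * real t * real m / real Q) + 2 * pi * real t * real m' / real Q)"
      by (simp add: ph_def cis_cnj cis_mult)
    also have "- (2 * pi * real t * real m / real Q) + 2 * pi * real t * real m' / real Q
        = real t * (2 * pi * (real m' - real m) / real Q)"
      using Q by (simp add: field_simps)
    also have "cis \<dots> = z ^ t" unfolding z_def by (rule Complex.DeMoivre[symmetric])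
    finally show ?thesis .
  qed
  then have "(\<Sum>t<Q. cnj (ph Q t m) * ph Q t m') = (\<Sum>t<Q. z ^ t)" by simp
  moreover have "z ^ Q = 1"
  proof -
    have "z ^ Q = cis (real Q * (2 * pi * (real m' - real m) / real Q))" unfolding z_def by (rule Complex.DeMoivre)
    also have "real Q * (2 * pi * (real m' - real m) / real Q) = 2 * pi * real_of_int (int m' - int m)" using Q by simp
    also have "cis \<dots> = 1" by (intro cis_multiple_2pi) auto
    finally show ?thesis .
  qed
  moreover have "z \<noteq> 1"
  proof
    assume "z = 1"
    then have "cos (2 * pi * (real m' - real m) / real Q) = 1" by (simp add: z_def complex_eq_iff)
    then obtain n :: int where n: "2 * pi * (real m' - real m) / real Q = of_int n * 2 * pi"
      unfolding cos_one_2pi_int by blast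
    then have "2 * pi * ((real m' - real m) / real Q) = 2 * pi * of_int n" by simp
    then have "(real m' - real m) / real Q = of_int n" by (subst (asm) mult_cancel_left) simp
    then have "real m' - real m = of_int n * real Q" using Q by (simp add: divide_eq_eq)
    then have "real_of_int (int m' - int m) = real_of_int (n * int Q)" by simp
    then have eq: "int m' - int m = n * int Q" using of_int_eq_iff by blast
    have "\<bar>int m' - int m\<bar> < int Q" using assms by linarith
    then have "\<bar>n\<bar> * int Q < 1 * int Q" unfolding eq by (simp add: abs_mult)
    then have "n = 0" using Q by simp
    then show False using eq False by simp
  qed
  ultimately show ?thesis using False by (simp add: geometric_sum)
qed

lemma sum_power_less:
  fixes x :: "nat \<Rightarrow> nat"
  assumes "\<And>i. i < n \<Longrightarrow> x i < B" shows "(\<Sum>i<n. x i * B ^ i) < B ^ n"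
  using assms
proof (induction n)
  case (Suc n)
  have "(\<Sum>i<Suc n. x i * B ^ i) < B ^ n + x n * B ^ n" using Suc by simp
  also have "\<dots> = Suc (x n) * B ^ n" by simp
  also have "\<dots> \<le> B * B ^ n" using Suc.prems[of n] by (intro mult_right_mono) auto
  finally show ?case by simp
qed simp

lemma sum_power_inj:
  fixes x y :: "nat \<Rightarrow> nat"
  assumes "\<And>i. i < n \<Longrightarrow> x i < B" "\<And>i. i < n \<Longrightarrow> y i < B" "(\<Sum>i<n. x i * B ^ i) = (\<Sum>i<n. y i * B ^ i)"
  shows "\<forall>i<n. x i = y i"
  using assms
proof (induction n)
  case (Suc n)
  have lt: "(\<Sum>i<n. x i * B ^ i) < B ^ n" "(\<Sum>i<n. y i * B ^ i) < B ^ n"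
    using Suc.prems by (auto intro: sum_power_less)
  have e: "(\<Sum>i<n. x i * B ^ i) + x n * B ^ n = (\<Sum>i<n. y i * B ^ i) + y n * B ^ n" using Suc.prems(3) by simp
  have dm: "(X + z * b) div b = z" "(X + z * b) mod b = X" if "X < b" for X z b :: nat
    using that by (cases "b = 0"; simp)+
  have "x n = y n" using dm(1)[OF lt(1), of "x n"] dm(1)[OF lt(2), of "y n"] e by simp
  have "(\<Sum>i<n. x i * B ^ i) = (\<Sum>i<n. y i * B ^ i)"
    using dm(2)[OF lt(1), of "x n"] dm(2)[OF lt(2), of "y n"] e by simp
  then have "\<forall>i<n. x i = y i" using Suc.prems(1,2) by (intro Suc.IH) auto
  with \<open>x n = y n\<close> show ?case using less_SucE by blast
qed simp

text \<open>Positional notation in a base \<open>B\<close> above all codes: digit \<open>i\<close>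
  of the number of \<open>s\<close> encodes what party \<open>i\<close> reads, so the number is a
  sum of terms that the parties can compute locally. Since all readings together determine
  \<open>s\<close>, it is injective.\<close>

lemma local_numbering:
  fixes \<iota> :: "nat \<Rightarrow> 's \<Rightarrow> 'a \<Rightarrow> nat" and \<rho> :: "nat \<Rightarrow> 's \<Rightarrow> 'r"
  assumes fin: "finite S"
    and read: "\<And>i s s' a a'. i < k \<Longrightarrow> s \<in> S \<Longrightarrow> s' \<in> S \<Longrightarrow> a \<in> A i \<Longrightarrow> a' \<in> A i \<Longrightarrow> \<iota> i s a = \<iota> i s' a' \<Longrightarrow> \<rho> i s = \<rho> i s'"
    and joint: "\<And>s s'. s \<in> S \<Longrightarrow> s' \<in> S \<Longrightarrow> (\<And>i. i < k \<Longrightarrow> \<rho> i s = \<rho> i s') \<Longrightarrow> s = s'"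
  obtains N :: "'s \<Rightarrow> nat" and g where "inj_on N S"
    "\<And>s a. s \<in> S \<Longrightarrow> a \<in> PiE {..<k} A \<Longrightarrow> N s = (\<Sum>i<k. g i (\<iota> i s (a i)))"
proof -
  let ?U = "(\<Union>i<k. \<rho> i ` S)"
  have "finite ?U" using fin by simp
  then obtain code :: "'r \<Rightarrow> nat" where code: "inj_on code ?U"
    using finite_imp_inj_to_nat_seg[OF \<open>finite ?U\<close>] by metis
  obtain B where B: "\<And>u. u \<in> ?U \<Longrightarrow> code u < B"
  proof
    fix u assume "u \<in> ?U"
    then show "code u < Suc (Max (code ` ?U))" using \<open>finite ?U\<close> by (simp add: le_imp_less_Suc)
  qed
  define N where "N = (\<lambda>s. \<Sum>i<k. code (\<rho> i s) * B ^ i)"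
  \<comment> \<open>Party \<open>i\<close> sees only the value of \<open>\<iota> i s a\<close>. Any
    preimage may be chosen, because \<open>read\<close> gives all of them the same
    \<open>\<rho> i s\<close>.\<close>
  define g where "g = (\<lambda>i y. code (\<rho> i (SOME s. s \<in> S \<and> (\<exists>a\<in>A i. \<iota> i s a = y))) * B ^ i)"
  show thesis
  proof
    show "inj_on N S"
    proof (rule inj_onI)
      fix s s' assume s: "s \<in> S" "s' \<in> S" "N s = N s'"
      have "\<forall>i<k. code (\<rho> i s) = code (\<rho> i s')"
        using s B unfolding N_def by (intro sum_power_inj) auto
      then have "\<rho> i s = \<rho> i s'" if "i < k" for i
        using that s by (intro inj_onD[OF code]) auto
      then show "s = s'" using joint s by blast
    qed
    fix s a assume s: "s \<in> S" and a: "a \<in> PiE {..<k} A"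
    have "g i (\<iota> i s (a i)) = code (\<rho> i s) * B ^ i" if i: "i < k" for i
    proof -
      have ai: "a i \<in> A i" using a i by auto
      define s' where "s' = (SOME s'. s' \<in> S \<and> (\<exists>a'\<in>A i. \<iota> i s' a' = \<iota> i s (a i)))"
      have "s' \<in> S \<and> (\<exists>a'\<in>A i. \<iota> i s' a' = \<iota> i s (a i))"
        unfolding s'_def by (rule someI[of _ s]) (use s ai in blast)
      then have "\<rho> i s' = \<rho> i s" using read[OF i] s ai by metis
      then show ?thesis by (simp add: g_def s'_def[symmetric])
    qed
    then show "N s = (\<Sum>i<k. g i (\<iota> i s (a i)))" by (simp add: N_def)
  qed
qed

text \<open>On the support of a shared label all first components coincide, so a family amounts to
  one label together with the family of second components.\<close>

lemma sum_diag:
  fixes G :: "nat \<Rightarrow> (nat \<Rightarrow> 'a) \<Rightarrow> 'b :: comm_monoid_add"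
  assumes k: "0 < k" and A: "\<And>i. i < k \<Longrightarrow> finite (A i)"
  shows "(\<Sum>f\<in>PiE {..<k} (\<lambda>i. {..<R} \<times> A i).
      if \<forall>i<k. fst (f i) = fst (f 0) then G (fst (f 0)) (\<lambda>i\<in>{..<k}. snd (f i)) else 0)
    = (\<Sum>s<R. \<Sum>a\<in>PiE {..<k} A. G s a)"
proof -
  let ?D = "{f\<in>PiE {..<k} (\<lambda>i. {..<R} \<times> A i). \<forall>i<k. fst (f i) = fst (f 0)}"
  have fin: "finite (PiE {..<k} (\<lambda>i. {..<R} \<times> A i))" using A by (intro finite_PiE) auto
  have "(\<Sum>f\<in>PiE {..<k} (\<lambda>i. {..<R} \<times> A i).
      if \<forall>i<k. fst (f i) = fst (f 0) then G (fst (f 0)) (\<lambda>i\<in>{..<k}. snd (f i)) else 0)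
    = (\<Sum>f\<in>?D. G (fst (f 0)) (\<lambda>i\<in>{..<k}. snd (f i)))"
    using fin by (simp add: sum.inter_filter)
  also have "\<dots> = (\<Sum>(s, a)\<in>{..<R} \<times> PiE {..<k} A. G s a)"
  proof (rule sum.reindex_bij_witness[where i = "\<lambda>(s, a). \<lambda>i\<in>{..<k}. (s, a i)" and j = "\<lambda>f. (fst (f 0), \<lambda>i\<in>{..<k}. snd (f i))"], goal_cases)
    case (1 f)
    have mem: "f \<in> PiE {..<k} (\<lambda>i. {..<R} \<times> A i)" using 1 by blast
    show ?case
    proof
      fix i
      have "fst (f i) = fst (f 0)" if "i < k" using 1 that by blast
      then show "(case (fst (f 0), \<lambda>i\<in>{..<k}. snd (f i)) of (s, a) \<Rightarrow> \<lambda>i\<in>{..<k}. (s, a i)) i = f i"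
        using PiE_arb[OF mem, of i] by (cases "i < k") (auto simp: prod_eq_iff)
    qed
  next
    case (2 f)
    have "f 0 \<in> {..<R} \<times> A 0" using 2 k by blast
    moreover have "snd (f i) \<in> A i" if "i < k" for i
    proof -
      have "f i \<in> {..<R} \<times> A i" using 2 that by blast
      then show ?thesis by auto
    qed
    ultimately show ?case by auto
  next
    case (3 b)
    then obtain s a where b: "b = (s, a)" "s < R" "a \<in> PiE {..<k} A" by auto
    have "(\<lambda>i\<in>{..<k}. snd ((\<lambda>i\<in>{..<k}. (s, a i)) i)) = a"
      using PiE_arb[OF b(3)] by (intro ext) auto
    then show ?case using k b(1) by simp
  next
    case (4 b)
    then obtain s a where b: "b = (s, a)" "s < R" "a \<in> PiE {..<k} A" by auto
    then have "(\<lambda>i\<in>{..<k}. (s, a i)) \<in> PiE {..<k} (\<lambda>i. {..<R} \<times> A i)" by auto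
    then show ?case using k b(1) by simp
  next
    case (5 f)
    show ?case by simp
  qed
  finally show ?thesis by (simp add: sum.cartesian_product)
qed

text \<open>Party 0 imprints the amplitudes \<open>c\<close>; then every party erases the label \<open>s\<close> by a Fourier
  measurement. The resulting phase is a function of the number \<open>N s\<close>, which splits into local
  summands, so that the parties can undo it.\<close>

lemma prep:
  fixes \<iota> :: "nat \<Rightarrow> 's \<Rightarrow> 'a \<Rightarrow> nat" and \<rho> :: "nat \<Rightarrow> 's \<Rightarrow> 'r" and c :: "'s \<Rightarrow> complex"
  assumes k: "0 < k" and st: "is_state k ds u" and les: "length es = k"
    and rep: "rep k ds u (\<lambda>i. {..<R} \<times> A i)
      (\<lambda>f. if \<forall>i<k. fst (f i) = fst (f 0) then \<xi> (\<lambda>i\<in>{..<k}. snd (f i)) / complex_of_real (sqrt (real R)) else 0)"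
    and fin: "finite S" and card: "card S \<le> R"
    and \<iota>: "\<And>i s a. i < k \<Longrightarrow> s \<in> S \<Longrightarrow> a \<in> A i \<Longrightarrow> \<iota> i s a < es ! i"
    and inj: "\<And>i s. i < k \<Longrightarrow> s \<in> S \<Longrightarrow> inj_on (\<iota> i s) (A i)"
    and read: "\<And>i s s' a a'. i < k \<Longrightarrow> s \<in> S \<Longrightarrow> s' \<in> S \<Longrightarrow> a \<in> A i \<Longrightarrow> a' \<in> A i \<Longrightarrow> \<iota> i s a = \<iota> i s' a' \<Longrightarrow> \<rho> i s = \<rho> i s'"
    and joint: "\<And>s s'. s \<in> S \<Longrightarrow> s' \<in> S \<Longrightarrow> (\<And>i. i < k \<Longrightarrow> \<rho> i s = \<rho> i s') \<Longrightarrow> s = s'"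
    and c: "(\<Sum>s\<in>S. (cmod (c s))\<^sup>2) = 1"
  shows "\<exists>out. is_state k es out \<and> reach ds u es (\<lambda>z. \<exists>b. z = (\<lambda>x. b * out x)) \<and>
    (\<Sum>a\<in>PiE {..<k} A. (cmod (\<xi> a))\<^sup>2) = 1 \<and>
    (\<forall>w. ip es w out = (\<Sum>s\<in>S. \<Sum>a\<in>PiE {..<k} A. cnj (w (map (\<lambda>i. \<iota> i s (a i)) [0..<k])) * (c s * \<xi> a)))"
proof -
  obtain dec where dec: "rep_by k ds u (\<lambda>i. {..<R} \<times> A i) dec
      (\<lambda>f. if \<forall>i<k. fst (f i) = fst (f 0) then \<xi> (\<lambda>i\<in>{..<k}. snd (f i)) / complex_of_real (sqrt (real R)) else 0)"
    using rep by (auto simp: rep_def)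
  have len: "length ds = k" and uon: "vec_on ds u" and u1: "sqn ds u = 1" using st by (auto simp: is_state_iff)
  have bij: "bij_betw (dec i) {..<ds ! i} ({..<R} \<times> A i)" if "i < k" for i using dec that by (auto simp: rep_by_def)
  have S0: "S \<noteq> {}" using c by auto
  have cS: "0 < card S" using S0 fin by (simp add: card_gt_0_iff)
  have R0: "0 < R" using cS card by simp
  have finA: "finite (A i)" if i: "i < k" for i
  proof -
    have "finite ({..<R} \<times> A i)" using bij_betw_finite[OF bij[OF i]] by simp
    then show ?thesis using R0 by (auto dest: finite_cartesian_productD2)
  qed
  have decin: "fst (dec i a) < R" "snd (dec i a) \<in> A i" if "i < k" "a < ds ! i" for i a
    using bij_betw_apply[OF bij[OF that(1)], of a] that(2) by auto
  have finP: "finite (PiE {..<k} A)" using finA by (intro finite_PiE) auto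
  define lab where "lab = (\<lambda>s (a :: nat \<Rightarrow> 'a). map (\<lambda>i. \<iota> i s (a i)) [0..<k])"
  have labin: "lab s a \<in> idxs es" if "s \<in> S" "a \<in> PiE {..<k} A" for s a
    using that \<iota> les by (auto simp: lab_def idxs_def PiE_iff)
  \<comment> \<open>The target: label \<open>s\<close> with amplitude \<open>c s\<close>, in
    superposition with the auxiliary amplitudes \<xi>, written into the local basis by \<iota>. No
    separate copy of \<open>s\<close> remains.\<close>
  define out where "out = (\<lambda>y. \<Sum>s\<in>S. \<Sum>a\<in>PiE {..<k} A. if lab s a = y then c s * \<xi> a else 0)"
  have outon: "vec_on es out"
    unfolding vec_on_def out_def using labin by (auto intro!: sum.neutral)
  have ipout: "ip es w out = (\<Sum>s\<in>S. \<Sum>a\<in>PiE {..<k} A. cnj (w (lab s a)) * (c s * \<xi> a))" for w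
  proof -
    have "ip es w out = (\<Sum>y\<in>idxs es. \<Sum>s\<in>S. \<Sum>a\<in>PiE {..<k} A. if lab s a = y then cnj (w y) * (c s * \<xi> a) else 0)"
      unfolding ip_def out_def sum_distrib_left by (intro sum.cong refl) auto
    also have "\<dots> = (\<Sum>s\<in>S. \<Sum>a\<in>PiE {..<k} A. \<Sum>y\<in>idxs es. if lab s a = y then cnj (w y) * (c s * \<xi> a) else 0)"
      by (subst sum.swap, rule sum.cong[OF refl], rule sum.swap)
    also have "\<dots> = (\<Sum>s\<in>S. \<Sum>a\<in>PiE {..<k} A. cnj (w (lab s a)) * (c s * \<xi> a))"
      using labin by (intro sum.cong refl) simp
    finally show ?thesis .
  qed
  have diag_sum: "(\<Sum>x\<in>idxs ds. if \<forall>i<k. fst (fam k dec x i) = fst (fam k dec x 0) then G (fst (fam k dec x 0)) (\<lambda>i\<in>{..<k}. snd (fam k dec x i)) else 0)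
      = (\<Sum>s<R. \<Sum>a\<in>PiE {..<k} A. G s a)" for G :: "nat \<Rightarrow> (nat \<Rightarrow> 'a) \<Rightarrow> 'z :: comm_monoid_add"
    using rep_by_sum[OF dec, of "\<lambda>f. if \<forall>i<k. fst (f i) = fst (f 0) then G (fst (f 0)) (\<lambda>i\<in>{..<k}. snd (f i)) else 0"]
      sum_diag[where R = R and G = G, OF k finA] by (rule trans)
  have ux: "u x = (if \<forall>i<k. fst (fam k dec x i) = fst (fam k dec x 0) then \<xi> (\<lambda>i\<in>{..<k}. snd (fam k dec x i)) / complex_of_real (sqrt (real R)) else 0)"
    if "x \<in> idxs ds" for x using dec that by (simp add: rep_by_def)
  have \<xi>1: "(\<Sum>a\<in>PiE {..<k} A. (cmod (\<xi> a))\<^sup>2) = 1"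
  proof -
    have "1 = (\<Sum>x\<in>idxs ds. (cmod (u x))\<^sup>2)" using u1 by (simp add: sqn_def)
    also have "\<dots> = (\<Sum>x\<in>idxs ds. if \<forall>i<k. fst (fam k dec x i) = fst (fam k dec x 0) then (cmod (\<xi> (\<lambda>i\<in>{..<k}. snd (fam k dec x i))))\<^sup>2 / real R else 0)"
    proof (rule sum.cong[OF refl])
      fix x assume x: "x \<in> idxs ds"
      show "(cmod (u x))\<^sup>2 = (if \<forall>i<k. fst (fam k dec x i) = fst (fam k dec x 0) then (cmod (\<xi> (\<lambda>i\<in>{..<k}. snd (fam k dec x i))))\<^sup>2 / real R else 0)"
      proof (cases "\<forall>i<k. fst (fam k dec x i) = fst (fam k dec x 0)")
        case True
        show ?thesis unfolding ux[OF x] if_P[OF True] by (simp add: norm_divide power_divide)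
      next
        case False
        show ?thesis unfolding ux[OF x] if_not_P[OF False] by simp
      qed
    qed
    also have "\<dots> = (\<Sum>s<R. \<Sum>a\<in>PiE {..<k} A. (cmod (\<xi> a))\<^sup>2 / real R)"
      by (rule diag_sum)
    also have "\<dots> = (\<Sum>a\<in>PiE {..<k} A. (cmod (\<xi> a))\<^sup>2)"
      using R0 by (simp add: sum_divide_distrib[symmetric])
    finally show ?thesis by simp
  qed
  have lab_inj: "s = s' \<and> a = a'" if "s \<in> S" "s' \<in> S" "a \<in> PiE {..<k} A" "a' \<in> PiE {..<k} A" "lab s a = lab s' a'" for s s' a a'
  proof -
    have e: "\<iota> i s (a i) = \<iota> i s' (a' i)" if "i < k" for i
      using \<open>lab s a = lab s' a'\<close> that by (simp add: lab_def)
    have ai: "a i \<in> A i" "a' i \<in> A i" if "i < k" for i using that \<open>a \<in> PiE {..<k} A\<close> \<open>a' \<in> PiE {..<k} A\<close> by auto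
    have s: "s = s'"
    proof (rule joint[OF \<open>s \<in> S\<close> \<open>s' \<in> S\<close>])
      fix i assume i: "i < k"
      show "\<rho> i s = \<rho> i s'"
        by (rule read[OF i \<open>s \<in> S\<close> \<open>s' \<in> S\<close> ai(1)[OF i] ai(2)[OF i] e[OF i]])
    qed
    have "a = a'"
    proof (rule PiE_ext[OF \<open>a \<in> PiE {..<k} A\<close> \<open>a' \<in> PiE {..<k} A\<close>])
      fix i assume "i \<in> {..<k}"
      then have i: "i < k" by simp
      show "a i = a' i"
        by (rule inj_onD[OF inj[OF i \<open>s \<in> S\<close>] _ ai(1)[OF i] ai(2)[OF i]]) (use e[OF i] s in simp)
    qed
    with s show ?thesis by simp
  qed
  have outlab: "out (lab s a) = c s * \<xi> a" if "s \<in> S" "a \<in> PiE {..<k} A" for s a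
  proof -
    have "out (lab s a) = (\<Sum>s'\<in>S. \<Sum>a'\<in>PiE {..<k} A. if s' = s then (if a' = a then c s * \<xi> a else 0) else 0)"
      unfolding out_def
    proof (intro sum.cong refl)
      fix s' a' assume "s' \<in> S" "a' \<in> PiE {..<k} A"
      then show "(if lab s' a' = lab s a then c s' * \<xi> a' else 0) = (if s' = s then (if a' = a then c s * \<xi> a else 0) else 0)"
        using lab_inj[of s' s a' a] that by auto
    qed
    also have "\<dots> = (\<Sum>s'\<in>S. if s' = s then c s * \<xi> a else 0)"
      using that finP by (intro sum.cong refl) simp
    also have "\<dots> = c s * \<xi> a" using that fin by simp
    finally show ?thesis .
  qed
  have "complex_of_real (sqn es out) = (\<Sum>s\<in>S. \<Sum>a\<in>PiE {..<k} A. cnj (c s * \<xi> a) * (c s * \<xi> a))"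
    unfolding sqn_ip ipout by (intro sum.cong refl) (simp add: outlab)
  also have "\<dots> = (\<Sum>s\<in>S. \<Sum>a\<in>PiE {..<k} A. complex_of_real ((cmod (c s))\<^sup>2 * (cmod (\<xi> a))\<^sup>2))"
    by (intro sum.cong refl) (simp only: of_real_mult complex_norm_square complex_cnj_mult mult_ac)
  also have "\<dots> = complex_of_real ((\<Sum>s\<in>S. (cmod (c s))\<^sup>2) * (\<Sum>a\<in>PiE {..<k} A. (cmod (\<xi> a))\<^sup>2))"
    by (simp add: sum_product)
  finally have "sqn es out = 1" unfolding c \<xi>1 by (metis mult_1 of_real_eq_iff)
  then have outst: "is_state k es out" using les outon by (simp add: is_state_iff)

  obtain en where en: "bij_betw en {..<card S} S" using ex_bij_betw_nat_finite[OF fin] atLeast0LessThan by metis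
  define sel where "sel = (\<lambda>s. if s < card S then en s else en 0)"
  define cc where "cc = (\<lambda>s. if s < card S then c (en s) else 0)"
  have selS: "sel s \<in> S" for s using bij_betw_apply[OF en] cS by (auto simp: sel_def)
  have sumS: "(\<Sum>s<R. if s < card S then H (en s) else 0) = sum H S" for H :: "'s \<Rightarrow> 'z :: comm_monoid_add"
  proof -
    have "(\<Sum>s<R. if s < card S then H (en s) else 0) = (\<Sum>s<card S. H (en s))"
      using card by (intro sum.mono_neutral_cong_right) auto
    also have "\<dots> = sum H S" by (rule sum.reindex_bij_betw[OF en])
    finally show ?thesis .
  qed
  have cc1: "(\<Sum>s<R. (cmod (cc s))\<^sup>2) = 1"
  proof -
    have "(\<Sum>s<R. (cmod (cc s))\<^sup>2) = (\<Sum>s<R. if s < card S then (cmod (c (en s)))\<^sup>2 else 0)"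
      by (intro sum.cong) (auto simp: cc_def)
    then show ?thesis using sumS[of "\<lambda>s. (cmod (c s))\<^sup>2"] c by simp
  qed
  obtain N0 :: "'s \<Rightarrow> nat" and g where N0: "inj_on N0 S"
    "\<And>s a. s \<in> S \<Longrightarrow> a \<in> PiE {..<k} A \<Longrightarrow> N0 s = (\<Sum>i<k. g i (\<iota> i s (a i)))"
  proof -
    assume N0_that: "\<And>(N :: 's \<Rightarrow> nat) g. inj_on N S \<Longrightarrow> (\<And>s a. s \<in> S \<Longrightarrow> a \<in> PiE {..<k} A \<Longrightarrow> N s = (\<Sum>i<k. g i (\<iota> i s (a i)))) \<Longrightarrow> thesis"
    show thesis
    proof (rule local_numbering[where S = S and k = k and A = A and \<iota> = \<iota> and \<rho> = \<rho>])
      show "finite S" by (rule fin)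
      show "\<rho> i s = \<rho> i s'"
        if "i < k" "s \<in> S" "s' \<in> S" "a \<in> A i" "a' \<in> A i" "\<iota> i s a = \<iota> i s' a'" for i s s' a a'
        by (rule read[OF that])
      show "s = s'" if "s \<in> S" "s' \<in> S" "\<And>i. i < k \<Longrightarrow> \<rho> i s = \<rho> i s'" for s s'
        by (rule joint[OF that])
      show thesis if "inj_on N S" "\<And>s a. s \<in> S \<Longrightarrow> a \<in> PiE {..<k} A \<Longrightarrow> N s = (\<Sum>i<k. g i (\<iota> i s (a i)))" for N :: "'s \<Rightarrow> nat" and g
        by (rule N0_that[OF that])
    qed
  qed
  define T where "T = Suc (Max (N0 ` S))"
  have N0T: "N0 s < T" if "s \<in> S" for s using that fin by (simp add: T_def le_imp_less_Suc)
  define Q where "Q = T + R"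
  define N where "N = (\<lambda>s. if s < card S then N0 (en s) else T + s)"
  have NQ: "N s < Q" if "s < R" for s
    using that N0T[OF bij_betw_apply[OF en]] R0 by (auto simp: N_def Q_def trans_less_add1)
  have Ninj: "s = s'" if "s < R" "s' < R" "N s = N s'" for s s'
  proof -
    have lt: "N0 (en z) < T" if "z < card S" for z using N0T[OF bij_betw_apply[OF en, of z]] that by simp
    consider "s < card S" "s' < card S" | "\<not> s < card S" "\<not> s' < card S" | "(s < card S) \<noteq> (s' < card S)" by blast
    then show ?thesis
    proof cases
      case 1
      then have "en s = en s'" using that bij_betw_apply[OF en] by (intro inj_onD[OF N0(1)]) (auto simp: N_def)
      then show ?thesis using 1 en by (auto simp: bij_betw_def dest: inj_onD)
    next
      case 2 then show ?thesis using that by (simp add: N_def)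
    next
      case 3 then show ?thesis using that lt[of s] lt[of s'] by (auto simp: N_def)
    qed
  qed
  have Q0: "0 < Q" using R0 by (simp add: Q_def)
  have modR: "x mod R < R" for x using R0 by simp

  \<comment> \<open>Imposing the amplitudes \<open>cc\<close> directly would not be an instrument.
    Taking all \<open>R\<close> cyclic shifts as outcomes makes the squares sum to 1; outcome
    \<open>t\<close> is compensated by reading every label as (s + t) mod R from then on.\<close>
  define Ks0 where "Ks0 = map (\<lambda>t b a. if b = a then cc ((fst (dec 0 a) + t) mod R) else 0) [0..<R]"
  have "reach ds u es (\<lambda>z. \<exists>b. z = (\<lambda>x. b * out x))"
  proof (rule reach_round[where i = 0 and d' = "ds ! 0" and Ks = Ks0])
    show "0 < length ds" using len k by simp
    show "local_instr (ds ! 0) (ds ! 0) Ks0"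
      unfolding local_instr_def
    proof (intro allI impI)
      fix a b assume ab: "a < ds ! 0" "b < ds ! 0"
      have "(\<Sum>K\<leftarrow>Ks0. \<Sum>z<ds ! 0. cnj (K z a) * K z b)
         = (\<Sum>t<R. \<Sum>z<ds ! 0. cnj (if z = a then cc ((fst (dec 0 a) + t) mod R) else 0) * (if z = b then cc ((fst (dec 0 b) + t) mod R) else 0))"
        by (simp add: Ks0_def o_def interv_sum_list_conv_sum_set_nat atLeast0LessThan)
      also have "\<dots> = (\<Sum>t<R. \<Sum>z<ds ! 0. if z = a then (if a = b then complex_of_real ((cmod (cc ((fst (dec 0 a) + t) mod R)))\<^sup>2) else 0) else 0)"
        by (intro sum.cong refl) (auto simp: complex_norm_square mult.commute simp del: of_real_power)
      also have "\<dots> = (if a = b then complex_of_real (\<Sum>t<R. (cmod (cc ((fst (dec 0 a) + t) mod R)))\<^sup>2) else 0)"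
        using ab by simp
      also have "(\<Sum>t<R. (cmod (cc ((fst (dec 0 a) + t) mod R)))\<^sup>2) = 1"
        using sum_lessThan_mod_shift[of "\<lambda>s. (cmod (cc s))\<^sup>2"] cc1 by simp
      finally show "(\<Sum>K\<leftarrow>Ks0. \<Sum>z<ds ! 0. cnj (K z a) * K z b) = (if a = b then 1 else 0)" by simp
    qed
    fix t assume "t < length Ks0"
    then have t: "t < R" by (simp add: Ks0_def)
    have Kt: "Ks0 ! t = (\<lambda>b a. if b = a then cc ((fst (dec 0 a) + t) mod R) else 0)"
    proof -
      have "[0..<R] ! t = t" "t < length [0..<R]" using t by auto
      then show ?thesis unfolding Ks0_def by (simp only: nth_map)
    qed
    define ut where "ut = (\<lambda>x. if x \<in> idxs ds then cc ((fst (dec 0 (x ! 0)) + t) mod R) * u x else 0)"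
    have uton: "vec_on ds ut" by (simp add: vec_on_def ut_def)
    have "local_app ds 0 (ds ! 0) (Ks0 ! t) u = ut"
    proof
      fix y
      show "local_app ds 0 (ds ! 0) (Ks0 ! t) u y = ut y"
      proof (cases "y \<in> idxs ds")
        case True
        have y0: "y ! 0 < ds ! 0" using True len k by (simp add: idxsD)
        have "local_app ds 0 (ds ! 0) (Ks0 ! t) u y = (\<Sum>a<ds ! 0. (if y ! 0 = a then cc ((fst (dec 0 a) + t) mod R) else 0) * u (y[0 := a]))"
          using True by (simp add: local_app_def Kt)
        also have "\<dots> = (\<Sum>a<ds ! 0. if a = y ! 0 then cc ((fst (dec 0 a) + t) mod R) * u (y[0 := a]) else 0)"
          by (intro sum.cong) auto
        also have "\<dots> = ut y" using y0 True by (simp add: ut_def)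
        finally show ?thesis .
      qed (simp add: local_app_def ut_def)
    qed
    moreover have "reach ds ut es (\<lambda>z. \<exists>b. z = (\<lambda>x. b * out x))"
    proof -
      \<comment> \<open>In one step each party rewrites its label into the target basis by
        \<open>f\<close> and measures the number \<open>M\<close> of the shared label in the Fourier
        basis.\<close>
      define f where "f = (\<lambda>i a. \<iota> i (sel ((fst (dec i a) + t) mod R)) (snd (dec i a)))"
      define M where "M = (\<lambda>i a. N ((fst (dec i a) + t) mod R))"
      define Ks where "Ks = (\<lambda>i::nat. map (\<lambda>\<tau> b a. if b = f i a then ph Q \<tau> (M i a) / complex_of_real (sqrt (real Q)) else 0) [0..<Q])"
      have fin_es: "f i a < es ! i" if "i < k" "a < ds ! i" for i a
        using that \<iota>[OF that(1) selS] decin[OF that] by (simp add: f_def)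
      have MQ: "M i a < Q" for i a using NQ[OF modR] by (simp add: M_def)
      show ?thesis
      proof (rule reach_par[where es = es and Ks = Ks])
        show "length es = length ds" using les len by simp
        show "vec_on ds ut" by (rule uton)
        fix i assume "i < length ds"
        then have i: "i < k" using len by simp
        show "local_instr (ds ! i) (es ! i) (Ks i)"
          unfolding local_instr_def
        proof (intro allI impI)
          fix a b assume ab: "a < ds ! i" "b < ds ! i"
          have "(\<Sum>K\<leftarrow>Ks i. \<Sum>z<es ! i. cnj (K z a) * K z b)
             = (\<Sum>\<tau><Q. \<Sum>z<es ! i. cnj (if z = f i a then ph Q \<tau> (M i a) / complex_of_real (sqrt (real Q)) else 0)
                 * (if z = f i b then ph Q \<tau> (M i b) / complex_of_real (sqrt (real Q)) else 0))"
            by (simp add: Ks_def o_def interv_sum_list_conv_sum_set_nat atLeast0LessThan)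
          also have "\<dots> = (\<Sum>\<tau><Q. \<Sum>z<es ! i. if z = f i a then (if f i a = f i b then cnj (ph Q \<tau> (M i a)) * ph Q \<tau> (M i b) / of_nat Q else 0) else 0)"
          proof (intro sum.cong refl)
            fix \<tau> z
            have "complex_of_real (sqrt (real Q)) * complex_of_real (sqrt (real Q)) = of_nat Q"
              by (simp add: of_real_mult[symmetric] del: of_real_mult)
            then show "cnj (if z = f i a then ph Q \<tau> (M i a) / complex_of_real (sqrt (real Q)) else 0)
                 * (if z = f i b then ph Q \<tau> (M i b) / complex_of_real (sqrt (real Q)) else 0)
               = (if z = f i a then (if f i a = f i b then cnj (ph Q \<tau> (M i a)) * ph Q \<tau> (M i b) / of_nat Q else 0) else 0)"
              by auto
          qed
          also have "\<dots> = (if f i a = f i b then (\<Sum>\<tau><Q. cnj (ph Q \<tau> (M i a)) * ph Q \<tau> (M i b)) / of_nat Q else 0)"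
            using fin_es[OF i ab(1)] by (simp add: sum_divide_distrib)
          also have "\<dots> = (if f i a = f i b \<and> M i a = M i b then 1 else 0)"
            unfolding ph_orthogonal[OF MQ MQ] using Q0 by simp
          also have "\<dots> = (if a = b then 1 else 0)"
          proof -
            have "a = b" if e: "f i a = f i b" "M i a = M i b"
            proof -
              have "(fst (dec i a) + t) mod R = (fst (dec i b) + t) mod R"
                using e(2) Ninj[OF modR modR] by (simp add: M_def)
              then have m: "(t + fst (dec i a)) mod R = (t + fst (dec i b)) mod R" by (simp add: add.commute)
              have 1: "fst (dec i a) = fst (dec i b)"
                by (rule add_mod_cancel[OF decin(1)[OF i ab(1)] decin(1)[OF i ab(2)] m])
              have "\<iota> i (sel ((fst (dec i b) + t) mod R)) (snd (dec i a)) = \<iota> i (sel ((fst (dec i b) + t) mod R)) (snd (dec i b))"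
                using e(1) unfolding f_def 1 .
              then have "snd (dec i a) = snd (dec i b)"
                by (rule inj_onD[OF inj[OF i selS] _ decin(2)[OF i ab(1)] decin(2)[OF i ab(2)]])
              with 1 have "dec i a = dec i b" by (simp add: prod_eq_iff)
              then show "a = b"
                by (rule inj_onD[OF bij_betw_imp_inj_on[OF bij[OF i]]]) (use ab in auto)
            qed
            then show ?thesis by auto
          qed
          finally show "(\<Sum>K\<leftarrow>Ks i. \<Sum>z<es ! i. cnj (K z a) * K z b) = (if a = b then 1 else 0)" .
        qed
      next
        fix \<tau> assume \<tau>': "\<And>i. i < length ds \<Longrightarrow> \<tau> i < length (Ks i)"
        then have \<tau>: "\<tau> i < Q" if "i < k" for i using that len by (simp add: Ks_def)
        have K\<tau>: "Ks i ! \<tau> i = (\<lambda>b a. if b = f i a then ph Q (\<tau> i) (M i a) / complex_of_real (sqrt (real Q)) else 0)"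
          if "i < k" for i
        proof -
          have "[0..<Q] ! \<tau> i = \<tau> i" "\<tau> i < length [0..<Q]" using \<tau>[OF that] by auto
          then show ?thesis unfolding Ks_def by (simp only: nth_map)
        qed
        define z where "z = prod_app ds es (\<lambda>i. Ks i ! \<tau> i) ut"
        have zon: "vec_on es z" by (simp add: z_def vec_on_prod_app)
        \<comment> \<open>All parties hold the same number in a given term, so their phases multiply
          to the character of the total outcome \<open>W\<close>. Knowing \<open>W\<close>, party
          \<open>i\<close> undoes its summand \<open>g i\<close> of that number.\<close>
        define W where "W = (\<Sum>i<k. \<tau> i)"
        define C where "C = (\<lambda>i::nat. [\<lambda>b a. if b = a then cnj (ph Q W (g i a)) else 0])"
        have zy: "z y = (\<Sum>x\<in>{x\<in>idxs ds. lmap f x = y}. (\<Prod>i<k. ph Q (\<tau> i) (M i (x ! i)) / complex_of_real (sqrt (real Q))) * ut x)"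
          if "y \<in> idxs es" for y
          unfolding z_def using that les len
          by (subst prod_app_monomial[where f = f and \<theta> = "\<lambda>i a. ph Q (\<tau> i) (M i a) / complex_of_real (sqrt (real Q))"])
             (auto simp: K\<tau>)
        \<comment> \<open>After the correction the scalar depends on no outcome.\<close>
        define r where "r = 1 / (complex_of_real (sqrt (real Q)) ^ k * complex_of_real (sqrt (real R)))"
        show "reach es (prod_app ds es (\<lambda>i. Ks i ! \<tau> i) ut) es (\<lambda>z. \<exists>b. z = (\<lambda>x. b * out x))"
          unfolding z_def[symmetric]
        proof (rule reach_par[where es = es and Ks = C])
          fix i assume "i < length es"
          show "local_instr (es ! i) (es ! i) (C i)"
            unfolding local_instr_def
          proof (intro allI impI)
            fix a b assume ab: "a < es ! i" "b < es ! i"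
            have "(\<Sum>K\<leftarrow>C i. \<Sum>z<es ! i. cnj (K z a) * K z b)
               = (\<Sum>z<es ! i. cnj (if z = a then cnj (ph Q W (g i a)) else 0) * (if z = b then cnj (ph Q W (g i b)) else 0))"
              by (simp add: C_def)
            also have "\<dots> = (\<Sum>z<es ! i. if z = a then (if a = b then 1 else 0) else 0)"
              by (intro sum.cong refl) (auto simp: mult.commute[of "ph _ _ _"] cnj_ph_mult)
            finally show "(\<Sum>K\<leftarrow>C i. \<Sum>z<es ! i. cnj (K z a) * K z b) = (if a = b then 1 else 0)" using ab by simp
          qed
        next
          fix \<sigma> assume "\<And>i. i < length es \<Longrightarrow> \<sigma> i < length (C i)"
          then have \<sigma>: "\<sigma> i = 0" if "i < k" for i using that les by (simp add: C_def)
          have "prod_app es es (\<lambda>i. C i ! \<sigma> i) z = (\<lambda>y. r * out y)"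
          proof
            fix y
            show "prod_app es es (\<lambda>i. C i ! \<sigma> i) z y = r * out y"
            proof (cases "y \<in> idxs es")
              case y: True
              have idl: "lmap (\<lambda>i a. a) x = x" for x by (simp add: lmap_def map_nth)
              have "prod_app es es (\<lambda>i. C i ! \<sigma> i) z y = (\<Sum>x\<in>{x\<in>idxs es. lmap (\<lambda>i a. a) x = y}. (\<Prod>i<k. cnj (ph Q W (g i (x ! i)))) * z x)"
                using y les \<sigma> by (subst prod_app_monomial[where f = "\<lambda>i a. a" and \<theta> = "\<lambda>i a. cnj (ph Q W (g i a))"]) (auto simp: C_def)
              also have "{x\<in>idxs es. lmap (\<lambda>i a. a) x = y} = {y}" using y by (auto simp: idl)
              finally have "prod_app es es (\<lambda>i. C i ! \<sigma> i) z y = (\<Prod>i<k. cnj (ph Q W (g i (y ! i)))) * z y" by simp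
              also have "\<dots> = (\<Sum>x\<in>{x\<in>idxs ds. lmap f x = y}. ut x / complex_of_real (sqrt (real Q)) ^ k)"
                unfolding zy[OF y] sum_distrib_left
              proof (rule sum.cong[OF refl])
                fix x assume "x \<in> {x\<in>idxs ds. lmap f x = y}"
                then have x: "x \<in> idxs ds" "lmap f x = y" by auto
                show "(\<Prod>i<k. cnj (ph Q W (g i (y ! i)))) * ((\<Prod>i<k. ph Q (\<tau> i) (M i (x ! i)) / complex_of_real (sqrt (real Q))) * ut x)
                   = ut x / complex_of_real (sqrt (real Q)) ^ k"
                proof (cases "ut x = 0")
                  case False
                  define s' where "s' = (fst (dec 0 (x ! 0)) + t) mod R"
                  have nz: "cc s' \<noteq> 0" "u x \<noteq> 0" using False x by (auto simp: ut_def s'_def)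
                  have diag: "fst (dec i (x ! i)) = fst (dec 0 (x ! 0))" if "i < k" for i
                  proof -
                    have "\<forall>i<k. fst (fam k dec x i) = fst (fam k dec x 0)"
                    proof (rule ccontr)
                      assume n: "\<not> ?thesis"
                      have "u x = 0" unfolding ux[OF x(1)] if_not_P[OF n] ..
                      with nz(2) show False ..
                    qed
                    then have "fst (fam k dec x i) = fst (fam k dec x 0)" using that by blast
                    then show ?thesis using that k by (simp add: fam_def)
                  qed
                  have s'S: "s' < card S" using nz(1) by (auto simp: cc_def split: if_splits)
                  define a where "a = (\<lambda>i\<in>{..<k}. snd (dec i (x ! i)))"
                  have aP: "a \<in> PiE {..<k} A" using decin(2) x(1) len by (auto simp: a_def idxs_def)
                  have yi: "y ! i = \<iota> i (en s') (a i)" if "i < k" for i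
                    using x len that diag[OF that] s'S unfolding x(2)[symmetric]
                    by (simp add: idxs_length f_def sel_def s'_def[symmetric] a_def)
                  have Ns: "N s' = (\<Sum>i<k. g i (y ! i))"
                  proof -
                    have "N s' = N0 (en s')" using s'S by (simp add: N_def)
                    also have "\<dots> = (\<Sum>i<k. g i (\<iota> i (en s') (a i)))"
                      using N0(2)[OF bij_betw_apply[OF en] aP] s'S by simp
                    also have "\<dots> = (\<Sum>i<k. g i (y ! i))" by (intro sum.cong refl) (simp add: yi)
                    finally show ?thesis .
                  qed
                  have Mi: "M i (x ! i) = N s'" if "i < k" for i
                    unfolding M_def s'_def by (simp only: diag[OF that])
                  have p1: "(\<Prod>i<k. cnj (ph Q W (g i (y ! i)))) = cnj (ph Q W (N s'))"
                    unfolding Ns by (simp add: ph_sum_right)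
                  have p2: "(\<Prod>i<k. ph Q (\<tau> i) (M i (x ! i)) / complex_of_real (sqrt (real Q))) = ph Q W (N s') / complex_of_real (sqrt (real Q)) ^ k"
                  proof -
                    have "(\<Prod>i<k. ph Q (\<tau> i) (M i (x ! i)) / complex_of_real (sqrt (real Q))) = (\<Prod>i<k. ph Q (\<tau> i) (N s') / complex_of_real (sqrt (real Q)))"
                      by (intro prod.cong refl) (simp add: Mi)
                    then show ?thesis by (simp add: W_def ph_sum_left prod_dividef)
                  qed
                  have p3: "cnj (ph Q W (N s')) * (ph Q W (N s') / complex_of_real (sqrt (real Q)) ^ k * ut x)
                      = (cnj (ph Q W (N s')) * ph Q W (N s')) * ut x / complex_of_real (sqrt (real Q)) ^ k" by simp
                  show ?thesis unfolding p1 p2 p3 cnj_ph_mult by simp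
                qed simp
              qed
              also have "\<dots> = (\<Sum>x\<in>{x\<in>idxs ds. lmap f x = y}. ut x) / complex_of_real (sqrt (real Q)) ^ k"
                by (simp add: sum_divide_distrib)
              also have "(\<Sum>x\<in>{x\<in>idxs ds. lmap f x = y}. ut x) = out y / complex_of_real (sqrt (real R))"
              proof -
                let ?G = "\<lambda>s a. if lab (sel s) a = y then cc s * \<xi> a / complex_of_real (sqrt (real R)) else 0"
                have "(\<Sum>x\<in>{x\<in>idxs ds. lmap f x = y}. ut x) = (\<Sum>x\<in>idxs ds. if lmap f x = y then ut x else 0)"
                  by (simp add: sum.inter_filter)
                also have "\<dots> = (\<Sum>x\<in>idxs ds. if \<forall>i<k. fst (fam k dec x i) = fst (fam k dec x 0)
                    then ?G ((fst (fam k dec x 0) + t) mod R) (\<lambda>i\<in>{..<k}. snd (fam k dec x i)) else 0)"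
                proof (rule sum.cong[OF refl])
                  fix x assume x: "x \<in> idxs ds"
                  show "(if lmap f x = y then ut x else 0) = (if \<forall>i<k. fst (fam k dec x i) = fst (fam k dec x 0)
                    then ?G ((fst (fam k dec x 0) + t) mod R) (\<lambda>i\<in>{..<k}. snd (fam k dec x i)) else 0)"
                  proof (cases "\<forall>i<k. fst (fam k dec x i) = fst (fam k dec x 0)")
                    case True
                    have lx: "length x = k" using x len by (simp add: idxs_def)
                    have diag: "fst (dec i (x ! i)) = fst (dec 0 (x ! 0))" if "i < k" for i
                    proof -
                      have "fst (fam k dec x i) = fst (fam k dec x 0)" using True that by blast
                      then show ?thesis using that k by (simp add: fam_def)
                    qed
                    have L: "lmap f x = lab (sel ((fst (fam k dec x 0) + t) mod R)) (\<lambda>i\<in>{..<k}. snd (fam k dec x i))"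
                    proof (rule nth_equalityI)
                      fix i assume "i < length (lmap f x)"
                      then have i: "i < k" using lx by simp
                      show "lmap f x ! i = lab (sel ((fst (fam k dec x 0) + t) mod R)) (\<lambda>i\<in>{..<k}. snd (fam k dec x i)) ! i"
                        using i lx k by (simp add: lab_def f_def fam_def diag[OF i])
                    qed (simp add: lab_def lx)
                    have U: "ut x = cc ((fst (fam k dec x 0) + t) mod R) * \<xi> (\<lambda>i\<in>{..<k}. snd (fam k dec x i)) / complex_of_real (sqrt (real R))"
                      unfolding ut_def if_P[OF x] ux[OF x] if_P[OF True] using k by (simp add: fam_def)
                    show ?thesis unfolding L U if_P[OF True] by (rule refl)
                  next
                    case False
                    have "u x = 0" unfolding ux[OF x] if_not_P[OF False] ..
                    then show ?thesis unfolding if_not_P[OF False] by (simp add: ut_def)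
                  qed
                qed
                also have "\<dots> = (\<Sum>s<R. \<Sum>a\<in>PiE {..<k} A. ?G ((s + t) mod R) a)"
                  by (rule diag_sum)
                also have "\<dots> = (\<Sum>s<R. \<Sum>a\<in>PiE {..<k} A. ?G s a)"
                  unfolding add.commute[of _ t]
                  by (rule sum_lessThan_mod_shift[where F = "\<lambda>s. \<Sum>a\<in>PiE {..<k} A. ?G s a"])
                also have "\<dots> = (\<Sum>s<R. if s < card S then (\<lambda>s. \<Sum>a\<in>PiE {..<k} A. if lab s a = y then c s * \<xi> a / complex_of_real (sqrt (real R)) else 0) (en s) else 0)"
                  by (rule sum.cong[OF refl]) (simp add: sel_def cc_def cong: if_cong)
                also have "\<dots> = (\<Sum>s\<in>S. \<Sum>a\<in>PiE {..<k} A. if lab s a = y then c s * \<xi> a / complex_of_real (sqrt (real R)) else 0)"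
                  by (rule sumS)
                also have "\<dots> = out y / complex_of_real (sqrt (real R))"
                  unfolding out_def sum_divide_distrib by (intro sum.cong refl) auto
                finally show ?thesis .
              qed
              finally show ?thesis by (simp add: r_def field_simps)
            qed (use outon in \<open>simp add: vec_on_def prod_app_def\<close>)
          qed
          then show "reach es (prod_app es es (\<lambda>i. C i ! \<sigma> i) z) es (\<lambda>z. \<exists>b. z = (\<lambda>x. b * out x))"
            by (intro reach_id) (use outon in \<open>auto simp: vec_on_def\<close>)
        qed (use zon in auto)
      qed
    qed
    ultimately show "reach (ds[0 := ds ! 0]) (local_app ds 0 (ds ! 0) (Ks0 ! t) u) es (\<lambda>z. \<exists>b. z = (\<lambda>x. b * out x))"
      by simp
  qed
  then show ?thesis using outst \<xi>1 ipout unfolding lab_def by blast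
qed

section \<open>Typical subsets\<close>

lemma sum_Pow_card:
  fixes F :: "nat \<Rightarrow> real"
  assumes "finite J"
  shows "(\<Sum>S\<in>Pow J. F (card S)) = (\<Sum>m\<le>card J. real (card J choose m) * F m)"
proof -
  have "(\<Sum>S\<in>Pow J. F (card S)) = (\<Sum>m\<le>card J. \<Sum>S\<in>{S\<in>Pow J. card S = m}. F (card S))"
    using assms by (intro sum.group[symmetric]) (auto intro: card_mono)
  also have "\<dots> = (\<Sum>m\<le>card J. \<Sum>S\<in>{S. S \<subseteq> J \<and> card S = m}. F m)"
    by (intro sum.cong refl) auto
  also have "\<dots> = (\<Sum>m\<le>card J. real (card J choose m) * F m)"
    by (simp add: n_subsets[OF assms])
  finally show ?thesis .
qed

text \<open>The square is expanded in m(m-1), m and 1, whose Bernstein sums are known.\<close>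

lemma sum_Bernstein_variance:
  "(\<Sum>m\<le>n. (real m - real n * p)\<^sup>2 * Bernstein n m p) = real n * p * (1 - p)"
proof -
  have "(\<Sum>m\<le>n. (real m - real n * p)\<^sup>2 * Bernstein n m p)
      = (\<Sum>m\<le>n. real m * (real m - 1) * Bernstein n m p + (1 - 2 * real n * p) * (real m * Bernstein n m p)
          + (real n * p)\<^sup>2 * Bernstein n m p)"
    by (intro sum.cong refl) (simp add: power2_eq_square algebra_simps)
  also have "\<dots> = real n * (real n - 1) * p\<^sup>2 + (1 - 2 * real n * p) * (real n * p) + (real n * p)\<^sup>2"
    by (simp add: sum.distrib sum_distrib_left[symmetric])
  also have "\<dots> = real n * p * (1 - p)" by (simp add: power2_eq_square algebra_simps)
  finally show ?thesis .
qed

text \<open>\<open>J\<close> stands for the tensor positions in a power of the direct sum and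
  \<open>S\<close> for those lying in the first block. The \<open>weight\<close> of such a pattern
  is its total squared amplitude.\<close>

definition window :: "'a set \<Rightarrow> real \<Rightarrow> real \<Rightarrow> 'a set set" where
  "window J p \<eta> = {S\<in>Pow J. \<bar>real (card S) - real (card J) * p\<bar> \<le> \<eta> * real (card J)}"

definition weight :: "'a set \<Rightarrow> real \<Rightarrow> 'a set \<Rightarrow> real" where
  "weight J p S = p ^ card S * (1 - p) ^ (card J - card S)"

lemma finite_window: "finite J \<Longrightarrow> finite (window J p \<eta>)"
  by (simp add: window_def)

lemma weight_nonneg: "0 \<le> p \<Longrightarrow> p \<le> 1 \<Longrightarrow> 0 \<le> weight J p S"
  by (simp add: weight_def)

lemma sum_weight_Pow: "finite J \<Longrightarrow> (\<Sum>S\<in>Pow J. weight J p S) = 1"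
proof -
  assume J: "finite J"
  have "(\<Sum>S\<in>Pow J. weight J p S) = (\<Sum>m\<le>card J. Bernstein (card J) m p)"
    unfolding weight_def by (subst sum_Pow_card[OF J]) (simp add: Bernstein_def mult.assoc)
  then show ?thesis by simp
qed

lemma sum_weight_window_le:
  assumes "finite J" "0 \<le> p" "p \<le> 1"
  shows "(\<Sum>S\<in>window J p \<eta>. weight J p S) \<le> 1"
proof -
  have "(\<Sum>S\<in>window J p \<eta>. weight J p S) \<le> (\<Sum>S\<in>Pow J. weight J p S)"
    using assms by (intro sum_mono2) (auto simp: window_def weight_nonneg)
  then show ?thesis using sum_weight_Pow assms by metis
qed

text \<open>Chebyshev's inequality for the number of positions in the first block.\<close>

lemma sum_weight_window_ge:
  assumes J: "finite J" "0 < card J" and p: "0 \<le> p" "p \<le> 1" and \<eta>: "0 < \<eta>"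
  shows "1 - p * (1 - p) / (\<eta>\<^sup>2 * real (card J)) \<le> (\<Sum>S\<in>window J p \<eta>. weight J p S)"
proof -
  let ?n = "real (card J)"
  have split: "(\<Sum>S\<in>Pow J. weight J p S) = (\<Sum>S\<in>window J p \<eta>. weight J p S) + (\<Sum>S\<in>Pow J - window J p \<eta>. weight J p S)"
    using J by (subst sum.subset_diff[of "window J p \<eta>"]) (auto simp: window_def)
  have "(\<Sum>S\<in>Pow J - window J p \<eta>. weight J p S) \<le> (\<Sum>S\<in>Pow J - window J p \<eta>. (real (card S) - ?n * p)\<^sup>2 / (\<eta> * ?n)\<^sup>2 * weight J p S)"
  proof (rule sum_mono)
    fix S assume "S \<in> Pow J - window J p \<eta>"
    then have "\<eta> * ?n < \<bar>real (card S) - ?n * p\<bar>" by (auto simp: window_def)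
    then have "(\<eta> * ?n)\<^sup>2 \<le> \<bar>real (card S) - ?n * p\<bar>\<^sup>2" using \<eta> by (intro power_mono) auto
    moreover have "0 < \<eta> * ?n" using \<eta> J by simp
    ultimately have "1 \<le> (real (card S) - ?n * p)\<^sup>2 / (\<eta> * ?n)\<^sup>2"
      using J \<eta> by (subst le_divide_eq_1_pos) auto
    then have "1 * weight J p S \<le> (real (card S) - ?n * p)\<^sup>2 / (\<eta> * ?n)\<^sup>2 * weight J p S"
      using weight_nonneg[OF p] by (rule mult_right_mono)
    then show "weight J p S \<le> (real (card S) - ?n * p)\<^sup>2 / (\<eta> * ?n)\<^sup>2 * weight J p S" by simp
  qed
  also have "\<dots> \<le> (\<Sum>S\<in>Pow J. (real (card S) - ?n * p)\<^sup>2 / (\<eta> * ?n)\<^sup>2 * weight J p S)"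
    using J weight_nonneg[OF p] by (intro sum_mono2) (auto intro!: divide_nonneg_nonneg mult_nonneg_nonneg)
  also have "\<dots> = (\<Sum>S\<in>Pow J. (real (card S) - ?n * p)\<^sup>2 * (p ^ card S * (1 - p) ^ (card J - card S))) / (\<eta> * ?n)\<^sup>2"
    by (simp add: sum_divide_distrib weight_def)
  also have "(\<Sum>S\<in>Pow J. (real (card S) - ?n * p)\<^sup>2 * (p ^ card S * (1 - p) ^ (card J - card S)))
     = (\<Sum>m\<le>card J. (real m - ?n * p)\<^sup>2 * Bernstein (card J) m p)"
    by (subst sum_Pow_card[OF J(1), of "\<lambda>m. (real m - ?n * p)\<^sup>2 * (p ^ m * (1 - p) ^ (card J - m))"]) (simp add: Bernstein_def ac_simps)
  also have "\<dots> / (\<eta> * ?n)\<^sup>2 = p * (1 - p) / (\<eta>\<^sup>2 * ?n)"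
  proof -
    have "n * p * (1 - p) / (\<eta> * n)\<^sup>2 = p * (1 - p) / (\<eta>\<^sup>2 * n)" if "0 < n" for n
      using \<eta> that by (simp add: field_simps power2_eq_square)
    then show ?thesis unfolding sum_Bernstein_variance using J by simp
  qed
  finally show ?thesis using split sum_weight_Pow[OF J(1), of p] by simp
qed

lemma two_powr_log: "0 < x \<Longrightarrow> 2 powr (real m * log 2 x) = x ^ m"
  using exp_of_nat_mult[of m "ln x"] by (simp add: powr_def log_def)

text \<open>A typical pattern has weight at least 2^(-e), with e the exponent on the right, and the
  total weight is at most 1. The excess over the entropy is the frequency error \<eta> times the
  slope log p - log (1-p), bounded by the sum of the absolute values.\<close>

lemma card_window_le:
  assumes J: "finite J" and p: "0 < p" "p < 1"
  shows "real (card (window J p \<eta>)) \<le> 2 powr (real (card J) * (h p + \<eta> * (\<bar>log 2 p\<bar> + \<bar>log 2 (1 - p)\<bar>)))"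
proof -
  let ?n = "real (card J)"
  let ?C = "\<bar>log 2 p\<bar> + \<bar>log 2 (1 - p)\<bar>"
  let ?e = "?n * (h p + \<eta> * ?C)"
  have "2 powr (- ?e) \<le> weight J p S" if S: "S \<in> window J p \<eta>" for S
  proof -
    let ?m = "card S"
    have m: "?m \<le> card J" using S J by (auto simp: window_def intro: card_mono)
    have w: "weight J p S = 2 powr (real ?m * log 2 p + (?n - real ?m) * log 2 (1 - p))"
    proof -
      have "2 powr (real ?m * log 2 p) = p ^ ?m"
        using p by (intro two_powr_log) auto
      moreover have "2 powr ((?n - real ?m) * log 2 (1 - p)) = (1 - p) ^ (card J - ?m)"
      proof -
        have "?n - real ?m = real (card J - ?m)" using m by simp
        then show ?thesis using p by (simp only:) (intro two_powr_log, simp)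
      qed
      ultimately show ?thesis by (simp add: weight_def powr_add)
    qed
    have "\<bar>(real ?m - ?n * p) * (log 2 p - log 2 (1 - p))\<bar> \<le> (\<eta> * ?n) * ?C"
      unfolding abs_mult using S by (intro mult_mono) (auto simp: window_def)
    then have "- ((\<eta> * ?n) * ?C) \<le> (real ?m - ?n * p) * (log 2 p - log 2 (1 - p))" by linarith
    then have "- ?e \<le> real ?m * log 2 p + (?n - real ?m) * log 2 (1 - p)"
      by (simp add: h_def algebra_simps)
    then show ?thesis unfolding w by (simp add: powr_mono)
  qed
  then have "(\<Sum>S\<in>window J p \<eta>. 2 powr (- ?e)) \<le> (\<Sum>S\<in>window J p \<eta>. weight J p S)" by (rule sum_mono)
  also have "\<dots> \<le> 1" using J p by (intro sum_weight_window_le) auto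
  finally have "real (card (window J p \<eta>)) * 2 powr (- ?e) \<le> 1" by simp
  then have "real (card (window J p \<eta>)) * 2 powr (- ?e) * 2 powr ?e \<le> 1 * 2 powr ?e" by (intro mult_right_mono) auto
  then show ?thesis by (simp add: mult.assoc powr_add[symmetric])
qed

section \<open>Sources and the dimension bound\<close>

lemma rep_cong:
  "rep k ds v A amp \<Longrightarrow> (\<And>f. f \<in> PiE {..<k} A \<Longrightarrow> amp f = amp' f) \<Longrightarrow> rep k ds v A amp'"
  unfolding rep_def by (auto simp: rep_by_def dest: fam_in_PiE[unfolded rep_by_def]) (metis fam_in_PiE rep_by_def)

lemma map_restrict: "map (\<lambda>i\<in>{..<k}. F i) [0..<k] = map F [0..<k]"
  by simp

lemma rep_pow_vec:
  assumes "length ds = k"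
  shows "rep k (fst (tpow n ds v)) (snd (tpow n ds v)) (\<lambda>i. PiE {..<n} (\<lambda>_. {..<ds ! i}))
    (\<lambda>f. \<Prod>t<n. v (map (\<lambda>i. f i t) [0..<k]))"
  using rep_tpow[OF rep_base[OF assms, of v], of n] unfolding map_restrict .

lemma rep_pow_pow_vec:
  assumes "length ds = k"
  shows "rep k (fst (tpow N (fst (tpow n ds v)) (snd (tpow n ds v)))) (snd (tpow N (fst (tpow n ds v)) (snd (tpow n ds v))))
    (\<lambda>i. PiE {..<N} (\<lambda>_. PiE {..<n} (\<lambda>_. {..<ds ! i})))
    (\<lambda>f. \<Prod>t<N. \<Prod>j<n. v (map (\<lambda>i. f i t j) [0..<k]))"
  by (rule rep_cong[OF rep_tpow[OF rep_pow_vec[OF assms, of n v], of N]])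
     (intro prod.cong refl arg_cong[where f = v] map_cong, auto)

lemma bij_PiE_swap:
  "bij_betw (\<lambda>f. (\<lambda>t\<in>I. snd (f t), \<lambda>t\<in>I. fst (f t))) (PiE I (\<lambda>_. A \<times> B)) (PiE I (\<lambda>_. B) \<times> PiE I (\<lambda>_. A))"
proof (rule bij_betw_byWitness[where f' = "\<lambda>(g, f). \<lambda>t\<in>I. (f t, g t)"])
  show "\<forall>f\<in>PiE I (\<lambda>_. A \<times> B). (case (\<lambda>t\<in>I. snd (f t), \<lambda>t\<in>I. fst (f t)) of (g, f) \<Rightarrow> \<lambda>t\<in>I. (f t, g t)) = f"
  proof
    fix f assume f: "f \<in> PiE I (\<lambda>_. A \<times> B)"
    show "(case (\<lambda>t\<in>I. snd (f t), \<lambda>t\<in>I. fst (f t)) of (g, f) \<Rightarrow> \<lambda>t\<in>I. (f t, g t)) = f"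
      using PiE_arb[OF f] by (intro ext) auto
  qed
  show "\<forall>z\<in>PiE I (\<lambda>_. B) \<times> PiE I (\<lambda>_. A). (\<lambda>t\<in>I. snd ((case z of (g, f) \<Rightarrow> \<lambda>t\<in>I. (f t, g t)) t), \<lambda>t\<in>I. fst ((case z of (g, f) \<Rightarrow> \<lambda>t\<in>I. (f t, g t)) t)) = z"
  proof clarify
    fix g f assume gf: "g \<in> PiE I (\<lambda>_. B)" "f \<in> PiE I (\<lambda>_. A)"
    have "(\<lambda>t\<in>I. snd ((\<lambda>t\<in>I. (f t, g t)) t)) = g" using PiE_arb[OF gf(1)] by (intro ext) auto
    moreover have "(\<lambda>t\<in>I. fst ((\<lambda>t\<in>I. (f t, g t)) t)) = f" using PiE_arb[OF gf(2)] by (intro ext) auto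
    ultimately show "(\<lambda>t\<in>I. snd ((\<lambda>t\<in>I. (f t, g t)) t)) = g \<and> (\<lambda>t\<in>I. fst ((\<lambda>t\<in>I. (f t, g t)) t)) = f" by blast
  qed
  show "(\<lambda>f. (\<lambda>t\<in>I. snd (f t), \<lambda>t\<in>I. fst (f t))) ` PiE I (\<lambda>_. A \<times> B) \<subseteq> PiE I (\<lambda>_. B) \<times> PiE I (\<lambda>_. A)"
  proof clarify
    fix f assume f: "f \<in> PiE I (\<lambda>_. A \<times> B)"
    have "snd (f t) \<in> B" "fst (f t) \<in> A" if "t \<in> I" for t using PiE_mem[OF f that] by auto
    then show "(\<lambda>t\<in>I. snd (f t)) \<in> PiE I (\<lambda>_. B) \<and> (\<lambda>t\<in>I. fst (f t)) \<in> PiE I (\<lambda>_. A)" by auto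
  qed
  show "(\<lambda>(g, f). \<lambda>t\<in>I. (f t, g t)) ` (PiE I (\<lambda>_. B) \<times> PiE I (\<lambda>_. A)) \<subseteq> PiE I (\<lambda>_. A \<times> B)"
  proof clarify
    fix g f assume gf: "g \<in> PiE I (\<lambda>_. B)" "f \<in> PiE I (\<lambda>_. A)"
    show "(\<lambda>t\<in>I. (f t, g t)) \<in> PiE I (\<lambda>_. A \<times> B)" using PiE_mem[OF gf(1)] PiE_mem[OF gf(2)] by auto
  qed
qed

text \<open>All branches are multiples of \<open>out\<close>, so the averaged output is the pure
  state \<open>out\<close>, and the error is its purified distance from \<open>w\<close>.\<close>

lemma reach_eps_conv:
  assumes "reach ds v es (\<lambda>z. \<exists>b. z = (\<lambda>x. b * out x))"
    and v: "is_state k ds v" and out: "is_state k es out" and w: "is_state k es w"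
    and e: "sqrt (1 - (cmod (ip es w out))\<^sup>2) \<le> \<epsilon>"
  shows "eps_conv ds (proj ds v) es (proj es w) \<epsilon>"
proof -
  obtain us where ens: "ens ds v es us" and us: "\<forall>u\<in>set us. \<exists>b. u = (\<lambda>x. b * out x)"
    using assms(1) unfolding reach_def by blast
  obtain L where L: "LOCC ds es L" and us_def: "us = map (\<lambda>A. op_vec ds A v) (map snd L)"
    using ens unfolding ens_def by (elim exE conjE) (rule that)
  have each: "(cmod (ip es w u))\<^sup>2 = sqn es u * (cmod (ip es w out))\<^sup>2" if u: "u \<in> set us" for u
  proof -
    obtain b where b: "u = (\<lambda>x. b * out x)" using bspec[OF us u] by blast
    have "ip es w u = b * ip es w out" unfolding b ip_def sum_distrib_left by (intro sum.cong) auto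
    moreover have "sqn es u = (cmod b)\<^sup>2" unfolding b sqn_scale using out by (simp add: is_state_iff)
    ultimately show ?thesis by (simp add: norm_mult power_mult_distrib)
  qed
  have tot: "(\<Sum>u\<leftarrow>us. sqn es u) = 1" using ens_sqn[OF ens] v by (simp add: is_state_iff)
  have "(\<Sum>u\<leftarrow>us. (cmod (ip es w u))\<^sup>2) = (\<Sum>u\<leftarrow>us. sqn es u * (cmod (ip es w out))\<^sup>2)"
    using each by (intro arg_cong[where f = sum_list] map_cong) auto
  also have "\<dots> = (cmod (ip es w out))\<^sup>2" using tot by (simp add: sum_list_mult_const)
  finally have "pdist es (channel_out ds L (proj ds v)) (proj es w) = sqrt (1 - (cmod (ip es w out))\<^sup>2)"
    using pdist_ens[of es w ds L v] w by (simp add: us_def is_state_iff)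
  then show ?thesis using L e unfolding eps_conv_def by auto
qed

context ent_measure
begin

text \<open>Copies of the GHZ state form one state of the same kind with 2^c labels: all parties
  hold the same bit string.\<close>

lemma rep_ghz_pow:
  "rep k (fst (tpow c (ghz_dims k) (ghz_vec k))) (snd (tpow c (ghz_dims k) (ghz_vec k)))
    (\<lambda>i. PiE {..<c} (\<lambda>_. {..<2::nat})) (\<lambda>f. if \<forall>i<k. f i = f 0 then complex_of_real (1 / sqrt (2 ^ c)) else 0)"
proof -
  have len: "length (ghz_dims k) = k" by (simp add: ghz_dims_def)
  have 1: "rep k (fst (tpow c (ghz_dims k) (ghz_vec k))) (snd (tpow c (ghz_dims k) (ghz_vec k)))
    (\<lambda>i. PiE {..<c} (\<lambda>_. {..<2::nat})) (\<lambda>f. \<Prod>t<c. ghz_vec k (map (\<lambda>i. f i t) [0..<k]))"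
    by (rule rep_map[OF rep_pow_vec[OF len], where \<beta> = "\<lambda>_ f. f"])
       (auto simp: ghz_dims_def bij_betw_def intro!: prod.cong arg_cong[where f = "ghz_vec k"])
  show ?thesis
  proof (rule rep_cong[OF 1])
    fix f :: "nat \<Rightarrow> nat \<Rightarrow> nat" assume f: "f \<in> PiE {..<k} (\<lambda>i. PiE {..<c} (\<lambda>_. {..<2::nat}))"
    have f2: "f i t < 2" if "i < k" "t < c" for i t
    proof -
      have "f i \<in> PiE {..<c} (\<lambda>_. {..<2})" using PiE_mem[OF f, of i] that by simp
      from PiE_mem[OF this, of t] show ?thesis using that by simp
    qed
    have g: "ghz_vec k (map (\<lambda>i. f i t) [0..<k]) = (if \<forall>i<k. f i t = f 0 t then complex_of_real (1 / sqrt 2) else 0)"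
      if t: "t < c" for t
    proof -
      have "map (\<lambda>i. f i t) [0..<k] = replicate k 0 \<or> map (\<lambda>i. f i t) [0..<k] = replicate k 1 \<longleftrightarrow> (\<forall>i<k. f i t = f 0 t)"
      proof
        assume *: "map (\<lambda>i. f i t) [0..<k] = replicate k 0 \<or> map (\<lambda>i. f i t) [0..<k] = replicate k 1"
        then consider "\<forall>i<k. f i t = 0" | "\<forall>i<k. f i t = 1" by (auto simp: list_eq_iff_nth_eq)
        then show "\<forall>i<k. f i t = f 0 t" using k_pos by cases metis+
      next
        assume *: "\<forall>i<k. f i t = f 0 t"
        have "f 0 t = 0 \<or> f 0 t = 1" using f2[OF k_pos t] by auto
        then show "map (\<lambda>i. f i t) [0..<k] = replicate k 0 \<or> map (\<lambda>i. f i t) [0..<k] = replicate k 1"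
        proof
          assume "f 0 t = 0"
          then have "\<forall>i<k. f i t = 0" using * by metis
          then show ?thesis by (auto simp: list_eq_iff_nth_eq)
        next
          assume "f 0 t = 1"
          then have "\<forall>i<k. f i t = 1" using * by metis
          then show ?thesis by (auto simp: list_eq_iff_nth_eq)
        qed
      qed
      then show ?thesis by (simp only: ghz_vec_def)
    qed
    have "(\<Prod>t<c. ghz_vec k (map (\<lambda>i. f i t) [0..<k])) = (\<Prod>t<c. if \<forall>i<k. f i t = f 0 t then complex_of_real (1 / sqrt 2) else 0)"
      by (rule prod.cong[OF refl]) (rule g, simp)
    also have "\<dots> = (if \<forall>t<c. \<forall>i<k. f i t = f 0 t then \<Prod>t<c. complex_of_real (1 / sqrt 2) else 0)"
      by (rule prod_monomial)
    also have "(\<forall>t<c. \<forall>i<k. f i t = f 0 t) \<longleftrightarrow> (\<forall>i<k. f i = f 0)"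
    proof
      assume *: "\<forall>t<c. \<forall>i<k. f i t = f 0 t"
      show "\<forall>i<k. f i = f 0"
      proof (intro allI impI)
        fix i assume i: "i < k"
        have "f i \<in> PiE {..<c} (\<lambda>_. {..<2})" "f 0 \<in> PiE {..<c} (\<lambda>_. {..<2})"
          using PiE_mem[OF f, of i] PiE_mem[OF f, of 0] i k_pos by auto
        then show "f i = f 0" by (rule PiE_ext) (use * i in blast)
      qed
    next
      assume "\<forall>i<k. f i = f 0"
      then show "\<forall>t<c. \<forall>i<k. f i t = f 0 t" by metis
    qed
    also have "(\<Prod>t<c. complex_of_real (1 / sqrt 2)) = complex_of_real (1 / sqrt (2 ^ c))"
      by (simp add: power_divide real_sqrt_power)
    finally show "(\<Prod>t<c. ghz_vec k (map (\<lambda>i. f i t) [0..<k])) = (if \<forall>i<k. f i = f 0 then complex_of_real (1 / sqrt (2 ^ c)) else 0)" .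
  qed
qed

section \<open>Sources: a state supplemented by GHZ states\<close>

definition src_dims :: "nat \<Rightarrow> nat list \<Rightarrow> nat list" where
  "src_dims c ds = tensor_dims ds (fst (tpow c (ghz_dims k) (ghz_vec k)))"

definition src_vec :: "nat \<Rightarrow> nat list \<Rightarrow> vec \<Rightarrow> vec" where
  "src_vec c ds v = tensor_vec ds v (fst (tpow c (ghz_dims k) (ghz_vec k))) (snd (tpow c (ghz_dims k) (ghz_vec k)))"

lemma is_state_src: "is_state k ds v \<Longrightarrow> is_state k (src_dims c ds) (src_vec c ds v)"
  unfolding src_dims_def src_vec_def by (intro is_state_tensor is_state_tpow is_state_ghz)

lemma E_src: "is_state k ds v \<Longrightarrow> Ev E (src_dims c ds) (src_vec c ds v) = Ev E ds v + c"
  unfolding src_dims_def src_vec_def using E_tpow[OF is_state_ghz] ghz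
  by (simp add: E_tensor is_state_tpow is_state_ghz)

text \<open>Regroups the copies into the normal form that \<open>prep\<close> expects: all GHZ bits
  merge into one shared label, numbered by \<open>code\<close>, and the other factors keep their
  amplitudes.\<close>

lemma rep_src:
  assumes "rep k ds v A amp"
  shows "rep k (fst (tpow N (src_dims c ds) (src_vec c ds v))) (snd (tpow N (src_dims c ds) (src_vec c ds v)))
    (\<lambda>i. {..<2 ^ (c * N) :: nat} \<times> PiE {..<N} (\<lambda>_. A i))
    (\<lambda>f. if \<forall>i<k. fst (f i) = fst (f 0) then (\<lambda>a. \<Prod>t<N. amp (\<lambda>i\<in>{..<k}. a i t)) (\<lambda>i\<in>{..<k}. snd (f i)) / complex_of_real (sqrt (real (2 ^ (c * N)))) else 0)"
proof -
  let ?B = "PiE {..<c} (\<lambda>_. {..<2::nat})"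
  have "finite (PiE {..<N} (\<lambda>_. ?B))" by (intro finite_PiE) auto
  moreover have cardB: "card (PiE {..<N} (\<lambda>_. ?B)) = 2 ^ (c * N)" by (simp add: card_PiE power_mult)
  ultimately obtain code where code: "bij_betw code (PiE {..<N} (\<lambda>_. ?B)) {..<2 ^ (c * N) :: nat}"
    using ex_bij_betw_finite_nat[of "PiE {..<N} (\<lambda>_. ?B)"] atLeast0LessThan by metis
  define \<beta> where "\<beta> = (\<lambda>(f :: nat \<Rightarrow> 'a \<times> (nat \<Rightarrow> nat)). (code (\<lambda>t\<in>{..<N}. snd (f t)), \<lambda>t\<in>{..<N}. fst (f t)))"
  have bij: "bij_betw \<beta> (PiE {..<N} (\<lambda>_. A i \<times> ?B)) ({..<2 ^ (c * N) :: nat} \<times> PiE {..<N} (\<lambda>_. A i))" for i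
  proof -
    have "bij_betw (map_prod code id) (PiE {..<N} (\<lambda>_. ?B) \<times> PiE {..<N} (\<lambda>_. A i)) ({..<2 ^ (c * N) :: nat} \<times> PiE {..<N} (\<lambda>_. A i))"
      using code by (intro bij_betw_map_prod) auto
    from bij_betw_trans[OF bij_PiE_swap this] show ?thesis by (simp add: \<beta>_def o_def)
  qed
  show ?thesis
    unfolding src_dims_def src_vec_def
  proof (rule rep_map[OF rep_tpow[OF rep_tensor[OF assms rep_ghz_pow]], where \<beta> = "\<lambda>_. \<beta>"])
    show "\<And>i. bij_betw \<beta> (PiE {..<N} (\<lambda>_. A i \<times> ?B)) ({..<2 ^ (c * N) :: nat} \<times> PiE {..<N} (\<lambda>_. A i))" by (rule bij)
    fix f assume f: "f \<in> PiE {..<k} (\<lambda>i. PiE {..<N} (\<lambda>_. A i \<times> ?B))"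
    have fi: "f i \<in> PiE {..<N} (\<lambda>_. A i \<times> ?B)" if "i < k" for i using PiE_mem[OF f, of i] that by simp
    let ?b = "\<lambda>i\<in>{..<k}. \<beta> (f i)"
    have b1: "fst (?b i) = code (\<lambda>t\<in>{..<N}. snd (f i t))" and b2: "snd (?b i) = (\<lambda>t\<in>{..<N}. fst (f i t))" if "i < k" for i
      using that by (simp_all add: \<beta>_def)
    have inB: "(\<lambda>t\<in>{..<N}. snd (f i t)) \<in> PiE {..<N} (\<lambda>_. ?B)" if "i < k" for i
    proof -
      have "snd (f i t) \<in> ?B" if "t \<in> {..<N}" for t
        using PiE_mem[OF fi[OF \<open>i < k\<close>] that] by (simp only: mem_Times_iff)
      then show ?thesis by (simp only: restrict_PiE_iff) blast
    qed
    have eqv: "(\<forall>t<N. \<forall>i<k. snd (f i t) = snd (f 0 t)) \<longleftrightarrow> (\<forall>i<k. fst (?b i) = fst (?b 0))"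
    proof
      assume *: "\<forall>t<N. \<forall>i<k. snd (f i t) = snd (f 0 t)"
      show "\<forall>i<k. fst (?b i) = fst (?b 0)"
      proof (intro allI impI)
        fix i assume i: "i < k"
        have "(\<lambda>t\<in>{..<N}. snd (f i t)) = (\<lambda>t\<in>{..<N}. snd (f 0 t))" by (rule restrict_ext) (use * i in blast)
        then show "fst (?b i) = fst (?b 0)" unfolding b1[OF i] b1[OF k_pos] by (rule arg_cong)
      qed
    next
      assume *: "\<forall>i<k. fst (?b i) = fst (?b 0)"
      show "\<forall>t<N. \<forall>i<k. snd (f i t) = snd (f 0 t)"
      proof (intro allI impI)
        fix t i assume t: "t < N" and i: "i < k"
        have "fst (?b i) = fst (?b 0)" using * i by blast
        then have "code (\<lambda>t\<in>{..<N}. snd (f i t)) = code (\<lambda>t\<in>{..<N}. snd (f 0 t))" unfolding b1[OF i] b1[OF k_pos] .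
        then have "(\<lambda>t\<in>{..<N}. snd (f i t)) = (\<lambda>t\<in>{..<N}. snd (f 0 t))"
          by (rule inj_onD[OF bij_betw_imp_inj_on[OF code] _ inB[OF i] inB[OF k_pos]])
        from fun_cong[OF this, of t] show "snd (f i t) = snd (f 0 t)" using t by simp
      qed
    qed
    let ?P = "\<lambda>t. \<forall>i<k. snd (f i t) = snd (f 0 t)"
    have e1: "(\<lambda>i\<in>{..<k}. fst ((\<lambda>i\<in>{..<k}. f i t) i)) = (\<lambda>i\<in>{..<k}. fst (f i t))" for t by (rule restrict_ext) simp
    have e2: "(\<forall>i<k. (\<lambda>i\<in>{..<k}. snd ((\<lambda>i\<in>{..<k}. f i t) i)) i = (\<lambda>i\<in>{..<k}. snd ((\<lambda>i\<in>{..<k}. f i t) i)) 0) \<longleftrightarrow> ?P t" for t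
      using k_pos by simp
    have "(\<Prod>t<N. amp (\<lambda>i\<in>{..<k}. fst ((\<lambda>i\<in>{..<k}. f i t) i)) * (if \<forall>i<k. (\<lambda>i\<in>{..<k}. snd ((\<lambda>i\<in>{..<k}. f i t) i)) i = (\<lambda>i\<in>{..<k}. snd ((\<lambda>i\<in>{..<k}. f i t) i)) 0
          then complex_of_real (1 / sqrt (2 ^ c)) else 0))
       = (\<Prod>t<N. if ?P t then amp (\<lambda>i\<in>{..<k}. fst (f i t)) * complex_of_real (1 / sqrt (2 ^ c)) else 0)"
    proof -
      have mult_if: "x * (if Q then y else 0) = (if Q then x * y else 0)" for x y :: complex and Q by simp
      show ?thesis unfolding e1 e2 mult_if ..
    qed
    also have "\<dots> = (if \<forall>t<N. ?P t then \<Prod>t<N. amp (\<lambda>i\<in>{..<k}. fst (f i t)) * complex_of_real (1 / sqrt (2 ^ c)) else 0)"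
      by (rule prod_monomial)
    also have "(\<Prod>t<N. amp (\<lambda>i\<in>{..<k}. fst (f i t)) * complex_of_real (1 / sqrt (2 ^ c)))
       = (\<Prod>t<N. amp (\<lambda>i\<in>{..<k}. (\<lambda>i\<in>{..<k}. snd (?b i)) i t)) / complex_of_real (sqrt (real (2 ^ (c * N))))"
    proof -
      have "(\<lambda>i\<in>{..<k}. (\<lambda>i\<in>{..<k}. snd (?b i)) i t) = (\<lambda>i\<in>{..<k}. fst (f i t))" if "t < N" for t
        by (rule restrict_ext) (use that b2 in simp)
      then have "(\<Prod>t<N. amp (\<lambda>i\<in>{..<k}. (\<lambda>i\<in>{..<k}. snd (?b i)) i t)) = (\<Prod>t<N. amp (\<lambda>i\<in>{..<k}. fst (f i t)))"
        by (intro prod.cong refl arg_cong[where f = amp]) simp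
      moreover have "(\<Prod>t<N. complex_of_real (1 / sqrt (2 ^ c))) = 1 / complex_of_real (sqrt (real (2 ^ (c * N))))"
        by (simp add: power_divide real_sqrt_power power_mult)
      ultimately show ?thesis by (simp only: prod.distrib) simp
    qed
    finally show "(\<Prod>t<N. amp (\<lambda>i\<in>{..<k}. fst ((\<lambda>i\<in>{..<k}. f i t) i)) * (if \<forall>i<k. (\<lambda>i\<in>{..<k}. snd ((\<lambda>i\<in>{..<k}. f i t) i)) i = (\<lambda>i\<in>{..<k}. snd ((\<lambda>i\<in>{..<k}. f i t) i)) 0
          then complex_of_real (1 / sqrt (2 ^ c)) else 0))
      = (if \<forall>i<k. fst (?b i) = fst (?b 0) then (\<lambda>a. \<Prod>t<N. amp (\<lambda>i\<in>{..<k}. a i t)) (\<lambda>i\<in>{..<k}. snd (?b i)) / complex_of_real (sqrt (real (2 ^ (c * N)))) else 0)"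
      unfolding eqv .
  qed
qed

text \<open>A power of the state is prepared from GHZ states alone, one for each bit of the size of
  its index set. Rounding up costs at most 1 in total, which is negligible per copy.\<close>

lemma E_le_log_dimH:
  assumes v: "is_state k ds v"
  shows "Ev E ds v \<le> log 2 (dimH ds)"
proof -
  have len: "length ds = k" using v by (simp add: is_state_iff)
  define L where "L = log 2 (dimH ds)"
  have L0: "0 \<le> L" using log_dimH_nonneg[OF v] by (simp add: L_def)
  have key: "real n * Ev E ds v \<le> real n * L + 1" for n
  proof -
    define c where "c = nat \<lceil>real n * L\<rceil>"
    have c: "real n * L \<le> real c" "real c \<le> real n * L + 1" using L0 by (auto simp: c_def)
    define es w where "es = fst (tpow n ds v)" and "w = snd (tpow n ds v)"
    have w: "is_state k es w" using is_state_tpow[OF v] by (simp add: es_def w_def)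
    have les: "length es = k" using w by (simp add: is_state_iff)
    define u0 where "u0 = src_vec c (replicate k 1) (unit_vec k)"
    define d0 where "d0 = src_dims c (replicate k 1)"
    have u0: "is_state k d0 u0" unfolding u0_def d0_def by (rule is_state_src[OF is_state_unit])
    have card: "card (idxs es) \<le> 2 ^ (c * 1)"
    proof -
      have pos: "0 < dimH ds" using is_state_dimH_pos[OF v] .
      have "real (dimH ds ^ n) = 2 powr (real n * L)"
        using pos two_powr_log[of "real (dimH ds)" n] by (simp add: L_def)
      also have "\<dots> \<le> 2 powr real c" using c by simp
      finally have "real (dimH ds ^ n) \<le> real (2 ^ c)" by (simp add: powr_realpow)
      then have "dimH ds ^ n \<le> 2 ^ c" by (simp only: of_nat_le_iff)
      then show ?thesis by (simp add: card_idxs es_def dimH_tpow)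
    qed
    \<comment> \<open>The source contains only the trivial state besides the GHZ states, so every
      party has a single auxiliary label.\<close>
    let ?A = "\<lambda>i. PiE {..<1::nat} (\<lambda>_. {..<replicate k (1::nat) ! i})"
    let ?X = "\<lambda>a. \<Prod>t<1. (\<lambda>f. unit_vec k (map f [0..<k])) (\<lambda>i\<in>{..<k}. a i (t::nat))"
    have single: "a = a'" if "i < k" "a \<in> ?A i" "a' \<in> ?A i" for i a a'
    proof (rule PiE_ext[OF that(2,3)])
      fix t assume t: "t \<in> {..<1::nat}"
      show "a t = a' t" using PiE_mem[OF that(2) t] PiE_mem[OF that(3) t] that(1) by simp
    qed
    have "\<exists>out. is_state k es out \<and> reach (fst (tpow 1 d0 u0)) (snd (tpow 1 d0 u0)) es (\<lambda>z. \<exists>b. z = (\<lambda>x. b * out x)) \<and>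
      (\<Sum>a\<in>PiE {..<k} ?A. (cmod (?X a))\<^sup>2) = 1 \<and>
      (\<forall>w'. ip es w' out = (\<Sum>s\<in>idxs es. \<Sum>a\<in>PiE {..<k} ?A. cnj (w' (map (\<lambda>i. s ! i) [0..<k])) * (w s * ?X a)))"
    \<comment> \<open>The labels are the multi-indices of the target with its own amplitudes, and
      each party reads its own coordinate.\<close>
    proof (rule prep[where R = "2 ^ (c * 1)" and \<rho> = "\<lambda>i s. s ! i"])
      show "is_state k (fst (tpow 1 d0 u0)) (snd (tpow 1 d0 u0))" by (rule is_state_tpow[OF u0])
      show "rep k (fst (tpow 1 d0 u0)) (snd (tpow 1 d0 u0)) (\<lambda>i. {..<2 ^ (c * 1) :: nat} \<times> ?A i)
        (\<lambda>f. if \<forall>i<k. fst (f i) = fst (f 0) then ?X (\<lambda>i\<in>{..<k}. snd (f i)) / complex_of_real (sqrt (real (2 ^ (c * 1)))) else 0)"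
        unfolding d0_def u0_def by (rule rep_src[OF rep_base]) simp
      show "inj_on (\<lambda>a. s ! i) (?A i)" if "i < k" "s \<in> idxs es" for i s
        using single[OF that(1)] by (intro inj_onI)
      show "s = s'" if "s \<in> idxs es" "s' \<in> idxs es" "\<And>i. i < k \<Longrightarrow> s ! i = s' ! i" for s s'
        using that les by (intro nth_equalityI) (auto simp: idxs_length)
      show "(\<Sum>s\<in>idxs es. (cmod (w s))\<^sup>2) = 1" using w by (simp add: is_state_def)
      show "s ! i < es ! i" if "i < k" "s \<in> idxs es" for i s using that les by (simp add: idxsD)
    qed (use k_pos les card in auto)
    then obtain out where out: "is_state k es out" "reach (fst (tpow 1 d0 u0)) (snd (tpow 1 d0 u0)) es (\<lambda>z. \<exists>b. z = (\<lambda>x. b * out x))"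
      "(\<Sum>a\<in>PiE {..<k} ?A. (cmod (?X a))\<^sup>2) = 1"
      "\<And>w'. ip es w' out = (\<Sum>s\<in>idxs es. \<Sum>a\<in>PiE {..<k} ?A. cnj (w' (map (\<lambda>i. s ! i) [0..<k])) * (w s * ?X a))"
      by blast
    obtain a0 where a0: "PiE {..<k} ?A = {a0}"
    proof -
      have "PiE {..<k} ?A \<noteq> {}"
      proof
        assume e: "PiE {..<k} ?A = {}"
        show False using out(3) unfolding e by simp
      qed
      then obtain a0 where a0: "a0 \<in> PiE {..<k} ?A" by blast
      have "a = a0" if a: "a \<in> PiE {..<k} ?A" for a
      proof (rule PiE_ext[OF a a0])
        fix i assume i: "i \<in> {..<k}"
        then have "i < k" by simp
        then show "a i = a0 i" by (rule single[OF _ PiE_mem[OF a i] PiE_mem[OF a0 i]])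
      qed
      with a0 have "PiE {..<k} ?A = {a0}" by blast
      then show ?thesis by (rule that)
    qed
    \<comment> \<open>The trivial factor contributes at most a phase, so the output and the target
      have overlap of modulus one.\<close>
    have X1: "cmod (?X a0) = 1"
    proof -
      have "(cmod (?X a0))\<^sup>2 = 1" using out(3) unfolding a0 by simp
      then have "cmod (?X a0) = 1 \<or> cmod (?X a0) = - 1" by (simp only: power2_eq_1_iff)
      moreover have "0 \<le> cmod (?X a0)" by (rule norm_ge_zero)
      ultimately show ?thesis by linarith
    qed
    have "ip es w out = (\<Sum>s\<in>idxs es. cnj (w s) * w s * ?X a0)"
      unfolding out(4) a0
    proof (rule sum.cong[OF refl])
      fix s assume s: "s \<in> idxs es"
      have "map (\<lambda>i. s ! i) [0..<k] = s" using s les by (metis idxs_length map_nth)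
      then show "(\<Sum>a\<in>{a0}. cnj (w (map (\<lambda>i. s ! i) [0..<k])) * (w s * ?X a)) = cnj (w s) * w s * ?X a0"
        by (simp only: sum.insert sum.empty finite.emptyI empty_iff not_False_eq_True add_0_right mult.assoc)
    qed
    also have "\<dots> = ip es w w * ?X a0" by (simp only: ip_def sum_distrib_right)
    also have "ip es w w = 1" using w by (simp add: sqn_ip[symmetric] is_state_iff)
    finally have "cmod (ip es w out) = 1" using X1 by (simp only: mult_1)
    then have "Ev E es out = Ev E es w" by (rule E_eq_of_ip[OF w out(1)])
    moreover have "Ev E es out \<le> Ev E (fst (tpow 1 d0 u0)) (snd (tpow 1 d0 u0))"
      by (rule reach_mono[OF out(2) is_state_tpow[OF u0] out(1)])
    moreover have "Ev E (fst (tpow 1 d0 u0)) (snd (tpow 1 d0 u0)) = c"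
      using E_tpow[OF u0, of 1] E_src[OF is_state_unit, of c] E_unit by (simp add: d0_def u0_def)
    moreover have "Ev E es w = real n * Ev E ds v" using E_tpow[OF v] by (simp add: es_def w_def)
    ultimately show ?thesis using c by linarith
  qed
  show ?thesis
  proof (rule ccontr)
    assume "\<not> ?thesis"
    then have d: "0 < Ev E ds v - L" by (simp add: L_def)
    obtain n :: nat where "1 / (Ev E ds v - L) < real n" using reals_Archimedean2 by blast
    then have "1 < real n * (Ev E ds v - L)" using d by (simp add: field_simps)
    then show False using key[of n] by (simp add: algebra_simps)
  qed
qed

end

section \<open>Upper bound for direct sums\<close>

lemma inv_into_bij: "bij_betw f A B \<Longrightarrow> b \<in> B \<Longrightarrow> f (inv_into A f b) = b \<and> inv_into A f b \<in> A"
  by (metis bij_betw_imp_surj_on f_inv_into_f inv_into_into)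

context ent_measure
begin

lemma rep_pair_pow:
  assumes "length ds = k" "length es = k"
  shows "rep k (tensor_dims (fst (tpow a ds v)) (fst (tpow b es w)))
      (tensor_vec (fst (tpow a ds v)) (snd (tpow a ds v)) (fst (tpow b es w)) (snd (tpow b es w)))
      (\<lambda>i. PiE {..<a} (\<lambda>_. {..<ds ! i}) \<times> PiE {..<b} (\<lambda>_. {..<es ! i}))
      (\<lambda>f. (\<Prod>j<a. v (map (\<lambda>i. fst (f i) j) [0..<k])) * (\<Prod>j<b. w (map (\<lambda>i. snd (f i) j) [0..<k])))"
  by (rule rep_cong[OF rep_tensor[OF rep_pow_vec[OF assms(1)] rep_pow_vec[OF assms(2)]]])
     (intro arg_cong2[where f = "(*)"] prod.cong refl arg_cong[where f = v] arg_cong[where f = w] map_cong, auto)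

text \<open>The target is truncated to typical patterns, and the weight \<open>P\<close> kept is the
  squared fidelity. At most positions the state is supplied by copies of \<open>v\<close> and
  \<open>w\<close>, at the others the basis states are written explicitly. The bound on
  \<open>c\<close> pays for both the number of patterns and these explicit indices.\<close>

lemma dsum_typical_conv:
  fixes a b c n0 N D0 :: nat and p \<eta> :: real
  assumes v: "is_state k ds v" and w: "is_state k es w" and p: "0 < p" "p < 1" and \<eta>: "0 < \<eta>"
    and a: "real a \<le> (p - \<eta>) * n0" and b: "real b \<le> (1 - p - \<eta>) * n0"
    and D0: "dimH ds \<le> D0" "dimH es \<le> D0"
    and c: "real n0 * (h p + \<eta> * (\<bar>log 2 p\<bar> + \<bar>log 2 (1 - p)\<bar>)) + real (n0 - a - b) * log 2 D0 \<le> c"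
  defines "\<Omega> \<equiv> dsum_vec (complex_of_real (sqrt p)) ds v (complex_of_real (sqrt (1 - p))) es w"
    and "D \<equiv> dsum_dims ds es"
    and "X \<equiv> tensor_dims (fst (tpow a ds v)) (fst (tpow b es w))"
    and "x \<equiv> tensor_vec (fst (tpow a ds v)) (snd (tpow a ds v)) (fst (tpow b es w)) (snd (tpow b es w))"
    and "J \<equiv> {..<N} \<times> {..<n0}"
  defines "P \<equiv> \<Sum>S\<in>window J p \<eta>. weight J p S"
  defines "B \<equiv> fst (tpow N (fst (tpow n0 D \<Omega>)) (snd (tpow n0 D \<Omega>)))"
    and "W \<equiv> snd (tpow N (fst (tpow n0 D \<Omega>)) (snd (tpow n0 D \<Omega>)))"
    and "d \<equiv> fst (tpow N (src_dims c X) (src_vec c X x))"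
    and "u \<equiv> snd (tpow N (src_dims c X) (src_vec c X x))"
  assumes P0: "0 < P"
  shows "eps_conv d (proj d u) B (proj B W) (sqrt (1 - P))"
proof -
  have len: "length ds = k" "length es = k" using v w by (auto simp: is_state_iff)
  have le: "length ds = length es" and ne: "0 < length es" using len k_pos by auto
  have \<Omega>: "is_state k D \<Omega>" unfolding \<Omega>_def D_def using v w k_pos p by (intro is_state_dsum) auto
  have lenD: "length D = k" using \<Omega> by (simp add: is_state_iff)
  have Di: "D ! i = ds ! i + es ! i" if "i < k" for i using that len by (simp add: D_def dsum_dims_nth)
  have Bst: "is_state k B W" unfolding B_def W_def by (intro is_state_tpow \<Omega>)
  have lenB: "length B = k" using Bst by (simp add: is_state_iff)
  have xst: "is_state k X x" unfolding X_def x_def by (intro is_state_tensor is_state_tpow v w)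
  have ust: "is_state k d u" unfolding d_def u_def by (intro is_state_tpow is_state_src xst)
  have finJ: "finite J" by (simp add: J_def)
  have cardJ: "card J = N * n0" by (simp add: J_def)
  define T where "T = window J p \<eta>"
  define I1 where "I1 = {..<N} \<times> {..<a}"
  define I2 where "I2 = {..<N} \<times> {..<b}"
  have cI: "card I1 = N * a" "card I2 = N * b" "finite I1" "finite I2" by (auto simp: I1_def I2_def)
  have finT: "finite T" unfolding T_def by (rule finite_window[OF finJ])
  have TJ: "S \<subseteq> J" "finite S" if "S \<in> T" for S
    using that finJ finite_subset[of S J] by (auto simp: T_def window_def)
  \<comment> \<open>The margin \<eta> in the bounds on \<open>a\<close> and \<open>b\<close> serves
    here: every typical pattern has room for all copies of \<open>v\<close> inside and all copies of
    \<open>w\<close> outside.\<close>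
  have cS: "N * a \<le> card S" "N * b \<le> card (J - S)" if S: "S \<in> T" for S
  proof -
    have w1: "\<bar>real (card S) - real (card J) * p\<bar> \<le> \<eta> * real (card J)" using S by (auto simp: T_def window_def)
    have 1: "real N * real a \<le> real N * ((p - \<eta>) * n0)" using a by (intro mult_left_mono) auto
    have "real N * ((p - \<eta>) * n0) = real (card J) * p - \<eta> * real (card J)" by (simp add: cardJ algebra_simps)
    with 1 w1 have "real (N * a) \<le> real (card S)" by simp
    then show "N * a \<le> card S" by (simp only: of_nat_le_iff)
    have 2: "real N * real b \<le> real N * ((1 - p - \<eta>) * n0)" using b by (intro mult_left_mono) auto
    have 3: "real N * ((1 - p - \<eta>) * n0) = real (card J) - real (card J) * p - \<eta> * real (card J)" by (simp add: cardJ algebra_simps)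
    have "card S \<le> card J" using TJ[OF S] finJ by (intro card_mono)
    then have "real (card (J - S)) = real (card J) - real (card S)"
      using TJ[OF S] by (simp add: card_Diff_subset of_nat_diff)
    with 2 3 w1 have "real (N * b) \<le> real (card (J - S))" by simp
    then show "N * b \<le> card (J - S)" by (simp only: of_nat_le_iff)
  qed
  \<comment> \<open>\<open>\<pi> S\<close> places the copies of \<open>v\<close> at positions inside
    \<open>S\<close>; correspondingly \<open>\<rho> S\<close> places the copies of \<open>w\<close>
    outside.\<close>
  have "\<forall>S\<in>T. \<exists>f. f ` I1 \<subseteq> S \<and> inj_on f I1"
  proof
    fix S assume "S \<in> T"
    then show "\<exists>f. f ` I1 \<subseteq> S \<and> inj_on f I1" using cS(1) TJ(2) cI by (intro card_le_inj) auto
  qed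
  from bchoice[OF this] obtain \<pi> where \<pi>: "\<And>S. S \<in> T \<Longrightarrow> \<pi> S ` I1 \<subseteq> S" "\<And>S. S \<in> T \<Longrightarrow> inj_on (\<pi> S) I1" by blast
  have "\<forall>S\<in>T. \<exists>f. f ` I2 \<subseteq> J - S \<and> inj_on f I2"
  proof
    fix S assume "S \<in> T"
    then show "\<exists>f. f ` I2 \<subseteq> J - S \<and> inj_on f I2" using cS(2) finJ cI by (intro card_le_inj) auto
  qed
  from bchoice[OF this] obtain \<rho> where \<rho>: "\<And>S. S \<in> T \<Longrightarrow> \<rho> S ` I2 \<subseteq> J - S" "\<And>S. S \<in> T \<Longrightarrow> inj_on (\<rho> S) I2" by blast
  \<comment> \<open>The positions in \<open>U S\<close> receive no copy. A label for the preparation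
    therefore consists of a pattern and, for each such position, a multi-index in the block
    prescribed by the pattern.\<close>
  define U where "U = (\<lambda>S. J - \<pi> S ` I1 - \<rho> S ` I2)"
  define Z where "Z = (\<lambda>S (y :: nat \<times> nat). if y \<in> S then idxs ds else shift ds ` idxs es)"
  define SS where "SS = Sigma T (\<lambda>S. PiE (U S) (Z S))"
  have finU: "finite (U S)" for S using finJ by (simp add: U_def)
  have finZ: "finite (Z S y)" for S y by (simp add: Z_def)
  have finPU: "finite (PiE (U S) (Z S))" for S using finU finZ by (intro finite_PiE) auto
  have finSS: "finite SS" unfolding SS_def using finT finPU by (intro finite_SigmaI) auto
  have split: "J = (\<pi> S ` I1 \<union> \<rho> S ` I2) \<union> U S" "\<pi> S ` I1 \<inter> \<rho> S ` I2 = {}" "(\<pi> S ` I1 \<union> \<rho> S ` I2) \<inter> U S = {}"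
    if S: "S \<in> T" for S
    using \<pi>(1)[OF S] \<rho>(1)[OF S] TJ(1)[OF S] by (auto simp: U_def)
  have cU: "card (U S \<inter> S) = card S - N * a" "card (U S - S) = card (J - S) - N * b" if S: "S \<in> T" for S
  proof -
    have "U S \<inter> S = S - \<pi> S ` I1" using \<rho>(1)[OF S] TJ(1)[OF S] by (auto simp: U_def)
    then show "card (U S \<inter> S) = card S - N * a"
      using \<pi>[OF S] TJ(2)[OF S] cI by (simp add: card_Diff_subset card_image finite_subset)
    have "U S - S = (J - S) - \<rho> S ` I2" using \<pi>(1)[OF S] by (auto simp: U_def)
    then show "card (U S - S) = card (J - S) - N * b"
      using \<rho>[OF S] finJ cI by (simp add: card_Diff_subset card_image)
  qed

  define A where "A = (\<lambda>i. PiE {..<N} (\<lambda>_. PiE {..<a} (\<lambda>_. {..<ds ! i}) \<times> PiE {..<b} (\<lambda>_. {..<es ! i})))"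
  have Ag: "fst (g t) j < ds ! i" if "g \<in> A i" "t < N" "j < a" for g i t j
  proof -
    have "g t \<in> PiE {..<a} (\<lambda>_. {..<ds ! i}) \<times> PiE {..<b} (\<lambda>_. {..<es ! i})"
      using PiE_mem[of g "{..<N}" _ t] that by (simp only: A_def) auto
    then have "fst (g t) \<in> PiE {..<a} (\<lambda>_. {..<ds ! i})" by (simp only: mem_Times_iff)
    from PiE_mem[OF this, of j] show ?thesis using that by simp
  qed
  have Ag2: "snd (g t) j < es ! i" if "g \<in> A i" "t < N" "j < b" for g i t j
  proof -
    have "g t \<in> PiE {..<a} (\<lambda>_. {..<ds ! i}) \<times> PiE {..<b} (\<lambda>_. {..<es ! i})"
      using PiE_mem[of g "{..<N}" _ t] that by (simp only: A_def) auto
    then have "snd (g t) \<in> PiE {..<b} (\<lambda>_. {..<es ! i})" by (simp only: mem_Times_iff)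
    from PiE_mem[OF this, of j] show ?thesis using that by simp
  qed
  define i1 where "i1 = (\<lambda>S y. inv_into I1 (\<pi> S) y)"
  define i2 where "i2 = (\<lambda>S y. inv_into I2 (\<rho> S) y)"
  \<comment> \<open>The symbol of party \<open>i\<close> at position \<open>y\<close>: from the
    placed copy of \<open>v\<close>, from the placed copy of \<open>w\<close> shifted into the
    second block, or from the label.\<close>
  define Y where "Y = (\<lambda>i s (g :: nat \<Rightarrow> (nat \<Rightarrow> nat) \<times> (nat \<Rightarrow> nat)) y.
     if y \<in> \<pi> (fst s) ` I1 then fst (g (fst (i1 (fst s) y))) (snd (i1 (fst s) y))
     else if y \<in> \<rho> (fst s) ` I2 then ds ! i + snd (g (fst (i2 (fst s) y))) (snd (i2 (fst s) y))
     else snd s y ! i)"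
  have sT: "fst s \<in> T" "snd s \<in> PiE (U (fst s)) (Z (fst s))" if "s \<in> SS" for s using that by (auto simp: SS_def)
  have Y1: "Y i s g (\<pi> (fst s) y) = fst (g (fst y)) (snd y)" if "s \<in> SS" "y \<in> I1" for i s g y
  proof -
    have "i1 (fst s) (\<pi> (fst s) y) = y" unfolding i1_def by (rule inv_into_f_f[OF \<pi>(2)[OF sT(1)[OF that(1)]] that(2)])
    moreover have "\<pi> (fst s) y \<in> \<pi> (fst s) ` I1" using that(2) by (rule imageI)
    ultimately show ?thesis by (simp only: Y_def if_True)
  qed
  have Y2: "Y i s g (\<rho> (fst s) y) = ds ! i + snd (g (fst y)) (snd y)" if "s \<in> SS" "y \<in> I2" for i s g y
  proof -
    have "i2 (fst s) (\<rho> (fst s) y) = y" unfolding i2_def by (rule inv_into_f_f[OF \<rho>(2)[OF sT(1)[OF that(1)]] that(2)])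
    moreover have m: "\<rho> (fst s) y \<in> \<rho> (fst s) ` I2" using that(2) by (rule imageI)
    moreover have "\<rho> (fst s) y \<notin> \<pi> (fst s) ` I1" using split(2)[OF sT(1)[OF that(1)]] m by blast
    ultimately show ?thesis by (simp only: Y_def if_True if_False)
  qed
  have Y3: "Y i s g y = snd s y ! i" if "s \<in> SS" "y \<in> U (fst s)" for i s g y
  proof -
    have "y \<notin> \<pi> (fst s) ` I1" "y \<notin> \<rho> (fst s) ` I2" using that(2) by (auto simp: U_def)
    then show ?thesis by (simp only: Y_def if_False)
  qed
  \<comment> \<open>Each party learns the pattern from its own symbols, which are below
    \<open>ds ! i\<close> exactly at the positions in the pattern. Hence the label can be read off
    the target itself.\<close>
  have Yprop: "Y i s g y < D ! i \<and> (Y i s g y < ds ! i \<longleftrightarrow> y \<in> fst s)"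
    if i: "i < k" and s: "s \<in> SS" and g: "g \<in> A i" and y: "y \<in> J" for i s g y
  proof -
    note S = sT(1)[OF s]
    consider (1) z where "z \<in> I1" "y = \<pi> (fst s) z" | (2) z where "z \<in> I2" "y = \<rho> (fst s) z" | (3) "y \<in> U (fst s)"
      using split(1)[OF S] y by blast
    then show ?thesis
    proof cases
      case 1
      then have "fst (g (fst z)) (snd z) < ds ! i" using Ag[OF g] by (auto simp: I1_def)
      moreover have "y \<in> fst s" using 1 \<pi>(1)[OF S] by blast
      ultimately show ?thesis unfolding 1(2) Y1[OF s 1(1)] using Di[OF i] by simp
    next
      case 2
      then have "snd (g (fst z)) (snd z) < es ! i" using Ag2[OF g] by (auto simp: I2_def)
      moreover have "y \<notin> fst s" using 2 \<rho>(1)[OF S] by blast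
      ultimately show ?thesis unfolding 2(2) Y2[OF s 2(1)] using Di[OF i] by simp
    next
      case 3
      have z: "snd s y \<in> Z (fst s) y" using PiE_mem[OF sT(2)[OF s] 3] .
      show ?thesis
      proof (cases "y \<in> fst s")
        case True
        then have "snd s y ! i < ds ! i" using z i len by (simp add: Z_def idxsD)
        then show ?thesis unfolding Y3[OF s 3] using True Di[OF i] by simp
      next
        case False
        then obtain z' where "z' \<in> idxs es" "snd s y = shift ds z'" using z by (auto simp: Z_def)
        then have "snd s y ! i = ds ! i + z' ! i" "z' ! i < es ! i" using i len by (auto simp: shift_nth idxs_def)
        then show ?thesis unfolding Y3[OF s 3] using False Di[OF i] by simp
      qed
    qed
  qed

  obtain dec where dec: "rep_by k B W (\<lambda>i. PiE {..<N} (\<lambda>_. PiE {..<n0} (\<lambda>_. {..<D ! i}))) dec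
      (\<lambda>f. \<Prod>t<N. \<Prod>j<n0. \<Omega> (map (\<lambda>i. f i t j) [0..<k]))"
    using rep_pow_pow_vec[OF lenD, of N n0 \<Omega>] unfolding rep_def B_def W_def by blast
  have bij: "bij_betw (dec i) {..<B ! i} (PiE {..<N} (\<lambda>_. PiE {..<n0} (\<lambda>_. {..<D ! i})))" if "i < k" for i
    using dec that by (auto simp: rep_by_def)
  define F where "F = (\<lambda>i s g. \<lambda>t\<in>{..<N}. \<lambda>j\<in>{..<n0}. Y i s g (t, j))"
  define \<iota> where "\<iota> = (\<lambda>i s g. inv_into {..<B ! i} (dec i) (F i s g))"
  have Fin: "F i s g \<in> PiE {..<N} (\<lambda>_. PiE {..<n0} (\<lambda>_. {..<D ! i}))" if "i < k" "s \<in> SS" "g \<in> A i" for i s g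
    unfolding F_def restrict_PiE_iff
  proof (intro ballI)
    fix t j assume "t \<in> {..<N}" "j \<in> {..<n0}"
    then have "(t, j) \<in> J" by (simp add: J_def)
    from Yprop[OF that this] show "Y i s g (t, j) \<in> {..<D ! i}" by simp
  qed
  have \<iota>: "dec i (\<iota> i s g) = F i s g" "\<iota> i s g < B ! i" if "i < k" "s \<in> SS" "g \<in> A i" for i s g
    using inv_into_bij[OF bij[OF that(1)] Fin[OF that]] by (auto simp: \<iota>_def)
  have FY: "Y i s g y = Y i s' g' y" if h: "i < k" "s \<in> SS" "s' \<in> SS" "g \<in> A i" "g' \<in> A i" "\<iota> i s g = \<iota> i s' g'" "y \<in> J" for i s s' g g' y
  proof -
    obtain t j where y: "y = (t, j)" "t < N" "j < n0" using h(7) by (auto simp: J_def)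
    have "F i s g = F i s' g'" using \<iota>(1)[OF h(1,2,4)] \<iota>(1)[OF h(1,3,5)] h(6) by simp
    from fun_cong[OF fun_cong[OF this, of t], of j] show ?thesis using y by (simp add: F_def)
  qed
  define \<xi>' where "\<xi>' = (\<lambda>f. (\<Prod>j<a. v (map (\<lambda>i. fst (f i) j) [0..<k])) * (\<Prod>j<b. w (map (\<lambda>i. snd (f i) j) [0..<k])))"
  define X' where "X' = (\<lambda>g. \<Prod>t<N. \<xi>' (\<lambda>i\<in>{..<k}. g i t))"
  \<comment> \<open>The copies supply the amplitudes of \<open>v\<close> and \<open>w\<close> but
    not the factors sqrt p and sqrt (1-p) of the direct sum. These and the renormalisation 1 / sqrt
    P go into the amplitude of the label.\<close>
  define cf where "cf = (\<lambda>s. complex_of_real (1 / sqrt P * (sqrt p ^ (N * a) * sqrt (1 - p) ^ (N * b))) * (\<Prod>y\<in>U (fst s). \<Omega> (snd s y)))"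

  have zsum: "(\<Sum>z\<in>Z S y. (cmod (\<Omega> z))\<^sup>2) = (if y \<in> S then p else 1 - p)" for S y
  proof (cases "y \<in> S")
    case True
    have "(\<Sum>z\<in>idxs ds. (cmod (\<Omega> z))\<^sup>2) = (\<Sum>z\<in>idxs ds. (cmod (complex_of_real (sqrt p) * v z))\<^sup>2)"
      unfolding \<Omega>_def by (intro sum.cong refl) (simp add: dsum_vec_left[OF le ne])
    also have "\<dots> = p" using sqn_scale[of ds "complex_of_real (sqrt p)" v] v p by (simp add: sqn_def is_state_iff)
    finally show ?thesis using True by (simp add: Z_def)
  next
    case False
    note inj = inj_on_shift[OF le]
    have "(\<Sum>z\<in>shift ds ` idxs es. (cmod (\<Omega> z))\<^sup>2) = (\<Sum>z\<in>idxs es. (cmod (complex_of_real (sqrt (1 - p)) * w z))\<^sup>2)"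
      unfolding sum.reindex[OF inj] o_def \<Omega>_def by (intro sum.cong refl) (simp add: dsum_vec_right[OF le ne])
    also have "\<dots> = 1 - p" using sqn_scale[of es "complex_of_real (sqrt (1 - p))" w] w p by (simp add: sqn_def is_state_iff)
    finally show ?thesis using False by (simp add: Z_def)
  qed
  have cf1: "(\<Sum>s\<in>SS. (cmod (cf s))\<^sup>2) = 1"
  proof -
    have sq: "(cmod (cf (S, z)))\<^sup>2 = 1 / P * (p ^ (N * a) * (1 - p) ^ (N * b)) * (\<Prod>y\<in>U S. (cmod (\<Omega> (z y)))\<^sup>2)" for S z
    proof -
      have "(sqrt p ^ (N * a))\<^sup>2 = p ^ (N * a)" "(sqrt (1 - p) ^ (N * b))\<^sup>2 = (1 - p) ^ (N * b)" "(1 / sqrt P)\<^sup>2 = 1 / P"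
        using p P0 by (simp_all add: power_divide flip: power_mult) (simp_all add: mult.commute[of _ 2] power_mult)
      moreover have "(cmod (\<Prod>y\<in>U S. \<Omega> (z y)))\<^sup>2 = (\<Prod>y\<in>U S. (cmod (\<Omega> (z y)))\<^sup>2)"
        by (simp add: prod_norm[symmetric] prod_power_distrib)
      ultimately show ?thesis
        unfolding cf_def norm_mult power_mult_distrib norm_of_real power2_abs fst_conv snd_conv by simp
    qed
    have "(\<Sum>s\<in>SS. (cmod (cf s))\<^sup>2) = (\<Sum>S\<in>T. \<Sum>z\<in>PiE (U S) (Z S). (cmod (cf (S, z)))\<^sup>2)"
      unfolding SS_def using finT finPU by (subst sum.Sigma) (auto simp: case_prod_unfold)
    also have "\<dots> = (\<Sum>S\<in>T. 1 / P * (p ^ (N * a) * (1 - p) ^ (N * b)) * (\<Sum>z\<in>PiE (U S) (Z S). \<Prod>y\<in>U S. (cmod (\<Omega> (z y)))\<^sup>2))"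
      unfolding sq sum_distrib_left ..
    \<comment> \<open>Summing over the explicit indices leaves p or 1 - p for each position in
      \<open>U S\<close>; together with the factors for the placed copies this is the weight of the
      pattern.\<close>
    also have "\<dots> = (\<Sum>S\<in>T. 1 / P * weight J p S)"
    proof (rule sum.cong[OF refl])
      fix S assume S: "S \<in> T"
      have "(\<Sum>z\<in>PiE (U S) (Z S). \<Prod>y\<in>U S. (cmod (\<Omega> (z y)))\<^sup>2) = (\<Prod>y\<in>U S. \<Sum>z\<in>Z S y. (cmod (\<Omega> z))\<^sup>2)"
        using prod_sum_PiE[of "U S" "Z S" "\<lambda>_ z. (cmod (\<Omega> z))\<^sup>2"] finU finZ by simp
      also have "\<dots> = (\<Prod>y\<in>U S. if y \<in> S then p else 1 - p)" unfolding zsum ..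
      also have "\<dots> = p ^ card (U S \<inter> S) * (1 - p) ^ card (U S - S)"
        using finU by (simp add: prod.If_cases Diff_eq Int_def Collect_neg_eq)
      finally have e: "(\<Sum>z\<in>PiE (U S) (Z S). \<Prod>y\<in>U S. (cmod (\<Omega> (z y)))\<^sup>2) = p ^ (card S - N * a) * (1 - p) ^ (card (J - S) - N * b)"
        unfolding cU[OF S] .
      have "p ^ (N * a) * p ^ (card S - N * a) = p ^ card S" using cS(1)[OF S] by (simp add: power_add[symmetric])
      moreover have "(1 - p) ^ (N * b) * (1 - p) ^ (card (J - S) - N * b) = (1 - p) ^ card (J - S)" using cS(2)[OF S] by (simp add: power_add[symmetric])
      moreover have "card (J - S) = card J - card S" using TJ[OF S] by (simp add: card_Diff_subset)
      moreover have "x1 * (x2 * x3) * (x4 * x5) = x1 * ((x2 * x4) * (x3 * x5))" for x1 x2 x3 x4 x5 :: real by simp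
      ultimately show "1 / P * (p ^ (N * a) * (1 - p) ^ (N * b)) * (\<Sum>z\<in>PiE (U S) (Z S). \<Prod>y\<in>U S. (cmod (\<Omega> (z y)))\<^sup>2) = 1 / P * weight J p S"
        unfolding e weight_def by metis
    qed
    also have "\<dots> = 1" unfolding sum_distrib_left[symmetric] using P0 by (simp add: P_def T_def)
    finally show ?thesis .
  qed

  have cardSS: "card SS \<le> 2 ^ (c * N)"
  proof -
    \<comment> \<open>Every pattern leaves exactly \<open>N * m\<close> positions, with at most
      \<open>D0\<close> basis states each.\<close>
    define m where "m = n0 - a - b"
    have D1: "0 < D0" using is_state_dimH_pos[OF v] D0(1) by simp
    have cZ: "card (Z S y) \<le> D0" for S y
    proof -
      have "card (shift ds ` idxs es) \<le> D0" using card_image_le[of "idxs es" "shift ds"] D0(2) by (simp add: card_idxs)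
      then show ?thesis using D0(1) by (simp add: Z_def card_idxs)
    qed
    have cUm: "card (U S) = N * m" if S: "S \<in> T" for S
    proof -
      have "card (U S) = card (U S \<inter> S) + card (U S - S)" using finU by (metis card_Int_Diff)
      also have "\<dots> = (card S - N * a) + (card (J - S) - N * b)" using cU[OF S] by simp
      also have "\<dots> = N * m"
      proof -
        have "card S + card (J - S) = N * n0" using TJ[OF S] finJ cardJ by (metis card_Diff_subset card_mono le_add_diff_inverse)
        then show ?thesis using cS[OF S] by (simp add: m_def diff_mult_distrib2 add_mult_distrib2)
      qed
      finally show ?thesis .
    qed
    have "card SS = (\<Sum>S\<in>T. card (PiE (U S) (Z S)))" unfolding SS_def using finT finPU by (intro card_SigmaI) auto
    also have "\<dots> \<le> (\<Sum>S\<in>T. D0 ^ (N * m))"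
    proof (rule sum_mono)
      fix S assume S: "S \<in> T"
      have "card (PiE (U S) (Z S)) = (\<Prod>y\<in>U S. card (Z S y))" by (rule card_PiE[OF finU])
      also have "\<dots> \<le> (\<Prod>y\<in>U S. D0)" using cZ by (intro prod_mono) auto
      also have "\<dots> = D0 ^ (N * m)" using cUm[OF S] by simp
      finally show "card (PiE (U S) (Z S)) \<le> D0 ^ (N * m)" .
    qed
    finally have "real (card SS) \<le> real (card T) * real (D0 ^ (N * m))" by (simp flip: of_nat_mult of_nat_power)
    also have "\<dots> \<le> 2 powr (real (card J) * (h p + \<eta> * (\<bar>log 2 p\<bar> + \<bar>log 2 (1 - p)\<bar>))) * 2 powr (real (N * m) * log 2 D0)"
    proof (rule mult_mono)
      show "real (card T) \<le> 2 powr (real (card J) * (h p + \<eta> * (\<bar>log 2 p\<bar> + \<bar>log 2 (1 - p)\<bar>)))"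
        unfolding T_def by (rule card_window_le[OF finJ p])
      show "real (D0 ^ (N * m)) \<le> 2 powr (real (N * m) * log 2 D0)" using two_powr_log[of "real D0" "N * m"] D1 by simp
    qed auto
    also have "\<dots> = 2 powr (real N * (real n0 * (h p + \<eta> * (\<bar>log 2 p\<bar> + \<bar>log 2 (1 - p)\<bar>)) + real m * log 2 D0))"
      unfolding powr_add[symmetric] cardJ by (simp add: algebra_simps)
    also have "\<dots> \<le> 2 powr (real N * real c)" using c unfolding m_def by (intro powr_mono mult_left_mono) auto
    also have "\<dots> = real (2 ^ (c * N))" by (simp add: powr_realpow[symmetric] mult.commute)
    finally show ?thesis by (simp only: of_nat_le_iff)
  qed

  \<comment> \<open>On the typical part the amplitudes of the target are sqrt P times those of the
    prepared state, so the two unit vectors have overlap sqrt P.\<close>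
  have Wlab: "W (map (\<lambda>i. \<iota> i s (g i)) [0..<k]) = complex_of_real (sqrt P) * (cf s * X' g)"
    if s: "s \<in> SS" and g: "g \<in> PiE {..<k} A" for s g
  proof -
    note S = sT(1)[OF s]
    have gi: "g i \<in> A i" if "i < k" for i using PiE_mem[OF g, of i] that by simp
    let ?l = "map (\<lambda>i. \<iota> i s (g i)) [0..<k]"
    have lin: "?l \<in> idxs B" using \<iota>(2)[OF _ s gi] lenB by (auto simp: idxs_def)
    have "W ?l = (\<Prod>t<N. \<Prod>j<n0. \<Omega> (map (\<lambda>i. fam k dec ?l i t j) [0..<k]))" using dec lin by (simp add: rep_by_def)
    also have "\<dots> = (\<Prod>t<N. \<Prod>j<n0. \<Omega> (map (\<lambda>i. Y i s (g i) (t, j)) [0..<k]))"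
    proof (intro prod.cong refl arg_cong[where f = \<Omega>] map_cong)
      fix t j i assume "t \<in> {..<N}" "j \<in> {..<n0}" "i \<in> set [0..<k]"
      then show "fam k dec ?l i t j = Y i s (g i) (t, j)" using \<iota>(1)[OF _ s gi] by (simp add: fam_def F_def)
    qed
    also have "\<dots> = (\<Prod>y\<in>J. \<Omega> (map (\<lambda>i. Y i s (g i) y) [0..<k]))" by (simp add: J_def prod.cartesian_product case_prod_unfold)
    also have "\<dots> = (\<Prod>y\<in>\<pi> (fst s) ` I1. \<Omega> (map (\<lambda>i. Y i s (g i) y) [0..<k])) * (\<Prod>y\<in>\<rho> (fst s) ` I2. \<Omega> (map (\<lambda>i. Y i s (g i) y) [0..<k]))
        * (\<Prod>y\<in>U (fst s). \<Omega> (map (\<lambda>i. Y i s (g i) y) [0..<k]))"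
    proof -
      have f: "finite (\<pi> (fst s) ` I1)" "finite (\<rho> (fst s) ` I2)" "finite (\<pi> (fst s) ` I1 \<union> \<rho> (fst s) ` I2)" using cI by auto
      show ?thesis
        unfolding split(1)[OF S]
        by (simp only: prod.union_disjoint[OF f(3) finU split(3)[OF S]] prod.union_disjoint[OF f(1,2) split(2)[OF S]])
    qed
    also have "(\<Prod>y\<in>\<pi> (fst s) ` I1. \<Omega> (map (\<lambda>i. Y i s (g i) y) [0..<k]))
       = complex_of_real (sqrt p) ^ (N * a) * (\<Prod>t<N. \<Prod>j<a. v (map (\<lambda>i. fst (g i t) j) [0..<k]))"
    proof -
      have "(\<Prod>y\<in>\<pi> (fst s) ` I1. \<Omega> (map (\<lambda>i. Y i s (g i) y) [0..<k])) = (\<Prod>y\<in>I1. \<Omega> (map (\<lambda>i. Y i s (g i) (\<pi> (fst s) y)) [0..<k]))"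
        by (simp add: prod.reindex[OF \<pi>(2)[OF S]])
      also have "\<dots> = (\<Prod>y\<in>I1. complex_of_real (sqrt p) * v (map (\<lambda>i. fst (g i (fst y)) (snd y)) [0..<k]))"
      proof (rule prod.cong[OF refl])
        fix y assume y: "y \<in> I1"
        have "map (\<lambda>i. fst (g i (fst y)) (snd y)) [0..<k] \<in> idxs ds"
          using Ag[OF gi] y len by (auto simp: idxs_def I1_def)
        then show "\<Omega> (map (\<lambda>i. Y i s (g i) (\<pi> (fst s) y)) [0..<k]) = complex_of_real (sqrt p) * v (map (\<lambda>i. fst (g i (fst y)) (snd y)) [0..<k])"
          unfolding Y1[OF s y] \<Omega>_def by (rule dsum_vec_left[OF le ne])
      qed
      also have "\<dots> = complex_of_real (sqrt p) ^ (N * a) * (\<Prod>y\<in>I1. v (map (\<lambda>i. fst (g i (fst y)) (snd y)) [0..<k]))"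
        using cI by (simp add: prod.distrib)
      finally show ?thesis by (simp add: I1_def prod.cartesian_product case_prod_unfold)
    qed
    also have "(\<Prod>y\<in>\<rho> (fst s) ` I2. \<Omega> (map (\<lambda>i. Y i s (g i) y) [0..<k]))
       = complex_of_real (sqrt (1 - p)) ^ (N * b) * (\<Prod>t<N. \<Prod>j<b. w (map (\<lambda>i. snd (g i t) j) [0..<k]))"
    proof -
      have "(\<Prod>y\<in>\<rho> (fst s) ` I2. \<Omega> (map (\<lambda>i. Y i s (g i) y) [0..<k])) = (\<Prod>y\<in>I2. \<Omega> (map (\<lambda>i. Y i s (g i) (\<rho> (fst s) y)) [0..<k]))"
        by (simp add: prod.reindex[OF \<rho>(2)[OF S]])
      also have "\<dots> = (\<Prod>y\<in>I2. complex_of_real (sqrt (1 - p)) * w (map (\<lambda>i. snd (g i (fst y)) (snd y)) [0..<k]))"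
      proof (rule prod.cong[OF refl])
        fix y assume y: "y \<in> I2"
        let ?m = "map (\<lambda>i. snd (g i (fst y)) (snd y)) [0..<k]"
        have m: "?m \<in> idxs es"
          using Ag2[OF gi] y len by (auto simp: idxs_def I2_def)
        have "map (\<lambda>i. ds ! i + snd (g i (fst y)) (snd y)) [0..<k] = shift ds ?m"
          using len by (intro nth_equalityI) (auto simp: shift_def)
        then show "\<Omega> (map (\<lambda>i. Y i s (g i) (\<rho> (fst s) y)) [0..<k]) = complex_of_real (sqrt (1 - p)) * w ?m"
          unfolding Y2[OF s y] \<Omega>_def using dsum_vec_right[OF le ne m] by simp
      qed
      also have "\<dots> = complex_of_real (sqrt (1 - p)) ^ (N * b) * (\<Prod>y\<in>I2. w (map (\<lambda>i. snd (g i (fst y)) (snd y)) [0..<k]))"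
        using cI by (simp add: prod.distrib)
      finally show ?thesis by (simp add: I2_def prod.cartesian_product case_prod_unfold)
    qed
    also have "(\<Prod>y\<in>U (fst s). \<Omega> (map (\<lambda>i. Y i s (g i) y) [0..<k])) = (\<Prod>y\<in>U (fst s). \<Omega> (snd s y))"
    proof (rule prod.cong[OF refl])
      fix y assume y: "y \<in> U (fst s)"
      have "length (snd s y) = k" using PiE_mem[OF sT(2)[OF s] y] len by (auto simp: Z_def idxs_def split: if_splits)
      then have "map (\<lambda>i. snd s y ! i) [0..<k] = snd s y" by (metis map_nth)
      then show "\<Omega> (map (\<lambda>i. Y i s (g i) y) [0..<k]) = \<Omega> (snd s y)" unfolding Y3[OF s y] by simp
    qed
    finally have 1: "W ?l = complex_of_real (sqrt p) ^ (N * a) * (\<Prod>t<N. \<Prod>j<a. v (map (\<lambda>i. fst (g i t) j) [0..<k]))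
       * (complex_of_real (sqrt (1 - p)) ^ (N * b) * (\<Prod>t<N. \<Prod>j<b. w (map (\<lambda>i. snd (g i t) j) [0..<k]))) * (\<Prod>y\<in>U (fst s). \<Omega> (snd s y))" .
    have 2: "X' g = (\<Prod>t<N. \<Prod>j<a. v (map (\<lambda>i. fst (g i t) j) [0..<k])) * (\<Prod>t<N. \<Prod>j<b. w (map (\<lambda>i. snd (g i t) j) [0..<k]))"
    proof -
      have "\<xi>' (\<lambda>i\<in>{..<k}. g i t) = (\<Prod>j<a. v (map (\<lambda>i. fst (g i t) j) [0..<k])) * (\<Prod>j<b. w (map (\<lambda>i. snd (g i t) j) [0..<k]))" for t
        unfolding \<xi>'_def
        by (intro arg_cong2[where f = "(*)"] prod.cong refl arg_cong[where f = v] arg_cong[where f = w] map_cong) auto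
      then show ?thesis by (simp add: X'_def prod.distrib)
    qed
    have "complex_of_real (sqrt P) * complex_of_real (1 / sqrt P * (sqrt p ^ (N * a) * sqrt (1 - p) ^ (N * b)))
       = complex_of_real (sqrt p) ^ (N * a) * complex_of_real (sqrt (1 - p)) ^ (N * b)"
    proof -
      have r: "sqrt P * (1 / sqrt P * (sqrt p ^ (N * a) * sqrt (1 - p) ^ (N * b))) = sqrt p ^ (N * a) * sqrt (1 - p) ^ (N * b)"
        using P0 by simp
      show ?thesis by (simp only: of_real_mult[symmetric] of_real_power[symmetric] r)
    qed
    then have "complex_of_real (sqrt P) * (cf s * X' g) = complex_of_real (sqrt p) ^ (N * a) * complex_of_real (sqrt (1 - p)) ^ (N * b) * (\<Prod>y\<in>U (fst s). \<Omega> (snd s y)) * X' g"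
      unfolding cf_def by (simp only: mult.assoc[symmetric])
    then show ?thesis unfolding 1 2 by (simp only: mult_ac)
  qed

  have "\<exists>out. is_state k B out \<and> reach d u B (\<lambda>z. \<exists>b. z = (\<lambda>x. b * out x)) \<and>
    (\<Sum>g\<in>PiE {..<k} A. (cmod (X' g))\<^sup>2) = 1 \<and>
    (\<forall>w. ip B w out = (\<Sum>s\<in>SS. \<Sum>g\<in>PiE {..<k} A. cnj (w (map (\<lambda>i. \<iota> i s (g i)) [0..<k])) * (cf s * X' g)))"
  \<comment> \<open>Party \<open>i\<close> reads the pattern and its own coordinate of each explicit
    multi-index; the parties together recover the label.\<close>
  proof (rule prep[where R = "2 ^ (c * N)" and \<rho> = "\<lambda>i s. (fst s, \<lambda>y\<in>U (fst s). snd s y ! i)"])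
    show "0 < k" "is_state k d u" "length B = k" "finite SS" "card SS \<le> 2 ^ (c * N)" "(\<Sum>s\<in>SS. (cmod (cf s))\<^sup>2) = 1"
      by (fact k_pos ust lenB finSS cardSS cf1)+
    show "rep k d u (\<lambda>i. {..<2 ^ (c * N) :: nat} \<times> A i)
      (\<lambda>f. if \<forall>i<k. fst (f i) = fst (f 0) then X' (\<lambda>i\<in>{..<k}. snd (f i)) / complex_of_real (sqrt (real (2 ^ (c * N)))) else 0)"
      using rep_src[OF rep_pair_pow[OF len, of a v b w], of N c] unfolding d_def u_def X_def x_def A_def X'_def \<xi>'_def .
    show "\<iota> i s g < B ! i" if "i < k" "s \<in> SS" "g \<in> A i" for i s g by (rule \<iota>(2)[OF that])
    show "inj_on (\<iota> i s) (A i)" if i: "i < k" and s: "s \<in> SS" for i s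
    proof (rule inj_onI)
      fix g g' assume g: "g \<in> A i" "g' \<in> A i" "\<iota> i s g = \<iota> i s g'"
      note S = sT(1)[OF s]
      have Y: "Y i s g y = Y i s g' y" if "y \<in> J" for y by (rule FY[OF i s s g that])
      have g1: "g \<in> PiE {..<N} (\<lambda>_. PiE {..<a} (\<lambda>_. {..<ds ! i}) \<times> PiE {..<b} (\<lambda>_. {..<es ! i}))"
        "g' \<in> PiE {..<N} (\<lambda>_. PiE {..<a} (\<lambda>_. {..<ds ! i}) \<times> PiE {..<b} (\<lambda>_. {..<es ! i}))"
        using g(1,2) unfolding A_def .
      show "g = g'"
      proof (rule PiE_ext[OF g1])
        fix t assume t: "t \<in> {..<N}"
        have m: "fst (g t) \<in> PiE {..<a} (\<lambda>_. {..<ds ! i})" "fst (g' t) \<in> PiE {..<a} (\<lambda>_. {..<ds ! i})"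
          "snd (g t) \<in> PiE {..<b} (\<lambda>_. {..<es ! i})" "snd (g' t) \<in> PiE {..<b} (\<lambda>_. {..<es ! i})"
          using PiE_mem[OF g1(1) t] PiE_mem[OF g1(2) t] by (simp_all only: mem_Times_iff)
        have "fst (g t) = fst (g' t)"
        proof (rule PiE_ext[OF m(1,2)])
          fix j assume j: "j \<in> {..<a}"
          have I: "(t, j) \<in> I1" using t j by (simp add: I1_def)
          have "\<pi> (fst s) (t, j) \<in> J" using \<pi>(1)[OF S] TJ(1)[OF S] I by blast
          from Y[OF this] show "fst (g t) j = fst (g' t) j" unfolding Y1[OF s I] by simp
        qed
        moreover have "snd (g t) = snd (g' t)"
        proof (rule PiE_ext[OF m(3,4)])
          fix j assume j: "j \<in> {..<b}"
          have I: "(t, j) \<in> I2" using t j by (simp add: I2_def)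
          have "\<rho> (fst s) (t, j) \<in> J" using \<rho>(1)[OF S] I by blast
          from Y[OF this] show "snd (g t) j = snd (g' t) j" unfolding Y2[OF s I] by simp
        qed
        ultimately show "g t = g' t" by (rule prod_eqI)
      qed
    qed
    show "(fst s, \<lambda>y\<in>U (fst s). snd s y ! i) = (fst s', \<lambda>y\<in>U (fst s'). snd s' y ! i)"
      if h: "i < k" "s \<in> SS" "s' \<in> SS" "g \<in> A i" "g' \<in> A i" "\<iota> i s g = \<iota> i s' g'" for i s s' g g'
    proof -
      have Y: "Y i s g y = Y i s' g' y" if "y \<in> J" for y by (rule FY[OF h that])
      have "y \<in> fst s \<longleftrightarrow> y \<in> fst s'" if y: "y \<in> J" for y
        using Yprop[OF h(1,2,4) y] Yprop[OF h(1,3,5) y] Y[OF y] by simp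
      then have fs: "fst s = fst s'" using TJ(1)[OF sT(1)[OF h(2)]] TJ(1)[OF sT(1)[OF h(3)]] by blast
      have "(\<lambda>y\<in>U (fst s). snd s y ! i) = (\<lambda>y\<in>U (fst s). snd s' y ! i)"
      proof (rule restrict_ext)
        fix y assume y: "y \<in> U (fst s)"
        then have "y \<in> J" by (simp add: U_def)
        from Y[OF this] show "snd s y ! i = snd s' y ! i"
          unfolding Y3[OF h(2) y] Y3[OF h(3) y[unfolded fs]] .
      qed
      then show ?thesis using fs by simp
    qed
    show "s = s'" if s: "s \<in> SS" "s' \<in> SS"
      and e: "\<And>i. i < k \<Longrightarrow> (fst s, \<lambda>y\<in>U (fst s). snd s y ! i) = (fst s', \<lambda>y\<in>U (fst s'). snd s' y ! i)" for s s'
    proof -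
      have fs: "fst s = fst s'" using e[OF k_pos] by simp
      have m: "snd s \<in> PiE (U (fst s)) (Z (fst s))" "snd s' \<in> PiE (U (fst s)) (Z (fst s))"
        using sT(2)[OF s(1)] sT(2)[OF s(2)] fs by simp_all
      have "snd s = snd s'"
      proof (rule PiE_ext[OF m])
        fix y assume y: "y \<in> U (fst s)"
        have l: "length z = k" if "z \<in> Z (fst s) y" for z using that len by (auto simp: Z_def idxs_def split: if_splits)
        show "snd s y = snd s' y"
        proof (rule nth_equalityI)
          show "length (snd s y) = length (snd s' y)" using l[OF PiE_mem[OF m(1) y]] l[OF PiE_mem[OF m(2) y]] by simp
          fix i assume "i < length (snd s y)"
          then have i: "i < k" using l[OF PiE_mem[OF m(1) y]] by simp
          have "(\<lambda>y\<in>U (fst s). snd s y ! i) = (\<lambda>y\<in>U (fst s). snd s' y ! i)" using e[OF i] fs by simp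
          from fun_cong[OF this, of y] show "snd s y ! i = snd s' y ! i" using y by simp
        qed
      qed
      with fs show ?thesis by (rule prod_eqI)
    qed
  qed
  then obtain out where out: "is_state k B out" "reach d u B (\<lambda>z. \<exists>b. z = (\<lambda>x. b * out x))"
    "(\<Sum>g\<in>PiE {..<k} A. (cmod (X' g))\<^sup>2) = 1"
    "\<And>w. ip B w out = (\<Sum>s\<in>SS. \<Sum>g\<in>PiE {..<k} A. cnj (w (map (\<lambda>i. \<iota> i s (g i)) [0..<k])) * (cf s * X' g))"
    by blast
  have "ip B W out = (\<Sum>s\<in>SS. \<Sum>g\<in>PiE {..<k} A. complex_of_real (sqrt P * ((cmod (cf s))\<^sup>2 * (cmod (X' g))\<^sup>2)))"
    unfolding out(4)
  proof (intro sum.cong refl)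
    fix s g assume sg: "s \<in> SS" "g \<in> PiE {..<k} A"
    show "cnj (W (map (\<lambda>i. \<iota> i s (g i)) [0..<k])) * (cf s * X' g) = complex_of_real (sqrt P * ((cmod (cf s))\<^sup>2 * (cmod (X' g))\<^sup>2))"
      unfolding Wlab[OF sg] by (simp only: of_real_mult complex_norm_square complex_cnj_mult complex_cnj_complex_of_real mult_ac)
  qed
  also have "\<dots> = complex_of_real (sqrt P * ((\<Sum>s\<in>SS. (cmod (cf s))\<^sup>2) * (\<Sum>g\<in>PiE {..<k} A. (cmod (X' g))\<^sup>2)))"
    unfolding sum_product by (simp only: of_real_sum of_real_mult sum_distrib_left)
  also have "\<dots> = complex_of_real (sqrt P)" unfolding cf1 out(3) by simp
  finally have "(cmod (ip B W out))\<^sup>2 = P" using P0 by simp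
  then show ?thesis using reach_eps_conv[OF out(2) ust out(1) Bst, of "sqrt (1 - P)"] by simp
qed

end

lemma h_nonneg: "0 \<le> p \<Longrightarrow> p \<le> 1 \<Longrightarrow> 0 \<le> h p"
proof -
  assume p: "0 \<le> p" "p \<le> 1"
  have "x * log 2 x \<le> 0" if "0 \<le> x" "x \<le> 1" for x :: real
    using that by (cases "x = 0") (auto intro!: mult_nonneg_nonpos)
  from this[of p] this[of "1 - p"] p show ?thesis by (simp add: h_def)
qed

text \<open>Passes from an estimate with bounded error to one for the rate.\<close>

lemma nonpos_if_multiples_bounded:
  fixes x K :: real
  assumes "\<And>n::nat. 0 < n \<Longrightarrow> real n * x \<le> K"
  shows "x \<le> 0"
proof (rule ccontr)
  assume "\<not> x \<le> 0"
  then have x: "0 < x" by simp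
  obtain n :: nat where n: "\<bar>K\<bar> / x < real n" using reals_Archimedean2 by blast
  have "0 \<le> \<bar>K\<bar> / x" using x by simp
  with n have "0 < n" by linarith
  have "\<bar>K\<bar> < real n * x" using n x by (simp add: divide_less_eq)
  with assms[OF \<open>0 < n\<close>] show False by linarith
qed

lemma restr_eq_self:
  assumes "blocks C v" "restr (\<lambda>i a. \<not> C i a) v = (\<lambda>_. 0)"
  shows "restr C v = v"
proof
  fix x
  show "restr C v x = v x"
    using assms(1) fun_cong[OF assms(2), of x] by (auto simp: restr_def blocks_def split: if_splits)
qed

section \<open>Asymptotic conversion into the direct sum\<close>

context ent_measure
begin

text \<open>Here \<open>n0\<close> is fixed and the number \<open>N\<close> of blocks grows, so the
  atypical weight tends to 0. Working with blocks of length \<open>n0\<close> gives source and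
  target the same number of copies, as \<open>asym_ge\<close> requires, although the rates are not
  integers.\<close>

lemma dsum_asym_ge:
  fixes a b c n0 D0 :: nat and p \<eta> :: real
  assumes v: "is_state k ds v" and w: "is_state k es w" and p: "0 < p" "p < 1" and \<eta>: "0 < \<eta>" and n0: "0 < n0"
    and a: "real a \<le> (p - \<eta>) * n0" and b: "real b \<le> (1 - p - \<eta>) * n0"
    and D0: "dimH ds \<le> D0" "dimH es \<le> D0"
    and c: "real n0 * (h p + \<eta> * (\<bar>log 2 p\<bar> + \<bar>log 2 (1 - p)\<bar>)) + real (n0 - a - b) * log 2 D0 \<le> c"
  defines "\<Omega> \<equiv> dsum_vec (complex_of_real (sqrt p)) ds v (complex_of_real (sqrt (1 - p))) es w"
    and "D \<equiv> dsum_dims ds es"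
    and "X \<equiv> tensor_dims (fst (tpow a ds v)) (fst (tpow b es w))"
    and "x \<equiv> tensor_vec (fst (tpow a ds v)) (snd (tpow a ds v)) (fst (tpow b es w)) (snd (tpow b es w))"
  shows "asym_ge (src_dims c X) (src_vec c X x) (fst (tpow n0 D \<Omega>)) (snd (tpow n0 D \<Omega>))"
proof -
  define f where "f = (\<lambda>n. INF \<epsilon>\<in>{\<epsilon>. 0 \<le> \<epsilon> \<and>
        eps_conv (fst (tpow n (src_dims c X) (src_vec c X x))) (proj (fst (tpow n (src_dims c X) (src_vec c X x))) (snd (tpow n (src_dims c X) (src_vec c X x))))
                 (fst (tpow n (fst (tpow n0 D \<Omega>)) (snd (tpow n0 D \<Omega>)))) (proj (fst (tpow n (fst (tpow n0 D \<Omega>)) (snd (tpow n0 D \<Omega>)))) (snd (tpow n (fst (tpow n0 D \<Omega>)) (snd (tpow n0 D \<Omega>))))) \<epsilon>}.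
        ereal \<epsilon>)"
  \<comment> \<open>Chebyshev's bound for \<open>N * n0\<close> positions is K / N.\<close>
  define K where "K = p * (1 - p) / (\<eta>\<^sup>2 * n0)"
  have K0: "0 \<le> K" using p \<eta> n0 by (simp add: K_def)
  have small: "f N \<le> ereal e" if e: "0 < e" and N: "K / min (e\<^sup>2) (1 / 2) < real N" for e N
  proof -
    \<comment> \<open>The bound 1/2 keeps \<open>P\<close> positive, and e^2 makes sqrt (1 - P) at
      most e.\<close>
    define m where "m = min (e\<^sup>2) (1 / 2)"
    have m: "0 < m" "m \<le> e\<^sup>2" "m < 1" using e by (auto simp: m_def)
    have "0 \<le> K / m" using K0 m by simp
    with N have N0: "0 < N" by (simp add: m_def)
    define J where "J = {..<N} \<times> {..<n0}"
    define P where "P = (\<Sum>S\<in>window J p \<eta>. weight J p S)"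
    have J: "finite J" "card J = N * n0" "0 < card J" using N0 n0 by (auto simp: J_def)
    have "p * (1 - p) / (\<eta>\<^sup>2 * real (card J)) = K / N" by (simp add: K_def J ac_simps)
    moreover have "K / N < m" using N m N0 by (simp add: m_def[symmetric] field_simps)
    ultimately have P: "1 - m < P"
      using sum_weight_window_ge[OF J(1,3) _ _ \<eta>, of p] p by (simp add: P_def)
    have P1: "P \<le> 1" unfolding P_def using J p by (intro sum_weight_window_le) auto
    have P0: "0 < P" using P m by simp
    have conv: "eps_conv (fst (tpow N (src_dims c X) (src_vec c X x))) (proj (fst (tpow N (src_dims c X) (src_vec c X x))) (snd (tpow N (src_dims c X) (src_vec c X x))))
                 (fst (tpow N (fst (tpow n0 D \<Omega>)) (snd (tpow n0 D \<Omega>)))) (proj (fst (tpow N (fst (tpow n0 D \<Omega>)) (snd (tpow n0 D \<Omega>)))) (snd (tpow N (fst (tpow n0 D \<Omega>)) (snd (tpow n0 D \<Omega>))))) (sqrt (1 - P))"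
      using dsum_typical_conv[OF v w p \<eta> a b D0 c, of N] P0 unfolding P_def J_def \<Omega>_def D_def X_def x_def by blast
    have "f N \<le> ereal (sqrt (1 - P))"
      unfolding f_def by (rule INF_lower) (use conv P1 in simp)
    also have "sqrt (1 - P) \<le> e" using P m e by (intro real_le_lsqrt) auto
    finally show ?thesis by simp
  qed
  have "limsup f \<le> 0"
  proof (rule ereal_le_epsilon2)
    fix e :: real assume e: "0 < e"
    obtain N0 :: nat where N0: "K / min (e\<^sup>2) (1 / 2) < real N0" using reals_Archimedean2 by blast
    have "eventually (\<lambda>N. f N \<le> ereal e) sequentially"
      unfolding eventually_sequentially
    proof (intro exI[where x = N0] allI impI)
      fix N assume "N0 \<le> N"
      then have "K / min (e\<^sup>2) (1 / 2) < real N" using N0 by linarith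
      then show "f N \<le> ereal e" by (rule small[OF e])
    qed
    then show "limsup f \<le> 0 + ereal e" by (simp add: Limsup_bounded)
  qed
  moreover have "0 \<le> limsup f"
  proof -
    have "0 \<le> f n" for n unfolding f_def by (auto intro!: INF_greatest)
    then have "0 \<le> liminf f" by (intro Liminf_bounded always_eventually allI)
    also have "\<dots> \<le> limsup f" by (rule Liminf_le_Limsup) simp
    finally show ?thesis .
  qed
  ultimately show ?thesis unfolding asym_ge_def f_def by (rule antisym)
qed

text \<open>By additivity the conversion gives n0 E(\<Omega>) \<le> a E(v) + b E(w) + c. The
  roundings of \<open>a\<close>, \<open>b\<close> and \<open>c\<close> cost a constant independent
  of n0, and the margin \<eta> costs a term linear in \<eta> n0. Letting n0 grow and then \<eta>
  tend to 0 gives the bound.\<close>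

lemma dsum_upper:
  assumes F: "E \<in> F_pure k" and v: "is_state k ds v" and w: "is_state k es w" and p: "0 < p" "p < 1"
  shows "Ev E (dsum_dims ds es) (dsum_vec (complex_of_real (sqrt p)) ds v (complex_of_real (sqrt (1 - p))) es w)
    \<le> p * Ev E ds v + (1 - p) * Ev E es w + h p"
proof -
  define D where "D = dsum_dims ds es"
  define \<Omega> where "\<Omega> = dsum_vec (complex_of_real (sqrt p)) ds v (complex_of_real (sqrt (1 - p))) es w"
  have \<Omega>: "is_state k D \<Omega>" unfolding \<Omega>_def D_def using v w k_pos p by (intro is_state_dsum) auto
  define C where "C = \<bar>log 2 p\<bar> + \<bar>log 2 (1 - p)\<bar>"
  \<comment> \<open>Any common bound for the two dimensions works: its logarithm is multiplied only
    by \<eta> and by constants that disappear per copy.\<close>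
  define D0 where "D0 = dimH ds * dimH es"
  have pos: "0 < dimH ds" "0 < dimH es" using is_state_dimH_pos v w by auto
  have D0: "dimH ds \<le> D0" "dimH es \<le> D0" using pos by (auto simp: D0_def)
  define L where "L = log 2 D0"
  have L0: "0 \<le> L" using pos by (simp add: L_def D0_def log_mult)
  have C0: "0 \<le> C" by (simp add: C_def)
  define R where "R = p * Ev E ds v + (1 - p) * Ev E es w + h p"
  have Ev0: "0 \<le> Ev E ds v" "0 \<le> Ev E es w" using E_nonneg v w by auto
  have h0: "0 \<le> h p" using h_nonneg p by simp
  \<comment> \<open>With \<eta> below p and 1 - p both rates are nonnegative, so the floors below
    are natural numbers.\<close>
  have step: "Ev E D \<Omega> - R - \<eta> * (C + 2 * L) \<le> 0" if \<eta>: "0 < \<eta>" "\<eta> < min p (1 - p)" for \<eta>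
  proof (rule nonpos_if_multiples_bounded)
    fix n0 :: nat assume n0: "0 < n0"
    define a where "a = nat \<lfloor>(p - \<eta>) * n0\<rfloor>"
    define b where "b = nat \<lfloor>(1 - p - \<eta>) * n0\<rfloor>"
    have nn: "0 \<le> (p - \<eta>) * n0" "0 \<le> (1 - p - \<eta>) * n0" using \<eta> by auto
    have a: "real a \<le> (p - \<eta>) * n0" "(p - \<eta>) * n0 - 1 \<le> real a"
      using nn unfolding a_def by (simp_all add: of_nat_nat, (linarith+)?)
    have b: "real b \<le> (1 - p - \<eta>) * n0" "(1 - p - \<eta>) * n0 - 1 \<le> real b"
      using nn unfolding b_def by (simp_all add: of_nat_nat, (linarith+)?)
    have "real a + real b \<le> n0 - 2 * \<eta> * n0" using a b by (simp add: algebra_simps)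
    then have "real a + real b \<le> n0" using \<eta> by (smt (verit) mult_nonneg_nonneg of_nat_0_le_iff)
    then have ab: "a + b \<le> n0" by linarith
    define m where "m = n0 - a - b"
    have "real m = n0 - real a - real b" using ab by (simp add: m_def)
    \<comment> \<open>The margin \<eta> and a floor enter twice, once for each summand.\<close>
    then have m: "real m \<le> 2 * \<eta> * n0 + 2" using a b by (simp add: algebra_simps)
    define y where "y = real n0 * (h p + \<eta> * C) + real m * L"
    have y0: "0 \<le> y" using h0 C0 L0 \<eta> by (simp add: y_def)
    define c where "c = nat \<lceil>y\<rceil>"
    have c: "y \<le> real c" "real c \<le> y + 1" using y0 unfolding c_def by (simp_all add: of_nat_nat, (linarith+)?)
    let ?X = "tensor_dims (fst (tpow a ds v)) (fst (tpow b es w))"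
    let ?x = "tensor_vec (fst (tpow a ds v)) (snd (tpow a ds v)) (fst (tpow b es w)) (snd (tpow b es w))"
    have xst: "is_state k ?X ?x" by (intro is_state_tensor is_state_tpow v w)
    have "asym_ge (src_dims c ?X) (src_vec c ?X ?x) (fst (tpow n0 D \<Omega>)) (snd (tpow n0 D \<Omega>))"
      unfolding D_def \<Omega>_def
      by (rule dsum_asym_ge[OF v w p \<eta>(1) n0 a(1) b(1) D0]) (use c(1) in \<open>simp add: y_def C_def L_def m_def\<close>)
    then have "Ev E (fst (tpow n0 D \<Omega>)) (snd (tpow n0 D \<Omega>)) \<le> Ev E (src_dims c ?X) (src_vec c ?X ?x)"
      using F is_state_tpow[OF \<Omega>] is_state_src[OF xst] unfolding F_pure_def by blast
    then have "n0 * Ev E D \<Omega> \<le> a * Ev E ds v + b * Ev E es w + c"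
      using E_tpow[OF \<Omega>] E_src[OF xst] E_tpow[OF v] E_tpow[OF w] E_tensor[OF is_state_tpow[OF v] is_state_tpow[OF w]] by simp
    also have "\<dots> \<le> (p * n0) * Ev E ds v + ((1 - p) * n0) * Ev E es w + (y + 1)"
    proof (intro add_mono mult_right_mono)
      have "0 \<le> \<eta> * n0" using \<eta> by simp
      then show "real a \<le> p * n0" "real b \<le> (1 - p) * n0" using a(1) b(1) by (simp_all add: algebra_simps)
    qed (use Ev0 c in auto)
    also have "y \<le> real n0 * (h p + \<eta> * C) + (2 * \<eta> * n0 + 2) * L"
      unfolding y_def using mult_right_mono[OF m L0] by simp
    finally have "n0 * Ev E D \<Omega> \<le> (p * n0) * Ev E ds v + ((1 - p) * n0) * Ev E es w + (real n0 * (h p + \<eta> * C) + (2 * \<eta> * n0 + 2) * L + 1)"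
      by simp
    then show "n0 * (Ev E D \<Omega> - R - \<eta> * (C + 2 * L)) \<le> 2 * L + 1"
      by (simp add: R_def algebra_simps)
  qed
  have "((\<lambda>\<eta>. R + \<eta> * (C + 2 * L)) \<longlongrightarrow> R + 0 * (C + 2 * L)) (at_right 0)" by (intro tendsto_intros)
  moreover have "eventually (\<lambda>\<eta>. Ev E D \<Omega> \<le> R + \<eta> * (C + 2 * L)) (at_right 0)"
    unfolding eventually_at_right_field using step p by (intro exI[where x = "min p (1 - p)"]) force
  ultimately have "Ev E D \<Omega> \<le> R + 0 * (C + 2 * L)" by (rule tendsto_lowerbound) simp
  then show ?thesis by (simp add: R_def D_def \<Omega>_def)
qed

text \<open>For 0 < p < 1 the two bounds meet. At the end points, where counting typical patterns
  would involve the logarithm of 0, the direct sum lies in a single block and its value is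
  known.\<close>

lemma F_pure_imp_dsum_rule:
  assumes F: "E \<in> F_pure k" shows "dsum_rule k E"
  unfolding dsum_rule_def
proof (intro allI impI)
  fix ds v es w and p :: real
  assume v: "is_state k ds v" and w: "is_state k es w" and p: "0 \<le> p" "p \<le> 1"
  define D where "D = dsum_dims ds es"
  define \<Omega> where "\<Omega> = dsum_vec (complex_of_real (sqrt p)) ds v (complex_of_real (sqrt (1 - p))) es w"
  have \<Omega>: "is_state k D \<Omega>" unfolding \<Omega>_def D_def using v w k_pos p by (intro is_state_dsum) auto
  have on: "vec_on D \<Omega>" and n1: "sqn D \<Omega> = 1" and len: "length D = k" using \<Omega> by (auto simp: is_state_iff)
  let ?C = "dsum_colour ds"
  note parts = dsum_parts[OF v w p, folded D_def \<Omega>_def]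
  have q: "sqn D (restr (\<lambda>i a. \<not> ?C i a) \<Omega>) = 1 - p"
    using sqn_parts[OF parts(1), of D] len k_pos n1 parts(4) by simp
  consider "p = 0" | "p = 1" | "0 < p" "p < 1" using p by linarith
  then have "Ev E D \<Omega> = p * Ev E ds v + (1 - p) * Ev E es w + h p"
  proof cases
    case 1
    have "restr ?C \<Omega> = (\<lambda>_. 0)" using parts(4) 1 sqn_eq_0[OF vec_on_restr[OF on]] by simp
    moreover have "blocks (\<lambda>i a. \<not> ?C i a) \<Omega>" using parts(1) by (auto simp: blocks_def)
    ultimately have "restr (\<lambda>i a. \<not> ?C i a) \<Omega> = \<Omega>" by (intro restr_eq_self) simp_all
    then show ?thesis using parts(3) 1 Eb_state[OF \<Omega>] by simp
  next
    case 2
    have "restr (\<lambda>i a. \<not> ?C i a) \<Omega> = (\<lambda>_. 0)" using q 2 sqn_eq_0[OF vec_on_restr[OF on]] by simp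
    then have "restr ?C \<Omega> = \<Omega>" by (rule restr_eq_self[OF parts(1)])
    then show ?thesis using parts(2) 2 Eb_state[OF \<Omega>] by simp
  next
    case 3
    show ?thesis
      using dsum_upper[OF F v w 3] dsum_lower[OF v w p] unfolding D_def \<Omega>_def by (rule antisym)
  qed
  then show "Ev E (dsum_dims ds es) (dsum_vec (complex_of_real (sqrt p)) ds v (complex_of_real (sqrt (1 - p))) es w)
     = p * Ev E ds v + (1 - p) * Ev E es w + h p"
    by (simp only: D_def \<Omega>_def)
qed

end

theorem mainTheorem8:
  fixes k :: nat and E :: entfun
  assumes "2 \<le> k"
    and "fully_additive k E"
    and "mono_on_average k E"
    and "Ev E (ghz_dims k) (ghz_vec k) = 1"
  shows "(asym_continuous k E \<longleftrightarrow> E \<in> F_pure k)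
       \<and> (E \<in> F_pure k \<longleftrightarrow> dsum_rule k E)
       \<and> (dsum_rule k E \<longleftrightarrow> cont_bound k E)"
proof -
  interpret ent_measure k E using assms by unfold_locales
  have "asym_continuous k E \<Longrightarrow> E \<in> F_pure k" by (rule asym_continuous_imp_F_pure)
  moreover have "E \<in> F_pure k \<Longrightarrow> dsum_rule k E" by (rule F_pure_imp_dsum_rule)
  moreover have "dsum_rule k E \<Longrightarrow> cont_bound k E" by (rule dsum_rule_imp_cont_bound[OF _ E_le_log_dimH])
  moreover have "cont_bound k E \<Longrightarrow> asym_continuous k E" by (rule cont_bound_imp_asym_continuous)
  ultimately show ?thesis by blast
qed

end
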